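(* Let $H=H(\mathcal D)$ be the Hopf algebra of a simply linked datum of nilpotent type (see context). For $\gamma\in\widehat G$ let $C(\gamma)=H\rightharpoonup\gamma\leftharpoonup H$, a subcoalgebra of $H^*$. The family $\{C(\gamma)\mid\gamma\in\widehat G\}$ contains every simple subcoalgebra of $H^*$. Thus $$\mathrm{corad}(H^* )=\sum_{\gamma\in\widehat G}C(\gamma).$$
   Context: $\Bbbk$ is a field of characteristic $0$ containing all roots of $1$, $G$ a finite abelian group, $\widehat G=\mathrm{Hom}(G,\Bbbk^\times)$, $\underline n=\{1,\dots,n\}$. Datum and $H$: $a_i,b_i\in G$, $\chi_i\in\widehat G$ ($i\in\underline n$) satisfy $a_ib_i\ne 1$ for all $i$; $\chi_j(a_i)=\chi_i(b_j)$ for all $i,j$; $\chi_i(a_j)\chi_j(a_i)=1$ and $\chi_i(b_j)\chi_j(b_i)=1$ for all $i\neq j$. Put $q_{ij}=\chi_j(a_i)$, $q_i=\chi_i(a_i)$, $m_i$ = the multiplicative order of $q_i$, with $m_i\ge 2$. $H=H(\mathcal D)$ is the Hopf algebra generated by $G$ and $x_i,y_i$ ($i\in\underline n$) with the relations of $G$ and: $gx_i=\chi_i(g)x_ig$, $gy_i=\chi_i^{-1}(g)y_ig$ for $g\in G$; $x_ix_j=q_{ij}x_jx_i$, $y_iy_j=q_{ij}y_jy_i$ for $i\ne j$; $x_iy_j-q_{ij}^{-1}y_jx_i=\delta_{ij}(a_ib_i-1)$ for all $i,j$; $x_i^{m_i}=0=y_i^{m_i}$. Elements of $G$ are grouplike,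 $\Delta x_i=a_i\otimes x_i+x_i\otimes 1$, $\Delta y_i=b_i\otimes y_i+y_i\otimes 1$. The elements $x^{\underline i}y^{\underline j}g$ ($0\le i_k,j_k<m_k$, $g\in G$; $x^{\underline i}=x_1^{i_1}\cdots x_n^{i_n}$ etc.) form a basis of $H$. Each $\gamma\in\widehat G$ is regarded as an element of $H^*$ by $\gamma(x^{\underline i}y^{\underline j}g)=\delta_{\underline0,\underline i}\delta_{\underline0,\underline j}\gamma(g)$. The actions of $H$ on $H^*$ are $(h\rightharpoonup\alpha)(k)=\alpha(kh)$ and $(\alpha\leftharpoonup h)(k)=\alpha(hk)$ for $h,k\in H$, $\alpha\in H^*$. $\mathrm{corad}(H^* )$ is the coradical, i.e. the sum of all simple subcoalgebras of $H^*$. *)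

theory Defs
  imports
    "HOL-Algebra.QuotRing"
    "HOL-Algebra.Module"
    "HOL-Algebra.Multiplicative_Group"
    "HOL-Algebra.Algebraic_Closure_Type"
    "HOL-Library.Poly_Mapping"
    "HOL-Library.Function_Algebras"
begin

section \<open>Fields\<close>

definition contains_roots_of_unity :: "'k::field itself \<Rightarrow> bool" where
  "contains_roots_of_unity _ \<longleftrightarrow>
     (\<forall>z :: 'k alg_closure. (\<exists>m>0. z ^ m = 1) \<longrightarrow> z \<in> range to_ac)"

definition unit_group :: "'k::field monoid" where
  "unit_group = units_of ring_of_type_algebra"

section \<open>Dual coalgebra of an algebra\<close>

text \<open>
  An algebra over the field \<open>'k\<close> is a record of type \<open>('k, 'h) module\<close>, i.e. a ring
  with a scalar multiplication. A functional on such an algebra is a function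
  \<open>'h \<Rightarrow> 'k\<close> vanishing outside the carrier, so that vector space operations on functionals
  are the pointwise ones.
\<close>

definition fscale :: "'k::field \<Rightarrow> ('x \<Rightarrow> 'k) \<Rightarrow> 'x \<Rightarrow> 'k" where
  "fscale c f = (\<lambda>x. c * f x)"

global_interpretation fun_space: vector_space "fscale :: 'k::field \<Rightarrow> ('x \<Rightarrow> 'k) \<Rightarrow> 'x \<Rightarrow> 'k"
  by unfold_locales (auto simp: fscale_def fun_eq_iff algebra_simps)

definition dual :: "('k::field, 'h) module \<Rightarrow> ('h \<Rightarrow> 'k) set" where
  "dual A = {\<alpha>. (\<forall>h. h \<notin> carrier A \<longrightarrow> \<alpha> h = 0)
     \<and> (\<forall>h\<in>carrier A. \<forall>k\<in>carrier A. \<alpha> (h \<oplus>\<^bsub>A\<^esub> k) = \<alpha> h + \<alpha> k)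
     \<and> (\<forall>c. \<forall>h\<in>carrier A. \<alpha> (c \<odot>\<^bsub>A\<^esub> h) = c * \<alpha> h)}"

text \<open>
  The tensor product of two spaces of functionals is realised inside the functions of two
  arguments, \<open>\<beta> \<otimes> \<gamma>\<close> being the function \<open>(h, k) \<mapsto> \<beta> h * \<gamma> k\<close>; over a field this
  identification is injective. For a finite-dimensional algebra the comultiplication of the
  dual, the transpose of multiplication, takes values in the tensor square of the dual.
\<close>

definition tensor :: "('h \<Rightarrow> 'k::field) set \<Rightarrow> ('h \<Rightarrow> 'k) set \<Rightarrow> ('h \<times> 'h \<Rightarrow> 'k) set" where
  "tensor B C = fun_space.span {(\<lambda>(h, k). \<beta> h * \<gamma> k) | \<beta> \<gamma>. \<beta> \<in> B \<and> \<gamma> \<in> C}"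

definition dual_comult :: "('k::field, 'h) module \<Rightarrow> ('h \<Rightarrow> 'k) \<Rightarrow> 'h \<times> 'h \<Rightarrow> 'k" where
  "dual_comult A \<alpha> =
     (\<lambda>(h, k). if h \<in> carrier A \<and> k \<in> carrier A then \<alpha> (h \<otimes>\<^bsub>A\<^esub> k) else 0)"

definition subcoalgebra :: "('k::field, 'h) module \<Rightarrow> ('h \<Rightarrow> 'k) set \<Rightarrow> bool" where
  "subcoalgebra A C \<longleftrightarrow> C \<subseteq> dual A \<and> fun_space.subspace C \<and> dual_comult A ` C \<subseteq> tensor C C"

definition simple_subcoalgebra :: "('k::field, 'h) module \<Rightarrow> ('h \<Rightarrow> 'k) set \<Rightarrow> bool" where
  "simple_subcoalgebra A C \<longleftrightarrow> subcoalgebra A C \<and> C \<noteq> {0}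
     \<and> (\<forall>B. subcoalgebra A B \<and> B \<subseteq> C \<longrightarrow> B = {0} \<or> B = C)"

definition sum_of_subspaces :: "('x \<Rightarrow> 'k::field) set set \<Rightarrow> ('x \<Rightarrow> 'k) set" where
  "sum_of_subspaces \<S> = fun_space.span (\<Union>\<S>)"

definition corad :: "('k::field, 'h) module \<Rightarrow> ('h \<Rightarrow> 'k) set" where
  "corad A = sum_of_subspaces {C. simple_subcoalgebra A C}"

definition left_act :: "('k::field, 'h) module \<Rightarrow> 'h \<Rightarrow> ('h \<Rightarrow> 'k) \<Rightarrow> 'h \<Rightarrow> 'k" where
  "left_act A h \<alpha> = (\<lambda>k. if k \<in> carrier A then \<alpha> (k \<otimes>\<^bsub>A\<^esub> h) else 0)"

definition right_act :: "('k::field, 'h) module \<Rightarrow> ('h \<Rightarrow> 'k) \<Rightarrow> 'h \<Rightarrow> 'h \<Rightarrow> 'k" where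
  "right_act A \<alpha> h = (\<lambda>k. if k \<in> carrier A then \<alpha> (h \<otimes>\<^bsub>A\<^esub> k) else 0)"

text \<open>\<open>A \<rightharpoonup> \<alpha> \<leftharpoonup> A\<close>, as usual the linear span of all \<open>h \<rightharpoonup> \<alpha> \<leftharpoonup> k\<close>.\<close>

definition bi_orbit :: "('k::field, 'h) module \<Rightarrow> ('h \<Rightarrow> 'k) \<Rightarrow> ('h \<Rightarrow> 'k) set" where
  "bi_orbit A \<alpha> = fun_space.span
     {right_act A (left_act A h \<alpha>) k | h k. h \<in> carrier A \<and> k \<in> carrier A}"

section \<open>Free algebras\<close>

text \<open>
  Words form the free monoid, written additively because the convolution product of
  \<open>Poly_Mapping\<close> uses \<open>monoid_add\<close> for exponents. Hence \<open>'s fword \<Rightarrow>\<^sub>0 'k\<close>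
  is the free associative unital algebra on \<open>'s\<close>.
\<close>

datatype 's fword = Word (letters: "'s list")

instantiation fword :: (type) monoid_add
begin

definition zero_fword :: "'a fword" where
  "zero_fword = Word []"

definition plus_fword :: "'a fword \<Rightarrow> 'a fword \<Rightarrow> 'a fword" where
  "plus_fword u v = Word (letters u @ letters v)"

instance
  by standard (auto simp: zero_fword_def plus_fword_def)

end

type_synonym ('s, 'k) free_algebra = "'s fword \<Rightarrow>\<^sub>0 'k"

definition fvar :: "'s \<Rightarrow> ('s, 'k::field) free_algebra" where
  "fvar s = Poly_Mapping.single (Word [s]) 1"

definition fconst :: "'k::field \<Rightarrow> ('s, 'k) free_algebra" where
  "fconst c = Poly_Mapping.single 0 c"

definition free_algebra_on :: "'s set \<Rightarrow> ('s, 'k::field) free_algebra ring" where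
  "free_algebra_on S = ring_of_type_algebra
     \<lparr>carrier := {f. \<forall>w\<in>Poly_Mapping.keys f. set (letters w) \<subseteq> S}\<rparr>"

section \<open>The Hopf algebra of a simply linked datum of nilpotent type\<close>

record ('g, 'k) datum =
  grp :: "'g monoid"
  rank :: nat
  aa :: "nat \<Rightarrow> 'g"
  bb :: "nat \<Rightarrow> 'g"
  chi :: "nat \<Rightarrow> 'g \<Rightarrow> 'k"

definition characters :: "('g, 'k::field) datum \<Rightarrow> ('g \<Rightarrow> 'k) set" where
  "characters D = hom (grp D) unit_group"

definition qq :: "('g, 'k::field) datum \<Rightarrow> nat \<Rightarrow> nat \<Rightarrow> 'k" where
  "qq D i j = chi D j (aa D i)"

definition mm :: "('g, 'k::field) datum \<Rightarrow> nat \<Rightarrow> nat" where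
  "mm D i = group.ord unit_group (qq D i i)"

locale simply_linked_nilpotent_datum =
  fixes D :: "('g, 'k::field) datum"
  assumes comm_group: "comm_group (grp D)"
    and finite_group: "finite (carrier (grp D))"
    and a_closed: "i \<in> {1..rank D} \<Longrightarrow> aa D i \<in> carrier (grp D)"
    and b_closed: "i \<in> {1..rank D} \<Longrightarrow> bb D i \<in> carrier (grp D)"
    and chi_closed: "i \<in> {1..rank D} \<Longrightarrow> chi D i \<in> characters D"
    and ab_nontriv: "i \<in> {1..rank D} \<Longrightarrow> aa D i \<otimes>\<^bsub>grp D\<^esub> bb D i \<noteq> \<one>\<^bsub>grp D\<^esub>"
    and chi_a_b: "i \<in> {1..rank D} \<Longrightarrow> j \<in> {1..rank D} \<Longrightarrow> chi D j (aa D i) = chi D i (bb D j)"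
    and chi_a: "i \<in> {1..rank D} \<Longrightarrow> j \<in> {1..rank D} \<Longrightarrow> i \<noteq> j \<Longrightarrow>
          chi D i (aa D j) * chi D j (aa D i) = 1"
    and chi_b: "i \<in> {1..rank D} \<Longrightarrow> j \<in> {1..rank D} \<Longrightarrow> i \<noteq> j \<Longrightarrow>
          chi D i (bb D j) * chi D j (bb D i) = 1"
    and m_ge_2: "i \<in> {1..rank D} \<Longrightarrow> 2 \<le> mm D i"

datatype 'g gen = GenG 'g | GenX nat | GenY nat

abbreviation var_g :: "'g \<Rightarrow> ('g gen, 'k::field) free_algebra" where
  "var_g g \<equiv> fvar (GenG g)"

abbreviation var_x :: "nat \<Rightarrow> ('g gen, 'k::field) free_algebra" where
  "var_x i \<equiv> fvar (GenX i)"

abbreviation var_y :: "nat \<Rightarrow> ('g gen, 'k::field) free_algebra" where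
  "var_y i \<equiv> fvar (GenY i)"

definition generators :: "('g, 'k::field) datum \<Rightarrow> 'g gen set" where
  "generators D = GenG ` carrier (grp D) \<union> GenX ` {1..rank D} \<union> GenY ` {1..rank D}"

definition free_alg :: "('g, 'k::field) datum \<Rightarrow> ('g gen, 'k) free_algebra ring" where
  "free_alg D = free_algebra_on (generators D)"

text \<open>A relation \<open>u = v\<close> is encoded as the element \<open>u - v\<close>.\<close>

definition relations :: "('g, 'k::field) datum \<Rightarrow> ('g gen, 'k) free_algebra set" where
  "relations D =
     {var_g \<one>\<^bsub>grp D\<^esub> - 1}
   \<union> {var_g g * var_g h - var_g (g \<otimes>\<^bsub>grp D\<^esub> h) | g h.
        g \<in> carrier (grp D) \<and> h \<in> carrier (grp D)}
   \<union> {var_g g * var_x i - fconst (chi D i g) * var_x i * var_g g | g i.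
        g \<in> carrier (grp D) \<and> i \<in> {1..rank D}}
   \<union> {var_g g * var_y i - fconst (inverse (chi D i g)) * var_y i * var_g g | g i.
        g \<in> carrier (grp D) \<and> i \<in> {1..rank D}}
   \<union> {var_x i * var_x j - fconst (qq D i j) * var_x j * var_x i | i j.
        i \<in> {1..rank D} \<and> j \<in> {1..rank D} \<and> i \<noteq> j}
   \<union> {var_y i * var_y j - fconst (qq D i j) * var_y j * var_y i | i j.
        i \<in> {1..rank D} \<and> j \<in> {1..rank D} \<and> i \<noteq> j}
   \<union> {var_x i * var_y j - fconst (inverse (qq D i j)) * var_y j * var_x i
        - (if i = j then var_g (aa D i \<otimes>\<^bsub>grp D\<^esub> bb D i) - 1 else 0) | i j.
        i \<in> {1..rank D} \<and> j \<in> {1..rank D}}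
   \<union> {var_x i ^ mm D i | i. i \<in> {1..rank D}}
   \<union> {var_y i ^ mm D i | i. i \<in> {1..rank D}}"

definition rel_ideal :: "('g, 'k::field) datum \<Rightarrow> ('g gen, 'k) free_algebra set" where
  "rel_ideal D = Idl\<^bsub>free_alg D\<^esub> (relations D)"

definition cls :: "('g, 'k::field) datum \<Rightarrow> ('g gen, 'k) free_algebra \<Rightarrow> ('g gen, 'k) free_algebra set" where
  "cls D f = rel_ideal D +>\<^bsub>free_alg D\<^esub> f"

text \<open>
  Only the algebra structure of \<open>H(D)\<close> is recorded: the coalgebra \<open>H\<^sup>*\<close> (its comultiplication,
  its subcoalgebras and its coradical) and the two actions of \<open>H\<close> on it depend only on the
  multiplication of \<open>H\<close>, not on its comultiplication.
\<close>

definition hopf_alg :: "('g, 'k::field) datum \<Rightarrow> ('k, ('g gen, 'k) free_algebra set) module" where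
  "hopf_alg D = ring.extend (free_alg D Quot rel_ideal D)
     (module.fields (\<lambda>c h. cls D (fconst c) \<otimes>\<^bsub>free_alg D Quot rel_ideal D\<^esub> h))"

definition exponents :: "('g, 'k::field) datum \<Rightarrow> (nat \<Rightarrow> nat) set" where
  "exponents D = {e. \<forall>k\<in>{1..rank D}. e k < mm D k}"

definition monomial ::
    "('g, 'k::field) datum \<Rightarrow> (nat \<Rightarrow> nat) \<Rightarrow> (nat \<Rightarrow> nat) \<Rightarrow> 'g \<Rightarrow> ('g gen, 'k) free_algebra set" where
  "monomial D e f g = cls D
     ((\<Prod>k\<leftarrow>[1..<Suc (rank D)]. var_x k ^ e k) *
      (\<Prod>k\<leftarrow>[1..<Suc (rank D)]. var_y k ^ f k) * var_g g)"

text \<open>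
  The functional on \<open>H(D)\<close> given by a character \<open>\<gamma>\<close>; it exists and is unique because the
  monomials form a basis of \<open>H(D)\<close>. Only the values of \<open>\<gamma>\<close> on the carrier of the group matter.
\<close>

definition char_functional ::
    "('g, 'k::field) datum \<Rightarrow> ('g \<Rightarrow> 'k) \<Rightarrow> ('g gen, 'k) free_algebra set \<Rightarrow> 'k" where
  "char_functional D \<gamma> = (THE \<alpha>. \<alpha> \<in> dual (hopf_alg D) \<and>
     (\<forall>e\<in>exponents D. \<forall>f\<in>exponents D. \<forall>g\<in>carrier (grp D).
        \<alpha> (monomial D e f g) =
          (if (\<forall>k\<in>{1..rank D}. e k = 0) \<and> (\<forall>k\<in>{1..rank D}. f k = 0) then \<gamma> g else 0)))"

definition C_of :: "('g, 'k::field) datum \<Rightarrow> ('g \<Rightarrow> 'k) \<Rightarrow> (('g gen, 'k) free_algebra set \<Rightarrow> 'k) set" where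
  "C_of D \<gamma> = bi_orbit (hopf_alg D) (char_functional D \<gamma>)"

end

theory Submission
  imports Defs
begin

text \<open>
  A subcoalgebra of \<open>H\<^sup>*\<close> is a subspace stable under both actions \<open>\<rightharpoonup>\<close> and \<open>\<leftharpoonup>\<close>, because
  the comultiplication of \<open>H\<^sup>*\<close> is the transpose of the product; for a finite-dimensional
  subspace the converse holds (\<open>subcoalgebra_stable\<close>, \<open>stable_imp_subcoalgebra\<close>). The theorem is
  therefore a statement about sub-bimodules of \<open>H\<^sup>*\<close>: the simple ones are exactly the bimodules
  \<open>C(\<gamma>)\<close> generated by the characters \<open>\<gamma>\<close> of the group.

  The functional \<open>\<gamma>\<close> satisfies \<open>\<gamma> \<leftharpoonup> x\<^sub>i = 0\<close>, \<open>y\<^sub>i \<rightharpoonup> \<gamma> = 0\<close> and \<open>g \<rightharpoonup> \<gamma> = \<gamma>(g) \<gamma>\<close>, and since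
  \<open>H\<close> is spanned by products \<open>x \<cdots> x y \<cdots> y g\<close>, these equations determine it up to a scalar
  (\<open>lowest_functional_unique\<close>). It exists because \<open>H\<close> has a Verma module with a basis of ordered
  \<open>x\<close>-monomials, on which \<open>\<gamma>(h)\<close> is the coefficient of the generating vector \<open>v\<close> in \<open>h v\<close>.

  Every nonzero sub-bimodule \<open>B\<close> contains such a functional: long words in the \<open>y\<^sub>i\<close>, and long
  words in the \<open>x\<^sub>i\<close>, vanish in \<open>H\<close>, so a longest word acting nontrivially produces an element
  killed by all \<open>y\<^sub>i\<close> from the left, and later one killed by all \<open>x\<^sub>i\<close> from the right; in between,
  the finite abelian group is diagonalised with the roots of unity of the field
  (\<open>char_functional_exists_in_subbimodule\<close>). Hence \<open>B\<close> contains some \<open>C(\<gamma>)\<close>, and a simple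
  subcoalgebra is equal to it.

  Conversely \<open>C(\<gamma>)\<close> is simple. Its left submodule \<open>S = H \<rightharpoonup> \<gamma>\<close> is simple by a Nakayama argument:
  a nonzero element of \<open>S\<close> can be moved to one of the form \<open>c \<gamma> + \<nu>\<close> with \<open>c \<noteq> 0\<close> and \<open>\<nu>\<close> in the span of
  all \<open>w \<rightharpoonup> \<gamma>\<close> for nonempty \<open>x\<close>-words \<open>w\<close>, and these words are nilpotent (\<open>L_\<Gamma>_inverse\<close>). An element
  of a nonzero sub-bimodule \<open>B\<close> of \<open>C(\<gamma>)\<close> is a sum of terms \<open>s \<leftharpoonup> k\<close> with \<open>s\<close> in \<open>S\<close>; if it is
  nonzero and the number of terms is minimal, one of its translates is killed by everything that
  kills \<open>\<gamma>\<close> (\<open>annihilated_vector\<close>). From there right multiplication by \<open>x\<close>-words leads to \<open>\<gamma>\<close>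
  itself, so \<open>B = C(\<gamma>)\<close>.
\<close>

section \<open>Subcoalgebras of a dual and stable subspaces\<close>

lemma zero_fun_eq: "(0 :: 'x \<Rightarrow> 'k::field) = (\<lambda>_. 0)"
  by (auto simp: fun_eq_iff)

lemma tensor_slices:
  assumes C: "fun_space.subspace C" and F: "F \<in> tensor C C"
  shows "(\<lambda>k. F (k, h)) \<in> C" "(\<lambda>k. F (h, k)) \<in> C"
proof -
  have "(\<lambda>k. F (k, h)) \<in> C \<and> (\<lambda>k. F (h, k)) \<in> C"
    using F unfolding tensor_def
  proof (induction rule: fun_space.span_induct_alt)
    case base
    show ?case using fun_space.subspace_0[OF C] by (simp add: zero_fun_eq)
  next
    case (step c x y)
    then obtain \<beta> \<gamma> where x: "x = (\<lambda>(h, k). \<beta> h * \<gamma> k)" and m: "\<beta> \<in> C" "\<gamma> \<in> C" by blast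
    have 1: "(\<lambda>k. (fscale c x + y) (k, h)) = fscale (c * \<gamma> h) \<beta> + (\<lambda>k. y (k, h))"
      and 2: "(\<lambda>k. (fscale c x + y) (h, k)) = fscale (c * \<beta> h) \<gamma> + (\<lambda>k. y (h, k))"
      by (auto simp: x fscale_def fun_eq_iff)
    show ?case unfolding 1 2 using step m C
      by (auto intro!: fun_space.subspace_add fun_space.subspace_scale)
  qed
  thus "(\<lambda>k. F (k, h)) \<in> C" "(\<lambda>k. F (h, k)) \<in> C" by auto
qed

text \<open>
  The translates of \<open>\<alpha>\<close> are the rows and columns of its comultiplication.
\<close>

lemma subcoalgebra_stable:
  assumes C: "subcoalgebra A C" and "\<alpha> \<in> C" and h: "h \<in> carrier A"
  shows "left_act A h \<alpha> \<in> C" "right_act A \<alpha> h \<in> C"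
proof -
  have t: "dual_comult A \<alpha> \<in> tensor C C" and s: "fun_space.subspace C"
    using assms by (auto simp: subcoalgebra_def)
  have "left_act A h \<alpha> = (\<lambda>k. dual_comult A \<alpha> (k, h))"
    "right_act A \<alpha> h = (\<lambda>k. dual_comult A \<alpha> (h, k))"
    using h by (auto simp: left_act_def right_act_def dual_comult_def)
  thus "left_act A h \<alpha> \<in> C" "right_act A \<alpha> h \<in> C" using tensor_slices[OF s t] by auto
qed


lemma sum_list_in_subspace:
  "fun_space.subspace C \<Longrightarrow> (\<And>x. x \<in> set xs \<Longrightarrow> f x \<in> C) \<Longrightarrow> (\<Sum>x\<leftarrow>xs. f x) \<in> C"
  by (induction xs) (auto intro: fun_space.subspace_add fun_space.subspace_0)

lemma sum_list_fun_apply: "(\<Sum>x\<leftarrow>xs. f x) a = (\<Sum>x\<leftarrow>xs. f x a :: 'k::field)"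
  by (induction xs) auto

text \<open>
  Gaussian elimination for functions: a nonzero member is normalised at a point \<open>p\<close>, and the
  members vanishing at \<open>p\<close> form a smaller subspace. The number \<open>n\<close> bounds the sizes of independent
  subsets and drops by one, since that member is independent of the subspace.
\<close>

lemma dual_points_aux:
  fixes C :: "('x \<Rightarrow> 'k::field) set"
  assumes "fun_space.subspace C"
    and "\<And>B. B \<subseteq> C \<Longrightarrow> \<not> fun_space.dependent B \<Longrightarrow> finite B \<and> card B \<le> n"
  shows "\<exists>ps. snd ` set ps \<subseteq> C \<and> (\<forall>f\<in>C. f = (\<Sum>(p, c)\<leftarrow>ps. fscale (f p) c))"
  using assms
proof (induction n arbitrary: C)
  case 0
  have "f = 0" if "f \<in> C" for f
  proof (rule ccontr)
    assume "f \<noteq> 0"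
    hence "\<not> fun_space.dependent {f}" by simp
    thus False using 0(2)[of "{f}"] that by auto
  qed
  thus ?case by (intro exI[of _ "[]"]) (auto simp: zero_fun_eq)
next
  case (Suc n)
  note C = Suc.prems(1)
  show ?case
  proof (cases "C \<subseteq> {0}")
    case True
    thus ?thesis by (intro exI[of _ "[]"]) (auto simp: zero_fun_eq)
  next
    case False
    then obtain f1 where f1: "f1 \<in> C" "f1 \<noteq> 0" by auto
    then obtain p where p: "f1 p \<noteq> 0" by (auto simp: fun_eq_iff)
    define f0 where "f0 = fscale (inverse (f1 p)) f1"
    have f0: "f0 \<in> C" "f0 p = 1"
      using f1 p C unfolding f0_def by (auto intro: fun_space.subspace_scale) (simp add: fscale_def)
    define C' where "C' = {f \<in> C. f p = 0}"
    have C': "fun_space.subspace C'"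
      using C unfolding C'_def fun_space.subspace_def by (auto simp: fscale_def)
    have bound: "finite B \<and> card B \<le> n" if B: "B \<subseteq> C'" "\<not> fun_space.dependent B" for B
    proof -
      have "fun_space.span B \<subseteq> C'" using B C' by (simp add: fun_space.span_minimal)
      hence nin: "f0 \<notin> fun_space.span B" using f0 by (auto simp: C'_def)
      hence "f0 \<notin> B" using fun_space.span_base by blast
      moreover have "\<not> fun_space.dependent (insert f0 B)"
        using B nin by (simp add: fun_space.independent_insertI)
      moreover have "insert f0 B \<subseteq> C" using f0 B by (auto simp: C'_def)
      ultimately show ?thesis using Suc.prems(2)[of "insert f0 B"] by auto
    qed
    obtain ps where ps: "snd ` set ps \<subseteq> C'" "\<And>f. f \<in> C' \<Longrightarrow> f = (\<Sum>(p, c)\<leftarrow>ps. fscale (f p) c)"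
      using Suc.IH[OF C' bound] by blast
    \<comment> \<open>The projection onto \<open>C'\<close> given by the list; subtracting it from \<open>f0\<close> makes \<open>f0\<close> dual to \<open>p\<close>.\<close>
    define r where "r f = (\<Sum>(p, c)\<leftarrow>ps. fscale (f p) c)" for f
    have r: "r f = f" if "f \<in> C'" for f using ps(2)[OF that] by (simp add: r_def)
    have r_diff: "r (f - fscale c g) = r f - fscale c (r g)" for f g c
      unfolding r_def by (induction ps) (auto simp: fscale_def fun_eq_iff algebra_simps)
    have rC: "r f \<in> C" for f
      unfolding r_def using ps(1) C
      by (intro sum_list_in_subspace) (auto simp: C'_def intro!: fun_space.subspace_scale)
    have "f = (\<Sum>(p, c)\<leftarrow>(p, f0 - r f0) # ps. fscale (f p) c)" if f: "f \<in> C" for f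
    proof -
      have "f - fscale (f p) f0 \<in> C'"
        using f f0(1) C unfolding C'_def
        by (auto intro!: fun_space.subspace_diff fun_space.subspace_scale)
           (simp add: fscale_def f0(2))
      from r[OF this] have "f = fscale (f p) (f0 - r f0) + r f"
        unfolding r_diff by (auto simp: fun_eq_iff fscale_def algebra_simps)
      thus ?thesis by (simp add: r_def)
    qed
    thus ?thesis using ps(1) f0 rC C
      by (intro exI[of _ "(p, f0 - r f0) # ps"]) (auto simp: C'_def intro!: fun_space.subspace_diff)
  qed
qed

text \<open>
  A finite-dimensional space of functions has a basis \<open>c\<close> whose dual basis consists of evaluations
  at points \<open>p\<close>. This writes \<open>\<alpha>(h k)\<close> as a sum of \<open>\<alpha>(h p) c(k)\<close>, a tensor built from
  translates of \<open>\<alpha>\<close>.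
\<close>

lemma dual_points:
  fixes C :: "('x \<Rightarrow> 'k::field) set"
  assumes C: "fun_space.subspace C" and S: "finite S" "C \<subseteq> fun_space.span S"
  obtains ps where "snd ` set ps \<subseteq> C" "\<And>f. f \<in> C \<Longrightarrow> f = (\<Sum>(p, c)\<leftarrow>ps. fscale (f p) c)"
proof -
  have "finite B \<and> card B \<le> card S" if "B \<subseteq> C" "\<not> fun_space.dependent B" for B
    using fun_space.independent_span_bound[of S B] that S by auto
  from dual_points_aux[OF C this] show ?thesis using that by blast
qed

lemma stable_imp_subcoalgebra:
  fixes A :: "('k::field, 'h) module"
  assumes C: "fun_space.subspace C" "C \<subseteq> dual A" and S: "finite S" "C \<subseteq> fun_space.span S"
    and L: "\<And>\<alpha> h. \<alpha> \<in> C \<Longrightarrow> h \<in> carrier A \<Longrightarrow> left_act A h \<alpha> \<in> C"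
    and R: "\<And>\<alpha> h. \<alpha> \<in> C \<Longrightarrow> h \<in> carrier A \<Longrightarrow> right_act A \<alpha> h \<in> C"
  shows "subcoalgebra A C"
proof -
  obtain ps where ps: "snd ` set ps \<subseteq> C" "\<And>f. f \<in> C \<Longrightarrow> f = (\<Sum>(p, c)\<leftarrow>ps. fscale (f p) c)"
    using dual_points[OF C(1) S] by metis
  have "dual_comult A \<alpha> \<in> tensor C C" if \<alpha>: "\<alpha> \<in> C" for \<alpha>
  proof -
    define col where "col p = (\<lambda>h. dual_comult A \<alpha> (h, p))" for p
    have zero: "(\<lambda>_. 0) \<in> C" using fun_space.subspace_0[OF C(1)] by (simp add: zero_fun_eq)
    have col: "col p \<in> C" for p
    proof (cases "p \<in> carrier A")
      case True
      have "col p = left_act A p \<alpha>" using True by (auto simp: col_def left_act_def dual_comult_def)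
      thus ?thesis using L \<alpha> True by simp
    qed (use zero in \<open>simp add: col_def dual_comult_def\<close>)
    have row: "(\<lambda>k. dual_comult A \<alpha> (h, k)) \<in> C" for h
    proof (cases "h \<in> carrier A")
      case True
      have "(\<lambda>k. dual_comult A \<alpha> (h, k)) = right_act A \<alpha> h"
        using True by (auto simp: right_act_def dual_comult_def)
      thus ?thesis using R \<alpha> True by simp
    qed (use zero in \<open>simp add: dual_comult_def\<close>)
    have "dual_comult A \<alpha> = (\<Sum>(p, c)\<leftarrow>ps. (\<lambda>(h, k). col p h * c k))"
    proof
      fix z :: "'h \<times> 'h"
      obtain h k where z: "z = (h, k)" by force
      have "dual_comult A \<alpha> (h, k) = (\<Sum>(p, c)\<leftarrow>ps. fscale (dual_comult A \<alpha> (h, p)) c) k"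
        using fun_cong[OF ps(2)[OF row[of h]], of k] by simp
      thus "dual_comult A \<alpha> z = (\<Sum>(p, c)\<leftarrow>ps. (\<lambda>(h, k). col p h * c k)) z"
        by (simp add: z sum_list_fun_apply col_def fscale_def case_prod_beta)
    qed
    also have "\<dots> \<in> tensor C C" unfolding tensor_def
      using ps(1) col by (intro sum_list_in_subspace) (fastforce intro!: fun_space.span_base)+
    finally show ?thesis .
  qed
  thus ?thesis using C by (auto simp: subcoalgebra_def)
qed

section \<open>Free algebras\<close>

lemma ring_of_type_simps [simp]:
  "carrier (ring_of_type_algebra :: 'a::ring_1 ring) = UNIV"
  "x \<otimes>\<^bsub>ring_of_type_algebra\<^esub> y = (x :: 'a) * y"
  "x \<oplus>\<^bsub>ring_of_type_algebra\<^esub> y = x + y"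
  "\<one>\<^bsub>ring_of_type_algebra\<^esub> = (1 :: 'a)"
  "\<zero>\<^bsub>ring_of_type_algebra\<^esub> = (0 :: 'a)"
  by (auto simp: ring_of_type_algebra_def)

definition word :: "'s list \<Rightarrow> ('s, 'k::field) free_algebra" where
  "word w = Poly_Mapping.single (Word w) 1"

lemma word_Nil: "word [] = 1"
  by (simp add: word_def zero_fword_def[symmetric])

lemma word_append: "word (u @ w) = (word u * word w :: ('s, 'k::field) free_algebra)"
  by (simp add: word_def mult_single plus_fword_def)

lemma word_Cons: "word (s # w) = (fvar s * word w :: ('s, 'k::field) free_algebra)"
  using word_append[of "[s]" w] by (simp add: word_def fvar_def)

lemma fconst_word: "fconst c * word w = Poly_Mapping.single (Word w) c"
  by (simp add: fconst_def word_def mult_single)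

lemma fconst_simps [simp]:
  "fconst 0 = 0" "fconst 1 = 1" "fconst (a + b) = fconst a + fconst b"
  "fconst (- a) = - fconst a"
  "fconst (a - b) = fconst a - fconst b" "fconst (a * b) = fconst a * fconst b"
  by (simp_all add: fconst_def single_add single_uminus single_diff mult_single)

lemma free_algebra_induct [case_names zero add]:
  assumes "P 0"
    and "\<And>c w p. Word w \<in> Poly_Mapping.keys f \<Longrightarrow> P p \<Longrightarrow> P (fconst c * word w + p)"
  shows "P f"
proof -
  have f: "f = (\<Sum>w\<in>Poly_Mapping.keys f. Poly_Mapping.single w (Poly_Mapping.lookup f w))"
    by (rule poly_mapping_eqI)
       (auto simp: lookup_sum lookup_single when_def in_keys_iff)
  have "P (\<Sum>w\<in>A. Poly_Mapping.single w (Poly_Mapping.lookup f w))"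
    if "finite A" "A \<subseteq> Poly_Mapping.keys f" for A
    using that
  proof (induction rule: finite_induct)
    case (insert w A)
    show ?case using insert assms(2)[of "letters w"]
      by (simp add: fconst_word)
  qed (use assms in simp)
  from this[of "Poly_Mapping.keys f"] show ?thesis by (subst f) simp
qed

lemma fconst_commute: "f * fconst c = fconst c * (f :: ('s, 'k::field) free_algebra)"
proof (induction f rule: free_algebra_induct)
  case (add d w p)
  have "fconst d * word w * fconst c = (Poly_Mapping.single (Word w) (d * c) :: ('s, 'k) free_algebra)"
    by (simp add: fconst_def word_def mult_single)
  also have "\<dots> = fconst c * (fconst d * word w)"
    by (simp add: fconst_def word_def mult_single mult.commute)
  finally show ?case using add(2) by (simp only: distrib_left distrib_right)
qed simp

lemma fconst_left_commute: "f * (fconst c * g) = fconst c * (f * (g :: ('s, 'k::field) free_algebra))"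
proof -
  have "f * (fconst c * g) = (f * fconst c) * g" by (simp only: mult.assoc)
  thus ?thesis by (simp only: fconst_commute[of f c] mult.assoc)
qed

text \<open>
  Scalar multiplication, named so that spans in the free algebra are available.
\<close>

definition scl :: "'k::field \<Rightarrow> ('s, 'k) free_algebra \<Rightarrow> ('s, 'k) free_algebra" where
  "scl c f = fconst c * f"

global_interpretation FA: vector_space "scl :: 'k::field \<Rightarrow> ('s, 'k) free_algebra \<Rightarrow> _"
  by unfold_locales (auto simp: scl_def algebra_simps)

lemma carrier_free_algebra_on:
  "carrier (free_algebra_on S) = {f. \<forall>w\<in>Poly_Mapping.keys f. set (letters w) \<subseteq> S}"
  by (simp add: free_algebra_on_def)

lemma free_algebra_on_simps [simp]:
  "x \<otimes>\<^bsub>free_algebra_on S\<^esub> y = x * y" "x \<oplus>\<^bsub>free_algebra_on S\<^esub> y = x + y"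
  "\<one>\<^bsub>free_algebra_on S\<^esub> = 1" "\<zero>\<^bsub>free_algebra_on S\<^esub> = 0"
  by (auto simp: free_algebra_on_def)

lemma free_algebra_on_closed:
  fixes f g :: "('s, 'k::field) free_algebra"
  shows "f \<in> carrier (free_algebra_on S) \<Longrightarrow> g \<in> carrier (free_algebra_on S) \<Longrightarrow>
      f + g \<in> carrier (free_algebra_on S)"
    "f \<in> carrier (free_algebra_on S) \<Longrightarrow> g \<in> carrier (free_algebra_on S) \<Longrightarrow>
      f * g \<in> carrier (free_algebra_on S)"
    "f \<in> carrier (free_algebra_on S) \<Longrightarrow> - f \<in> carrier (free_algebra_on S)"
    "fconst c \<in> carrier (free_algebra_on S)"
    "set w \<subseteq> S \<Longrightarrow> word w \<in> carrier (free_algebra_on S)"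
proof -
  show "f + g \<in> carrier (free_algebra_on S)"
    if "f \<in> carrier (free_algebra_on S)" "g \<in> carrier (free_algebra_on S)"
    using that Poly_Mapping.keys_add[of f g] unfolding carrier_free_algebra_on by blast
  show "f * g \<in> carrier (free_algebra_on S)"
    if "f \<in> carrier (free_algebra_on S)" "g \<in> carrier (free_algebra_on S)"
    using that keys_mult[of f g] unfolding carrier_free_algebra_on
    by (fastforce simp: plus_fword_def)
  show "- f \<in> carrier (free_algebra_on S)" if "f \<in> carrier (free_algebra_on S)"
    using that unfolding carrier_free_algebra_on by (auto simp: in_keys_iff)
qed (auto simp: carrier_free_algebra_on fconst_def word_def zero_fword_def)

lemma free_algebra_on_closed_derived:
  fixes f g :: "('s, 'k::field) free_algebra"
  shows "f \<in> carrier (free_algebra_on S) \<Longrightarrow> g \<in> carrier (free_algebra_on S) \<Longrightarrow>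
      f - g \<in> carrier (free_algebra_on S)"
    "0 \<in> carrier (free_algebra_on S)" "1 \<in> carrier (free_algebra_on S)"
    "s \<in> S \<Longrightarrow> fvar s \<in> carrier (free_algebra_on S)"
  using free_algebra_on_closed(1)[of f S "- g"] free_algebra_on_closed(3)[of g S]
    free_algebra_on_closed(4)[of 0 S] free_algebra_on_closed(4)[of 1 S]
    free_algebra_on_closed(5)[of "[s]" S]
  by (auto simp: word_def fvar_def)

lemma ring_free_algebra_on: "ring (free_algebra_on S :: ('s, 'k::field) free_algebra ring)"
proof (intro ringI abelian_groupI monoidI)
  fix x assume "x \<in> carrier (free_algebra_on S :: ('s, 'k) free_algebra ring)"
  thus "\<exists>y\<in>carrier (free_algebra_on S). y \<oplus>\<^bsub>free_algebra_on S\<^esub> x = \<zero>\<^bsub>free_algebra_on S\<^esub>"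
    by (intro bexI[of _ "- x"]) (auto intro: free_algebra_on_closed)
qed (auto intro: free_algebra_on_closed free_algebra_on_closed_derived simp: algebra_simps)

section \<open>The relations of \<open>H\<close>\<close>

context simply_linked_nilpotent_datum
begin

abbreviation "F \<equiv> carrier (free_alg D)"
abbreviation "I \<equiv> rel_ideal D"
abbreviation "H \<equiv> hopf_alg D"
abbreviation "G \<equiv> carrier (grp D)"
text \<open>
  Both the index set and its enumeration are constants of their own: rewriting of interval
  membership would otherwise destroy the premises of the rules about generators.
\<close>

definition "idx = {1..rank D}"

lemma finite_idx [simp]: "finite idx" by (simp add: idx_def)

definition "idx_list = [1..<Suc (rank D)]"

lemma idx_list [simp]: "set idx_list = idx" "distinct idx_list" by (auto simp: idx_list_def idx_def)

lemmas datum_closed = a_closed[folded idx_def] b_closed[folded idx_def] chi_closed[folded idx_def]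

sublocale G: comm_group "grp D" by (rule comm_group)
sublocale FR: ring "free_alg D" unfolding free_alg_def by (rule ring_free_algebra_on)

lemma free_alg_simps [simp]:
  "x \<otimes>\<^bsub>free_alg D\<^esub> y = x * y" "x \<oplus>\<^bsub>free_alg D\<^esub> y = x + y"
  "\<one>\<^bsub>free_alg D\<^esub> = 1" "\<zero>\<^bsub>free_alg D\<^esub> = 0"
  by (auto simp: free_alg_def)

lemma F_closed [simp, intro]:
  "f \<in> F \<Longrightarrow> g \<in> F \<Longrightarrow> f + g \<in> F" "f \<in> F \<Longrightarrow> g \<in> F \<Longrightarrow> f * g \<in> F"
  "f \<in> F \<Longrightarrow> - f \<in> F" "f \<in> F \<Longrightarrow> g \<in> F \<Longrightarrow> f - g \<in> F" "fconst c \<in> F" "0 \<in> F" "1 \<in> F"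
  by (auto simp: free_alg_def intro: free_algebra_on_closed free_algebra_on_closed_derived)

lemma var_F [simp, intro]:
  "g \<in> G \<Longrightarrow> var_g g \<in> F" "i \<in> idx \<Longrightarrow> var_x i \<in> F" "i \<in> idx \<Longrightarrow> var_y i \<in> F"
  by (auto simp: free_alg_def generators_def idx_def intro!: free_algebra_on_closed_derived)

lemma power_F [simp, intro]: "f \<in> F \<Longrightarrow> f ^ n \<in> F"
  by (induction n) auto

lemma prod_list_F [intro]: "(\<And>f. f \<in> set fs \<Longrightarrow> f \<in> F) \<Longrightarrow> prod_list fs \<in> F"
  by (induction fs) auto

lemma relations_F: "relations D \<subseteq> F"
  unfolding relations_def idx_def[symmetric]
  by (intro Un_least) (auto simp: datum_closed)

sublocale I: ideal I "free_alg D"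
  unfolding rel_ideal_def using relations_F by (rule FR.genideal_ideal)

lemma relations_I: "r \<in> relations D \<Longrightarrow> r \<in> I"
  unfolding rel_ideal_def using FR.genideal_self[OF relations_F] by blast

lemma I_F: "f \<in> I \<Longrightarrow> f \<in> F" by (rule I.Icarr)

lemma I_closed:
  "f \<in> I \<Longrightarrow> g \<in> I \<Longrightarrow> f + g \<in> I" "f \<in> I \<Longrightarrow> g \<in> F \<Longrightarrow> g * f \<in> I" "f \<in> I \<Longrightarrow> g \<in> F \<Longrightarrow> f * g \<in> I"
  "0 \<in> I" "f \<in> I \<Longrightarrow> - f \<in> I" "f \<in> I \<Longrightarrow> g \<in> I \<Longrightarrow> f - g \<in> I"
proof -
  show add: "f \<in> I \<Longrightarrow> g \<in> I \<Longrightarrow> f + g \<in> I" for f g using I.a_closed[of f g] by simp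
  show l: "f \<in> I \<Longrightarrow> g \<in> F \<Longrightarrow> g * f \<in> I" for f g using I.I_l_closed[of f g] by simp
  show "f \<in> I \<Longrightarrow> g \<in> F \<Longrightarrow> f * g \<in> I" using I.I_r_closed[of f g] by simp
  show "0 \<in> I" using I.zero_closed by simp
  show m: "f \<in> I \<Longrightarrow> - f \<in> I" for f using l[of f "fconst (-1)"] by simp
  show "f \<in> I \<Longrightarrow> g \<in> I \<Longrightarrow> f - g \<in> I" using add[of f "- g"] m[of g] by simp
qed

text \<open>
  Equality in \<open>H\<close> up to a scalar, which may be zero. The scalars of the commutation relations do not influence any
  span, so straightening is carried out modulo this preorder and never computes them.
\<close>

definition propor :: "('g gen, 'k) free_algebra \<Rightarrow> ('g gen, 'k) free_algebra \<Rightarrow> bool" (infix \<open>\<propto>\<close> 50)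
  where "f \<propto> g \<longleftrightarrow> f \<in> F \<and> g \<in> F \<and> (\<exists>c. f - fconst c * g \<in> I)"

lemma propor_refl: "f \<in> F \<Longrightarrow> f \<propto> f"
  unfolding propor_def using I_closed(4) by (intro conjI exI[where x = 1]) simp_all

lemma propor_trans [trans]:
  assumes "f \<propto> g" "g \<propto> h" shows "f \<propto> h"
proof -
  from assms obtain c d where c: "f - fconst c * g \<in> I" and d: "g - fconst d * h \<in> I"
    and F: "f \<in> F" "g \<in> F" "h \<in> F" by (auto simp: propor_def)
  have "(f - fconst c * g) + fconst c * (g - fconst d * h) \<in> I"
    using c d F I_closed(1,2) by simp
  also have "(f - fconst c * g) + fconst c * (g - fconst d * h) = f - fconst (c * d) * h"
    by (simp add: algebra_simps)
  finally show ?thesis using F unfolding propor_def by blast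
qed

lemma propor_mult_left: "f \<propto> g \<Longrightarrow> h \<in> F \<Longrightarrow> h * f \<propto> h * g"
proof -
  assume a: "f \<propto> g" "h \<in> F"
  then obtain c where c: "f - fconst c * g \<in> I" by (auto simp: propor_def)
  have "h * (f - fconst c * g) \<in> I" using c a I_closed(2) by simp
  also have "h * (f - fconst c * g) = h * f - fconst c * (h * g)"
    by (simp add: right_diff_distrib fconst_left_commute)
  finally show ?thesis using a unfolding propor_def by blast
qed

lemma propor_mult_right: "f \<propto> g \<Longrightarrow> h \<in> F \<Longrightarrow> f * h \<propto> g * h"
proof -
  assume a: "f \<propto> g" "h \<in> F"
  then obtain c where c: "f - fconst c * g \<in> I" by (auto simp: propor_def)
  have "(f - fconst c * g) * h \<in> I" using c a I_closed(3) by simp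
  also have "(f - fconst c * g) * h = f * h - fconst c * (g * h)"
    by (simp add: left_diff_distrib mult.assoc)
  finally show ?thesis using a unfolding propor_def by blast
qed

lemma propor_mult: "f \<propto> f' \<Longrightarrow> g \<propto> g' \<Longrightarrow> f * g \<propto> f' * g'"
  using propor_mult_left propor_mult_right propor_trans by (meson propor_def)

lemma propor_I: "f \<propto> g \<Longrightarrow> g \<in> I \<Longrightarrow> f \<in> I"
proof -
  assume a: "f \<propto> g" "g \<in> I"
  then obtain c where "f - fconst c * g \<in> I" by (auto simp: propor_def)
  from I_closed(1)[OF this I_closed(2)[OF a(2) F_closed(5)[of c]]] show ?thesis by simp
qed


lemma relation_in_ideal:
  "var_g \<one>\<^bsub>grp D\<^esub> - 1 \<in> I"
  "g \<in> G \<Longrightarrow> h \<in> G \<Longrightarrow> var_g g * var_g h - var_g (g \<otimes>\<^bsub>grp D\<^esub> h) \<in> I"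
  "g \<in> G \<Longrightarrow> i \<in> idx \<Longrightarrow> var_g g * var_x i - fconst (chi D i g) * var_x i * var_g g \<in> I"
  "g \<in> G \<Longrightarrow> i \<in> idx \<Longrightarrow> var_g g * var_y i - fconst (inverse (chi D i g)) * var_y i * var_g g \<in> I"
  "i \<in> idx \<Longrightarrow> j \<in> idx \<Longrightarrow> i \<noteq> j \<Longrightarrow> var_x i * var_x j - fconst (qq D i j) * var_x j * var_x i \<in> I"
  "i \<in> idx \<Longrightarrow> j \<in> idx \<Longrightarrow> i \<noteq> j \<Longrightarrow> var_y i * var_y j - fconst (qq D i j) * var_y j * var_y i \<in> I"
  "i \<in> idx \<Longrightarrow> j \<in> idx \<Longrightarrow> var_x i * var_y j - fconst (inverse (qq D i j)) * var_y j * var_x i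
        - (if i = j then var_g (aa D i \<otimes>\<^bsub>grp D\<^esub> bb D i) - 1 else 0) \<in> I"
  "i \<in> idx \<Longrightarrow> var_x i ^ mm D i \<in> I"
  "i \<in> idx \<Longrightarrow> var_y i ^ mm D i \<in> I"
proof -
  show "var_g \<one>\<^bsub>grp D\<^esub> - 1 \<in> I"
    by (rule relations_I, unfold relations_def, rule UnI1, rule UnI1, rule UnI1, rule UnI1, rule UnI1, rule UnI1, rule UnI1, rule UnI1, rule singletonI)
  show "g \<in> G \<Longrightarrow> h \<in> G \<Longrightarrow> var_g g * var_g h - var_g (g \<otimes>\<^bsub>grp D\<^esub> h) \<in> I"
    by (rule relations_I, unfold relations_def, rule UnI1, rule UnI1, rule UnI1, rule UnI1, rule UnI1, rule UnI1, rule UnI1, rule UnI2, (unfold idx_def)?, blast)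
  show "g \<in> G \<Longrightarrow> i \<in> idx \<Longrightarrow> var_g g * var_x i - fconst (chi D i g) * var_x i * var_g g \<in> I"
    by (rule relations_I, unfold relations_def, rule UnI1, rule UnI1, rule UnI1, rule UnI1, rule UnI1, rule UnI1, rule UnI2, (unfold idx_def)?, blast)
  show "g \<in> G \<Longrightarrow> i \<in> idx \<Longrightarrow> var_g g * var_y i - fconst (inverse (chi D i g)) * var_y i * var_g g \<in> I"
    by (rule relations_I, unfold relations_def, rule UnI1, rule UnI1, rule UnI1, rule UnI1, rule UnI1, rule UnI2, (unfold idx_def)?, blast)
  show "i \<in> idx \<Longrightarrow> j \<in> idx \<Longrightarrow> i \<noteq> j \<Longrightarrow> var_x i * var_x j - fconst (qq D i j) * var_x j * var_x i \<in> I"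
    by (rule relations_I, unfold relations_def, rule UnI1, rule UnI1, rule UnI1, rule UnI1, rule UnI2, (unfold idx_def)?, blast)
  show "i \<in> idx \<Longrightarrow> j \<in> idx \<Longrightarrow> i \<noteq> j \<Longrightarrow> var_y i * var_y j - fconst (qq D i j) * var_y j * var_y i \<in> I"
    by (rule relations_I, unfold relations_def, rule UnI1, rule UnI1, rule UnI1, rule UnI2, (unfold idx_def)?, blast)
  show "i \<in> idx \<Longrightarrow> j \<in> idx \<Longrightarrow> var_x i * var_y j - fconst (inverse (qq D i j)) * var_y j * var_x i
        - (if i = j then var_g (aa D i \<otimes>\<^bsub>grp D\<^esub> bb D i) - 1 else 0) \<in> I"
    by (rule relations_I, unfold relations_def, rule UnI1, rule UnI1, rule UnI2, (unfold idx_def)?, blast)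
  show "i \<in> idx \<Longrightarrow> var_x i ^ mm D i \<in> I"
    by (rule relations_I, unfold relations_def, rule UnI1, rule UnI2, (unfold idx_def)?, blast)
  show "i \<in> idx \<Longrightarrow> var_y i ^ mm D i \<in> I"
    by (rule relations_I, unfold relations_def, rule UnI2, (unfold idx_def)?, blast)
qed

lemma commute_propor:
  "g \<in> G \<Longrightarrow> h \<in> G \<Longrightarrow> var_g g * var_g h \<propto> var_g (g \<otimes>\<^bsub>grp D\<^esub> h)"
  "g \<in> G \<Longrightarrow> i \<in> idx \<Longrightarrow> var_g g * var_x i \<propto> var_x i * var_g g"
  "g \<in> G \<Longrightarrow> i \<in> idx \<Longrightarrow> var_g g * var_y i \<propto> var_y i * var_g g"
  "i \<in> idx \<Longrightarrow> j \<in> idx \<Longrightarrow> var_x i * var_x j \<propto> var_x j * var_x i"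
  "i \<in> idx \<Longrightarrow> j \<in> idx \<Longrightarrow> var_y i * var_y j \<propto> var_y j * var_y i"
proof -
  have propI: "f - fconst c * g * h \<in> I \<Longrightarrow> f \<in> F \<Longrightarrow> g \<in> F \<Longrightarrow> h \<in> F \<Longrightarrow> f \<propto> g * h" for c f g h
    unfolding propor_def mult.assoc by blast
  show "g \<in> G \<Longrightarrow> h \<in> G \<Longrightarrow> var_g g * var_g h \<propto> var_g (g \<otimes>\<^bsub>grp D\<^esub> h)"
    using propI[of _ 1 _ 1, OF _ _ _ F_closed(7)] relation_in_ideal(2)[of g h] by simp
  show "g \<in> G \<Longrightarrow> i \<in> idx \<Longrightarrow> var_g g * var_x i \<propto> var_x i * var_g g"
    by (rule propI, erule (1) relation_in_ideal(3)) auto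
  show "g \<in> G \<Longrightarrow> i \<in> idx \<Longrightarrow> var_g g * var_y i \<propto> var_y i * var_g g"
    by (rule propI, erule (1) relation_in_ideal(4)) auto
  show "i \<in> idx \<Longrightarrow> j \<in> idx \<Longrightarrow> var_x i * var_x j \<propto> var_x j * var_x i"
    using propI[OF relation_in_ideal(5)[of i j]] propor_refl[of "var_x i * var_x i"] by (cases "i = j") auto
  show "i \<in> idx \<Longrightarrow> j \<in> idx \<Longrightarrow> var_y i * var_y j \<propto> var_y j * var_y i"
    using propI[OF relation_in_ideal(6)[of i j]] propor_refl[of "var_y i * var_y i"] by (cases "i = j") auto
qed

lemma chi_unit: "i \<in> idx \<Longrightarrow> g \<in> G \<Longrightarrow> chi D i g \<noteq> 0"
  using datum_closed(3)[of i] by (auto simp: characters_def hom_def unit_group_def units_of_def Units_def Pi_def)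

lemma qq_nonzero: "i \<in> idx \<Longrightarrow> j \<in> idx \<Longrightarrow> qq D i j \<noteq> 0"
  unfolding qq_def using chi_unit datum_closed by simp

section \<open>Straightening words in the \<open>x\<^sub>i\<close> or in the \<open>y\<^sub>i\<close>\<close>

abbreviation x_word :: "nat list \<Rightarrow> ('g gen, 'k) free_algebra" where "x_word w \<equiv> (\<Prod>i\<leftarrow>w. var_x i)"
abbreviation y_word :: "nat list \<Rightarrow> ('g gen, 'k) free_algebra" where "y_word w \<equiv> (\<Prod>i\<leftarrow>w. var_y i)"

lemma words_in_F [simp, intro]: "set w \<subseteq> idx \<Longrightarrow> x_word w \<in> F" "set w \<subseteq> idx \<Longrightarrow> y_word w \<in> F"
  by (auto intro!: prod_list_F var_F)

lemma commute_word:
  assumes "f \<in> F" "\<And>i. i \<in> set w \<Longrightarrow> z i \<in> F \<and> f * z i \<propto> z i * f"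
  shows "f * (\<Prod>i\<leftarrow>w. z i) \<propto> (\<Prod>i\<leftarrow>w. z i) * f"
  using assms(2)
proof (induction w)
  case (Cons i w)
  have F: "(\<Prod>i\<leftarrow>w. z i) \<in> F" "z i \<in> F" using Cons.prems by (auto intro!: prod_list_F)
  have "f * z i * (\<Prod>i\<leftarrow>w. z i) \<propto> z i * f * (\<Prod>i\<leftarrow>w. z i)"
    using Cons.prems F by (intro propor_mult_right) auto
  also have "z i * f * (\<Prod>i\<leftarrow>w. z i) = z i * (f * (\<Prod>i\<leftarrow>w. z i))" by (rule mult.assoc)
  also have "z i * (f * (\<Prod>i\<leftarrow>w. z i)) \<propto> z i * ((\<Prod>i\<leftarrow>w. z i) * f)"
    using Cons F by (intro propor_mult_left) auto
  finally show ?case by (simp add: mult.assoc)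
qed (use assms(1) in \<open>auto intro: propor_refl\<close>)

lemma commute_power:
  assumes "f \<in> F" "z \<in> F" "f * z \<propto> z * f"
  shows "f * z ^ n \<propto> z ^ n * f"
  using commute_word[of f "replicate n 0" "\<lambda>_. z"] assms
  by (auto simp: prod_list_replicate map_replicate_const)

text \<open>
  The letter moves past the smaller powers, each exchange costing a scalar, until it meets the power
  of the same generator.
\<close>

lemma insert_letter:
  assumes z: "\<And>i. i \<in> idx \<Longrightarrow> z i \<in> F" "\<And>i j. i \<in> idx \<Longrightarrow> j \<in> idx \<Longrightarrow> z i * z j \<propto> z j * z i"
    and "i \<in> set ks" "distinct ks" "set ks \<subseteq> idx"
  shows "z i * (\<Prod>k\<leftarrow>ks. z k ^ e k) \<propto> (\<Prod>k\<leftarrow>ks. z k ^ (e(i := Suc (e i))) k)"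
  using assms(3-)
proof (induction ks)
  case (Cons k ks)
  have F: "(\<Prod>k\<leftarrow>ks. z k ^ e' k) \<in> F" "z k \<in> F" "z i \<in> F" for e' :: "nat \<Rightarrow> nat"
    using Cons.prems z(1) by (auto intro!: prod_list_F power_F z(1))
  show ?case
  proof (cases "i = k")
    case True
    hence "(\<Prod>k\<leftarrow>ks. z k ^ (e(i := Suc (e i))) k) = (\<Prod>k\<leftarrow>ks. z k ^ e k)"
      using Cons.prems by (intro arg_cong[of _ _ prod_list] map_cong) auto
    thus ?thesis using True F by (auto simp: mult.assoc intro!: propor_refl)
  next
    case False
    have "z i * z k ^ e k * (\<Prod>k\<leftarrow>ks. z k ^ e k) \<propto> z k ^ e k * z i * (\<Prod>k\<leftarrow>ks. z k ^ e k)"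
      using F z Cons.prems by (intro propor_mult_right commute_power) auto
    also have "z k ^ e k * z i * (\<Prod>k\<leftarrow>ks. z k ^ e k) = z k ^ e k * (z i * (\<Prod>k\<leftarrow>ks. z k ^ e k))"
      by (rule mult.assoc)
    also have "z k ^ e k * (z i * (\<Prod>k\<leftarrow>ks. z k ^ e k)) \<propto>
        z k ^ e k * (\<Prod>k\<leftarrow>ks. z k ^ (e(i := Suc (e i))) k)"
      using F False Cons by (intro propor_mult_left) auto
    finally show ?thesis using False by (simp add: mult.assoc)
  qed
qed auto

lemma sort_word:
  assumes z: "\<And>i. i \<in> idx \<Longrightarrow> z i \<in> F" "\<And>i j. i \<in> idx \<Longrightarrow> j \<in> idx \<Longrightarrow> z i * z j \<propto> z j * z i"
    and "set w \<subseteq> idx"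
  shows "(\<Prod>i\<leftarrow>w. z i) \<propto> (\<Prod>k\<leftarrow>idx_list. z k ^ count_list w k)"
  using assms(3)
proof (induction w)
  case Nil
  have "(\<Prod>k\<leftarrow>ks. (1 :: ('g gen, 'k) free_algebra)) = 1" for ks :: "nat list" by (induction ks) auto
  thus ?case by (simp add: propor_refl)
next
  case (Cons i w)
  have eq: "(count_list w)(i := Suc (count_list w i)) = count_list (i # w)" by auto
  have "z i * (\<Prod>i\<leftarrow>w. z i) \<propto> z i * (\<Prod>k\<leftarrow>idx_list. z k ^ count_list w k)"
    using Cons z by (intro propor_mult_left) auto
  also have "\<dots> \<propto> (\<Prod>k\<leftarrow>idx_list. z k ^ count_list (i # w) k)"
    unfolding eq[symmetric] using Cons.prems z by (intro insert_letter) auto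
  finally show ?case by simp
qed

lemma high_power_I:
  assumes "\<And>i. i \<in> set ks \<Longrightarrow> z i \<in> F" "j \<in> set ks" "z j ^ m \<in> I" "m \<le> e j"
  shows "(\<Prod>k\<leftarrow>ks. z k ^ e k) \<in> I"
  using assms(1,2)
proof (induction ks)
  case (Cons k ks)
  have F: "(\<Prod>k\<leftarrow>ks. z k ^ e k) \<in> F" "z k ^ e k \<in> F"
    using Cons.prems by (auto intro!: prod_list_F power_F)
  show ?case
  proof (cases "j = k")
    case True
    have "z j ^ e j = z j ^ m * z j ^ (e j - m)" using assms(4) by (simp flip: power_add)
    hence "z j ^ e j \<in> I" using assms Cons.prems True by (auto intro: I_closed)
    thus ?thesis using F True by (auto intro: I_closed)
  qed (use Cons F in \<open>auto intro: I_closed\<close>)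
qed auto

lemma word_high:
  assumes z: "\<And>i. i \<in> idx \<Longrightarrow> z i \<in> F" "\<And>i j. i \<in> idx \<Longrightarrow> j \<in> idx \<Longrightarrow> z i * z j \<propto> z j * z i"
    "\<And>i. i \<in> idx \<Longrightarrow> z i ^ mm D i \<in> I"
    and w: "set w \<subseteq> idx" and k: "k \<in> idx" "mm D k \<le> count_list w k"
  shows "(\<Prod>i\<leftarrow>w. z i) \<in> I"
  using sort_word[OF z(1,2) w] by (rule propor_I) (use k z in \<open>auto intro!: high_power_I[of _ z k "mm D k"]\<close>)

text \<open>
  A word of this length contains some letter \<open>k\<close> at least \<open>m\<^sub>k\<close> times, by the pigeonhole principle.
\<close>

definition word_bound :: nat where "word_bound = Suc (\<Sum>k\<in>idx. mm D k)"

text \<open>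
  The nilpotency of the algebra generated by the \<open>x\<^sub>i\<close>, or by the \<open>y\<^sub>i\<close>: sorting the word brings
  together \<open>m\<^sub>k\<close> copies of a single letter \<open>k\<close>.
\<close>

lemma long_word:
  assumes z: "\<And>i. i \<in> idx \<Longrightarrow> z i \<in> F" "\<And>i j. i \<in> idx \<Longrightarrow> j \<in> idx \<Longrightarrow> z i * z j \<propto> z j * z i"
    "\<And>i. i \<in> idx \<Longrightarrow> z i ^ mm D i \<in> I"
    and w: "set w \<subseteq> idx" "word_bound \<le> length w"
  shows "(\<Prod>i\<leftarrow>w. z i) \<in> I"
proof (rule ccontr)
  assume "(\<Prod>i\<leftarrow>w. z i) \<notin> I"
  hence "count_list w k \<le> mm D k" if "k \<in> idx" for k
    using word_high[OF z w(1) that] by (meson nat_le_linear)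
  hence "(\<Sum>k\<in>idx. count_list w k) \<le> (\<Sum>k\<in>idx. mm D k)" by (intro sum_mono) auto
  thus False using w sum_count_set[of w idx] by (simp add: word_bound_def)
qed

lemma x_word_high: "set w \<subseteq> idx \<Longrightarrow> k \<in> idx \<Longrightarrow> mm D k \<le> count_list w k \<Longrightarrow> x_word w \<in> I"
  by (rule word_high[of var_x]) (auto intro: commute_propor relation_in_ideal)

lemma y_word_high: "set w \<subseteq> idx \<Longrightarrow> k \<in> idx \<Longrightarrow> mm D k \<le> count_list w k \<Longrightarrow> y_word w \<in> I"
  by (rule word_high[of var_y]) (auto intro: commute_propor relation_in_ideal)

lemma x_word_long: "set w \<subseteq> idx \<Longrightarrow> word_bound \<le> length w \<Longrightarrow> x_word w \<in> I"
  by (rule long_word[of var_x]) (auto intro: commute_propor relation_in_ideal)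

lemma y_word_long: "set w \<subseteq> idx \<Longrightarrow> word_bound \<le> length w \<Longrightarrow> y_word w \<in> I"
  by (rule long_word[of var_y]) (auto intro: commute_propor relation_in_ideal)

lemma x_word_sort: "set w \<subseteq> idx \<Longrightarrow> x_word w \<propto> (\<Prod>k\<leftarrow>idx_list. var_x k ^ count_list w k)"
  by (rule sort_word[of var_x]) (auto intro: commute_propor)

lemma y_word_sort: "set w \<subseteq> idx \<Longrightarrow> y_word w \<propto> (\<Prod>k\<leftarrow>idx_list. var_y k ^ count_list w k)"
  by (rule sort_word[of var_y]) (auto intro: commute_propor)

section \<open>Products of an \<open>x\<close>-word, a \<open>y\<close>-word and a group element span \<open>H\<close>\<close>

text \<open>
  The ideal is part of the span, so that membership can be tested on representatives.
\<close>

definition normal_span :: "('g gen, 'k) free_algebra set" where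
  "normal_span = FA.span (I \<union> {x_word w * y_word u * var_g g | w u g. set w \<subseteq> idx \<and> set u \<subseteq> idx \<and> g \<in> G})"

lemma normal_span_base: "set w \<subseteq> idx \<Longrightarrow> set u \<subseteq> idx \<Longrightarrow> g \<in> G \<Longrightarrow> x_word w * y_word u * var_g g \<in> normal_span"
  unfolding normal_span_def by (intro FA.span_base) blast

lemma normal_span_I: "f \<in> I \<Longrightarrow> f \<in> normal_span"
  unfolding normal_span_def by (intro FA.span_base) blast

lemma normal_span_lin: "f \<in> normal_span \<Longrightarrow> g \<in> normal_span \<Longrightarrow> f + g \<in> normal_span" "f \<in> normal_span \<Longrightarrow> g \<in> normal_span \<Longrightarrow> f - g \<in> normal_span"
  "f \<in> normal_span \<Longrightarrow> fconst c * f \<in> normal_span"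
  unfolding normal_span_def using FA.span_scale[of _ _ c]
  by (auto intro: FA.span_add FA.span_diff simp: scl_def)

lemma normal_span_propor: "f \<propto> g \<Longrightarrow> g \<in> normal_span \<Longrightarrow> f \<in> normal_span"
proof -
  assume a: "f \<propto> g" "g \<in> normal_span"
  then obtain c where "f - fconst c * g \<in> I" by (auto simp: propor_def)
  from normal_span_lin(1)[OF normal_span_I[OF this] normal_span_lin(3)[OF a(2), of c]] show ?thesis by simp
qed

lemma normal_span_mult_left:
  assumes f: "f \<in> F"
    and "\<And>w u g. set w \<subseteq> idx \<Longrightarrow> set u \<subseteq> idx \<Longrightarrow> g \<in> G \<Longrightarrow> f * (x_word w * y_word u * var_g g) \<in> normal_span"
    and p: "p \<in> normal_span"
  shows "f * p \<in> normal_span"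
  using p[unfolded normal_span_def]
proof (induction rule: FA.span_induct_alt)
  case (step c x y)
  have "f * x \<in> normal_span" using step(1) assms(2) f by (auto intro: normal_span_I I_closed)
  hence "fconst c * (f * x) + f * y \<in> normal_span" using step by (intro normal_span_lin)
  thus ?case by (simp add: scl_def distrib_left fconst_left_commute)
qed (simp add: normal_span_I I_closed)

lemma normal_span_x: assumes "i \<in> idx" "p \<in> normal_span" shows "var_x i * p \<in> normal_span"
proof (rule normal_span_mult_left[OF _ _ assms(2)])
  fix w u g assume "set w \<subseteq> idx" "set u \<subseteq> idx" "g \<in> G"
  thus "var_x i * (x_word w * y_word u * var_g g) \<in> normal_span"
    using normal_span_base[of "i # w" u g] assms by (simp add: mult.assoc)
qed (use assms in auto)

lemma normal_span_g: assumes "h \<in> G" "p \<in> normal_span" shows "var_g h * p \<in> normal_span"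
proof (rule normal_span_mult_left[OF _ _ assms(2)])
  fix w u g assume a: "set w \<subseteq> idx" "set u \<subseteq> idx" "g \<in> G"
  have "var_g h * (x_word w * y_word u * var_g g) = (var_g h * x_word w) * (y_word u * var_g g)"
    by (simp add: mult.assoc)
  also have "\<dots> \<propto> (x_word w * var_g h) * (y_word u * var_g g)"
    using a assms by (intro propor_mult_right commute_word) (auto intro: commute_propor)
  also have "\<dots> = x_word w * ((var_g h * y_word u) * var_g g)" by (simp add: mult.assoc)
  also have "\<dots> \<propto> x_word w * ((y_word u * var_g h) * var_g g)"
    using a assms
    by (intro propor_mult_left propor_mult_right commute_word) (auto intro: commute_propor)
  also have "\<dots> = x_word w * y_word u * (var_g h * var_g g)" by (simp add: mult.assoc)
  also have "\<dots> \<propto> x_word w * y_word u * var_g (h \<otimes>\<^bsub>grp D\<^esub> g)"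
    using a assms by (intro propor_mult_left commute_propor) auto
  finally show "var_g h * (x_word w * y_word u * var_g g) \<in> normal_span"
    by (rule normal_span_propor) (use a assms in \<open>auto intro: normal_span_base\<close>)
qed (use assms in auto)

text \<open>
  The linking relation, solved for the product in the wrong order.
\<close>

lemma yx_swap:
  assumes "i \<in> idx" "j \<in> idx"
  shows "var_y j * var_x i - fconst (qq D i j) * (var_x i * var_y j
        - (if i = j then var_g (aa D i \<otimes>\<^bsub>grp D\<^esub> bb D i) - 1 else 0)) \<in> I"
proof -
  define d where "d = (if i = j then var_g (aa D i \<otimes>\<^bsub>grp D\<^esub> bb D i) - 1 else 0 :: ('g gen, 'k) free_algebra)"
  \<comment> \<open>Multiplying the linking relation by \<open>- q\<^sub>i\<^sub>j\<close> isolates \<open>y\<^sub>j x\<^sub>i\<close>.\<close>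
  have "fconst (- qq D i j) * (var_x i * var_y j - fconst (inverse (qq D i j)) * var_y j * var_x i - d) \<in> I"
    unfolding d_def by (rule I_closed(2)[OF relation_in_ideal(7)[OF assms] F_closed(5)])
  also have "fconst (- qq D i j) * (var_x i * var_y j - fconst (inverse (qq D i j)) * var_y j * var_x i - d)
     = fconst (qq D i j * inverse (qq D i j)) * var_y j * var_x i - fconst (qq D i j) * (var_x i * var_y j - d)"
    by (simp add: algebra_simps)
  finally show ?thesis using qq_nonzero[OF assms] by (simp add: d_def)
qed

text \<open>
  Induction on the \<open>x\<close>-word: exchanging \<open>y\<^sub>j\<close> with its first letter leaves terms in which \<open>y\<^sub>j\<close>
  faces a shorter word, and a linking term \<open>a\<^sub>i b\<^sub>i - 1\<close> that only involves the group.
\<close>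

lemma normal_span_y: assumes "j \<in> idx" "p \<in> normal_span" shows "var_y j * p \<in> normal_span"
proof (rule normal_span_mult_left[OF _ _ assms(2)])
  fix w u g assume a: "set w \<subseteq> idx" "set u \<subseteq> idx" "g \<in> G"
  show "var_y j * (x_word w * y_word u * var_g g) \<in> normal_span" using a(1)
  proof (induction w)
    case Nil
    show ?case using normal_span_base[of "[]" "j # u" g] assms a by (simp add: mult.assoc)
  next
    case (Cons i w)
    define M where "M = x_word w * y_word u * var_g g"
    have i: "i \<in> idx" using Cons by auto
    have M: "M \<in> normal_span" "M \<in> F" "var_y j * M \<in> normal_span"
      using Cons a by (auto simp: M_def intro: normal_span_base)
    define d where "d = (if i = j then var_g (aa D i \<otimes>\<^bsub>grp D\<^esub> bb D i) - 1 else 0 :: ('g gen, 'k) free_algebra)"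
    have dM: "d * M \<in> normal_span" using M normal_span_I[OF I_closed(4)] i datum_closed
      by (auto simp: d_def left_diff_distrib intro!: normal_span_lin normal_span_g)
    have "(var_y j * var_x i - fconst (qq D i j) * (var_x i * var_y j - d)) * M \<in> normal_span"
      unfolding d_def by (rule normal_span_I, rule I_closed(3)[OF yx_swap[OF i assms(1)] M(2)])
    moreover have "fconst (qq D i j) * (var_x i * (var_y j * M) - d * M) \<in> normal_span"
      using M dM i by (intro normal_span_lin normal_span_x)
    ultimately have "(var_y j * var_x i - fconst (qq D i j) * (var_x i * var_y j - d)) * M
       + fconst (qq D i j) * (var_x i * (var_y j * M) - d * M) \<in> normal_span" by (rule normal_span_lin)
    also have "(var_y j * var_x i - fconst (qq D i j) * (var_x i * var_y j - d)) * M
       + fconst (qq D i j) * (var_x i * (var_y j * M) - d * M) = var_y j * (var_x i * M)"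
      by (simp add: algebra_simps)
    finally show ?case by (simp add: M_def mult.assoc)
  qed
qed (use assms in auto)

lemma one_normal_span: "1 \<in> normal_span"
proof -
  have "var_g \<one>\<^bsub>grp D\<^esub> - (var_g \<one>\<^bsub>grp D\<^esub> - 1) \<in> normal_span"
    using normal_span_base[of "[]" "[]" "\<one>\<^bsub>grp D\<^esub>"] by (intro normal_span_lin(2)[OF _ normal_span_I[OF relation_in_ideal(1)]]) auto
  thus ?thesis by simp
qed

lemma F_induct [consumes 1, case_names one gen lin]:
  assumes f: "f \<in> F" and one: "P 1"
    and gen: "\<And>s p. s \<in> generators D \<Longrightarrow> p \<in> F \<Longrightarrow> P p \<Longrightarrow> P (fvar s * p)"
    and lin: "\<And>c p q. p \<in> F \<Longrightarrow> q \<in> F \<Longrightarrow> P p \<Longrightarrow> P q \<Longrightarrow> P (fconst c * p + q)"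
  shows "P f"
proof -
  have w: "word w \<in> F \<and> P (word w)" if "set w \<subseteq> generators D" for w
    using that
  proof (induction w)
    case (Cons s w)
    thus ?case using gen[of s "word w"] free_algebra_on_closed(5)[of "s # w" "generators D"]
      by (simp add: word_Cons free_alg_def)
  qed (use one in \<open>simp add: word_Nil\<close>)
  have P0: "P 0" using lin[of 1 1 "-1"] lin[OF _ _ one one, of "-1"] by simp
  have "f \<in> F \<and> P f"
  proof (rule free_algebra_induct[of "\<lambda>p. p \<in> F \<and> P p" f])
    fix c u p assume "Word u \<in> Poly_Mapping.keys f" and p: "p \<in> F \<and> P p"
    hence "set u \<subseteq> generators D"
      using f by (fastforce simp: free_alg_def carrier_free_algebra_on)
    thus "fconst c * word u + p \<in> F \<and> P (fconst c * word u + p)"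
      using w p by (auto intro: lin)
  qed (use P0 in auto)
  thus ?thesis by blast
qed

text \<open>
  The span contains \<open>1\<close> and is stable under left multiplication by every generator.
\<close>

lemma F_normal_span: "F \<subseteq> normal_span"
proof
  fix f assume "f \<in> F"
  thus "f \<in> normal_span"
  proof (induction rule: F_induct)
    case (gen s p)
    thus ?case unfolding generators_def idx_def[symmetric] by (auto intro: normal_span_x normal_span_y normal_span_g)
  qed (auto intro: one_normal_span normal_span_lin)
qed


section \<open>Functionals on \<open>H\<close> and the two actions\<close>

lemma FR_minus: "f \<in> F \<Longrightarrow> g \<in> F \<Longrightarrow> f \<ominus>\<^bsub>free_alg D\<^esub> g = f - g"
  using FR.minus_equality[of "- g" g] by (simp add: FR.minus_eq)

lemma H_carrier: "carrier H = cls D ` F"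
  by (auto simp: hopf_alg_def ring.defs FactRing_def A_RCOSETS_def' cls_def)

lemma cls_carrier [simp]: "f \<in> F \<Longrightarrow> cls D f \<in> carrier H"
  by (auto simp: H_carrier)

lemma H_mult [simp]: "f \<in> F \<Longrightarrow> g \<in> F \<Longrightarrow> cls D f \<otimes>\<^bsub>H\<^esub> cls D g = cls D (f * g)"
  using I.rcoset_mult_add[of f g] by (simp add: hopf_alg_def ring.defs FactRing_def cls_def)

lemma H_add [simp]: "f \<in> F \<Longrightarrow> g \<in> F \<Longrightarrow> cls D f \<oplus>\<^bsub>H\<^esub> cls D g = cls D (f + g)"
  using I.a_rcos_sum[of f g] by (simp add: hopf_alg_def ring.defs FactRing_def cls_def)

lemma H_smult [simp]: "f \<in> F \<Longrightarrow> c \<odot>\<^bsub>H\<^esub> cls D f = cls D (fconst c * f)"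
  using H_mult[of "fconst c" f] by (simp add: hopf_alg_def ring.defs module.defs)

lemma cls_eq: "f \<in> F \<Longrightarrow> g \<in> F \<Longrightarrow> f - g \<in> I \<longleftrightarrow> cls D f = cls D g"
  using FR.quotient_eq_iff_same_a_r_cos[OF I.is_ideal, of f g] by (simp add: FR_minus cls_def)


abbreviation "E \<equiv> dual H"
text \<open>
  The two actions, indexed by representatives in the free algebra. On elements \<open>f\<close> of the free
  algebra products and sums are those of a type class, and every relation of \<open>H\<close> becomes an identity
  between operators on functionals.
\<close>

definition "L f \<alpha> = left_act H (cls D f) \<alpha>"
definition "R f \<alpha> = right_act H \<alpha> (cls D f)"

lemma E_outside: "\<alpha> \<in> E \<Longrightarrow> h \<notin> carrier H \<Longrightarrow> \<alpha> h = 0"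
  by (auto simp: dual_def)

lemma E_add: "\<alpha> \<in> E \<Longrightarrow> f \<in> F \<Longrightarrow> g \<in> F \<Longrightarrow> \<alpha> (cls D (f + g)) = \<alpha> (cls D f) + \<alpha> (cls D g)"
proof -
  assume a: "\<alpha> \<in> E" "f \<in> F" "g \<in> F"
  hence "\<alpha> (cls D f \<oplus>\<^bsub>H\<^esub> cls D g) = \<alpha> (cls D f) + \<alpha> (cls D g)"
    unfolding dual_def using cls_carrier by blast
  thus ?thesis using a by simp
qed

lemma E_scale: "\<alpha> \<in> E \<Longrightarrow> f \<in> F \<Longrightarrow> \<alpha> (cls D (fconst c * f)) = c * \<alpha> (cls D f)"
proof -
  assume a: "\<alpha> \<in> E" "f \<in> F"
  hence "\<alpha> (c \<odot>\<^bsub>H\<^esub> cls D f) = c * \<alpha> (cls D f)"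
    unfolding dual_def using cls_carrier by blast
  thus ?thesis using a by simp
qed

lemma E_I: assumes "\<alpha> \<in> E" "f \<in> I" shows "\<alpha> (cls D f) = 0"
proof -
  have "cls D f = cls D (fconst 0 * f)"
    using assms I_F by (subst cls_eq[symmetric]) auto
  thus ?thesis using E_scale[of \<alpha> f 0] assms I_F by simp
qed

lemma ext_H:
  assumes "\<And>h. h \<notin> carrier H \<Longrightarrow> \<alpha> h = \<beta> h" "\<And>f. f \<in> F \<Longrightarrow> \<alpha> (cls D f) = \<beta> (cls D f)"
  shows "\<alpha> = \<beta>"
proof
  fix h show "\<alpha> h = \<beta> h"
  proof (cases "h \<in> carrier H")
    case True
    then obtain f where "f \<in> F" "h = cls D f" by (auto simp: H_carrier)
    thus ?thesis using assms(2) by simp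
  qed (rule assms(1))
qed

lemma E_memI:
  assumes 1: "\<And>h. h \<notin> carrier H \<Longrightarrow> \<alpha> h = 0"
    and 2: "\<And>f g. f \<in> F \<Longrightarrow> g \<in> F \<Longrightarrow> \<alpha> (cls D (f + g)) = \<alpha> (cls D f) + \<alpha> (cls D g)"
    and 3: "\<And>c f. f \<in> F \<Longrightarrow> \<alpha> (cls D (fconst c * f)) = c * \<alpha> (cls D f)"
  shows "\<alpha> \<in> E"
  unfolding dual_def
proof (intro CollectI conjI allI ballI impI)
  fix h k c assume "h \<in> carrier H" "k \<in> carrier H"
  then obtain f g where "f \<in> F" "h = cls D f" "g \<in> F" "k = cls D g"
    unfolding H_carrier by blast
  thus "\<alpha> (h \<oplus>\<^bsub>H\<^esub> k) = \<alpha> h + \<alpha> k" by (simp add: 2)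
next
  fix h c assume "h \<in> carrier H"
  then obtain f where "f \<in> F" "h = cls D f" unfolding H_carrier by blast
  thus "\<alpha> (c \<odot>\<^bsub>H\<^esub> h) = c * \<alpha> h" by (simp add: 3)
qed (rule 1)

lemma E_ext: "\<alpha> \<in> E \<Longrightarrow> \<beta> \<in> E \<Longrightarrow> (\<And>f. f \<in> F \<Longrightarrow> \<alpha> (cls D f) = \<beta> (cls D f)) \<Longrightarrow> \<alpha> = \<beta>"
  by (rule ext_H) (simp_all add: E_outside)

lemma E_subspace: "fun_space.subspace E"
proof (rule fun_space.subspaceI)
  show "0 \<in> E" by (rule E_memI) auto
  show "\<alpha> + \<beta> \<in> E" if "\<alpha> \<in> E" "\<beta> \<in> E" for \<alpha> \<beta>
    using that by (intro E_memI) (simp_all add: E_outside E_add E_scale distrib_left)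
  show "fscale c \<alpha> \<in> E" if "\<alpha> \<in> E" for c \<alpha>
    using that by (intro E_memI) (simp_all add: E_outside E_add E_scale distrib_left fscale_def)
qed

lemma L_apply [simp]: "f \<in> F \<Longrightarrow> k \<in> F \<Longrightarrow> L f \<alpha> (cls D k) = \<alpha> (cls D (k * f))"
  by (simp add: L_def left_act_def)

lemma R_apply [simp]: "f \<in> F \<Longrightarrow> k \<in> F \<Longrightarrow> R f \<alpha> (cls D k) = \<alpha> (cls D (f * k))"
  by (simp add: R_def right_act_def)

lemma LR_outside: "h \<notin> carrier H \<Longrightarrow> L f \<alpha> h = 0" "h \<notin> carrier H \<Longrightarrow> R f \<alpha> h = 0"
  by (auto simp: L_def R_def left_act_def right_act_def)

lemma L_E [simp, intro]: assumes "f \<in> F" "\<alpha> \<in> E" shows "L f \<alpha> \<in> E"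
  by (rule E_memI)
     (use assms in \<open>auto simp: LR_outside distrib_right mult.assoc E_add E_scale\<close>)

lemma R_E [simp, intro]: assumes "f \<in> F" "\<alpha> \<in> E" shows "R f \<alpha> \<in> E"
  by (rule E_memI)
     (use assms in \<open>auto simp: LR_outside distrib_left fconst_left_commute E_add E_scale\<close>)

lemma L_mult: "f \<in> F \<Longrightarrow> g \<in> F \<Longrightarrow> L (f * g) \<alpha> = L f (L g \<alpha>)"
  by (rule ext_H) (auto simp: LR_outside mult.assoc)

lemma R_mult: "f \<in> F \<Longrightarrow> g \<in> F \<Longrightarrow> R (f * g) \<alpha> = R g (R f \<alpha>)"
  by (rule ext_H) (auto simp: LR_outside mult.assoc)

lemma L_R_commute: "f \<in> F \<Longrightarrow> g \<in> F \<Longrightarrow> L f (R g \<alpha>) = R g (L f \<alpha>)"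
  by (rule ext_H) (auto simp: LR_outside mult.assoc)

lemma LR_linear:
  "L f (\<alpha> + \<beta>) = L f \<alpha> + L f \<beta>" "L f (fscale c \<alpha>) = fscale c (L f \<alpha>)" "L f 0 = 0"
  "R f (\<alpha> + \<beta>) = R f \<alpha> + R f \<beta>" "R f (fscale c \<alpha>) = fscale c (R f \<alpha>)" "R f 0 = 0"
  by (auto simp: L_def R_def left_act_def right_act_def fscale_def fun_eq_iff)

lemma LR_linear_arg:
  assumes "\<alpha> \<in> E" "f \<in> F"
  shows "g \<in> F \<Longrightarrow> L (f + g) \<alpha> = L f \<alpha> + L g \<alpha>" "L (fconst c * f) \<alpha> = fscale c (L f \<alpha>)"
    "L 1 \<alpha> = \<alpha>"
    "g \<in> F \<Longrightarrow> R (f + g) \<alpha> = R f \<alpha> + R g \<alpha>" "R (fconst c * f) \<alpha> = fscale c (R f \<alpha>)"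
    "R 1 \<alpha> = \<alpha>"
  using assms
  by (auto intro!: ext_H simp: LR_outside distrib_left distrib_right E_add E_scale E_outside
       fconst_left_commute mult.assoc fscale_def)

lemma LR_ideal:
  assumes "\<alpha> \<in> E" "f \<in> I"
  shows "L f \<alpha> = 0" "R f \<alpha> = 0"
  using assms I_F[of f]
  by (auto intro!: ext_H simp: LR_outside E_I I_closed)

lemma LR_cong:
  assumes "\<alpha> \<in> E" "f \<in> F" "g \<in> F" "f - g \<in> I"
  shows "L f \<alpha> = L g \<alpha>" "R f \<alpha> = R g \<alpha>"
  using LR_linear_arg(1,4)[of \<alpha> "f - g" g] LR_ideal[of \<alpha> "f - g"] assms by auto

lemma propor_apply:
  assumes "f \<propto> g" "\<alpha> \<in> E"
  shows "\<exists>c. \<alpha> (cls D f) = c * \<alpha> (cls D g)"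
proof -
  from assms obtain c where c: "f - fconst c * g \<in> I" and F: "f \<in> F" "g \<in> F"
    by (auto simp: propor_def)
  hence "cls D f = cls D (fconst c * g)" by (subst cls_eq[symmetric]) auto
  thus ?thesis using E_scale F assms by auto
qed

lemma dual_lift:
  assumes "\<And>f g. f \<in> F \<Longrightarrow> g \<in> F \<Longrightarrow> \<phi> (f + g) = \<phi> f + \<phi> g"
    "\<And>c f. f \<in> F \<Longrightarrow> \<phi> (fconst c * f) = c * \<phi> f" "\<And>f. f \<in> I \<Longrightarrow> \<phi> f = (0 :: 'k)"
  obtains \<alpha> where "\<alpha> \<in> E" "\<And>f. f \<in> F \<Longrightarrow> \<alpha> (cls D f) = \<phi> f"
proof -
  define rp where "rp h = (SOME f. f \<in> F \<and> cls D f = h)" for h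
  define \<alpha> where "\<alpha> h = (if h \<in> carrier H then \<phi> (rp h) else 0)" for h
  have \<alpha>: "\<alpha> (cls D f) = \<phi> f" if f: "f \<in> F" for f
  proof -
    have rp: "rp (cls D f) \<in> F \<and> cls D (rp (cls D f)) = cls D f"
      unfolding rp_def by (rule someI[of _ f]) (use f in auto)
    hence "rp (cls D f) - f \<in> I" using cls_eq f by blast
    from assms(3)[OF this] assms(1)[OF _ f, of "rp (cls D f) - f"] rp f
    have "\<phi> (rp (cls D f)) = \<phi> f" by simp
    thus ?thesis using f by (simp add: \<alpha>_def)
  qed
  have "\<alpha> \<in> E" by (rule E_memI) (use assms in \<open>auto simp: \<alpha>, auto simp: \<alpha>_def\<close>)
  thus ?thesis using \<alpha> that by blast
qed

lemma E_zero_on_words: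
  assumes \<alpha>: "\<alpha> \<in> E"
    and z: "\<And>w u g. set w \<subseteq> idx \<Longrightarrow> set u \<subseteq> idx \<Longrightarrow> g \<in> G \<Longrightarrow> \<alpha> (cls D (x_word w * y_word u * var_g g)) = 0"
  shows "\<alpha> = 0"
proof (rule E_ext[OF \<alpha> fun_space.subspace_0[OF E_subspace]])
  fix f assume "f \<in> F"
  hence "f \<in> normal_span" using F_normal_span by blast
  hence "f \<in> F \<and> \<alpha> (cls D f) = 0"
    unfolding normal_span_def
  proof (induction rule: FA.span_induct_alt)
    case base thus ?case using E_I[OF \<alpha> I_closed(4)] by simp
  next
    case (step c x y)
    have "x \<in> F \<and> \<alpha> (cls D x) = 0" using step(1) E_I[OF \<alpha>] I_F z by auto
    thus ?case using step \<alpha> by (auto simp: scl_def E_add E_scale)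
  qed
  thus "\<alpha> (cls D f) = 0 (cls D f)" by simp
qed

lemma monomial_eq: "monomial D e f g = cls D ((\<Prod>k\<leftarrow>idx_list. var_x k ^ e k) * (\<Prod>k\<leftarrow>idx_list. var_y k ^ f k) * var_g g)"
  by (simp add: monomial_def idx_list_def)

text \<open>
  Straightening turns a word into a multiple of a monomial whose exponents are the letter counts;
  if some count reaches \<open>m\<^sub>k\<close> then the word already vanishes in \<open>H\<close>.
\<close>

lemma E_zero_on_monomials:
  assumes \<alpha>: "\<alpha> \<in> E"
    and z: "\<And>e f g. e \<in> exponents D \<Longrightarrow> f \<in> exponents D \<Longrightarrow> g \<in> G \<Longrightarrow> \<alpha> (monomial D e f g) = 0"
  shows "\<alpha> = 0"
proof (rule E_zero_on_words[OF \<alpha>])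
  fix w u g assume a: "set w \<subseteq> idx" "set u \<subseteq> idx" "g \<in> G"
  consider (high) k where "k \<in> idx" "mm D k \<le> count_list w k \<or> mm D k \<le> count_list u k"
    | (low) "count_list w \<in> exponents D" "count_list u \<in> exponents D"
    unfolding exponents_def idx_def[symmetric] by (auto simp: not_le) (meson not_le)+
  thus "\<alpha> (cls D (x_word w * y_word u * var_g g)) = 0"
  proof cases
    case high
    hence "x_word w \<in> I \<or> y_word u \<in> I" using x_word_high[of w k] y_word_high[of u k] a by blast
    hence "x_word w * y_word u \<in> I" using a I_closed(2)[of "y_word u" "x_word w"] I_closed(3)[of "x_word w" "y_word u"] by auto
    hence "x_word w * y_word u * var_g g \<in> I" using a by (rule_tac I_closed(3)) auto
    thus ?thesis by (rule E_I[OF \<alpha>])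
  next
    case low
    have "x_word w * y_word u * var_g g \<propto> (\<Prod>k\<leftarrow>idx_list. var_x k ^ count_list w k) *
        (\<Prod>k\<leftarrow>idx_list. var_y k ^ count_list u k) * var_g g"
      using a x_word_sort[of w] y_word_sort[of u] by (intro propor_mult_right propor_mult) auto
    from propor_apply[OF this \<alpha>] z[OF low a(3)] show ?thesis by (auto simp: monomial_eq)
  qed
qed

end

section \<open>Operators of the Verma module\<close>

lemma lookup_fconst_mult: "Poly_Mapping.lookup (fconst c * f) w = c * Poly_Mapping.lookup f w"
  unfolding fconst_def mult_map_scale_conv_mult[symmetric] by (simp add: map.rep_eq when_def)

lemma unit_group_simps [simp]:
  "carrier (unit_group :: 'k::field monoid) = {x. x \<noteq> 0}"
  "x \<otimes>\<^bsub>unit_group\<^esub> y = (x * y :: 'k)" "\<one>\<^bsub>unit_group\<^esub> = (1 :: 'k)"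
proof -
  have "\<exists>y. y * x = 1 \<and> x * y = 1" if "x \<noteq> 0" for x :: 'k
    using that by (intro exI[of _ "inverse x"]) auto
  thus "carrier (unit_group :: 'k::field monoid) = {x. x \<noteq> 0}"
    by (auto simp: unit_group_def units_of_def Units_def)
qed (auto simp: unit_group_def units_of_def)

lemma group_unit_group: "group (unit_group :: 'k::field monoid)"
proof (rule groupI)
  fix x :: 'k assume "x \<in> carrier unit_group"
  thus "\<exists>y\<in>carrier unit_group. y \<otimes>\<^bsub>unit_group\<^esub> x = \<one>\<^bsub>unit_group\<^esub>"
    by (intro bexI[of _ "inverse x"]) auto
qed auto

lemma unit_group_pow: "x [^]\<^bsub>unit_group\<^esub> (n :: nat) = (x :: 'k::field) ^ n"
  by (induction n) (auto simp: nat_pow_def)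

context simply_linked_nilpotent_datum
begin

lemma chi_mult: "i \<in> idx \<Longrightarrow> g \<in> G \<Longrightarrow> h \<in> G \<Longrightarrow> chi D i (g \<otimes>\<^bsub>grp D\<^esub> h) = chi D i g * chi D i h"
  using datum_closed(3)[of i] by (auto simp: characters_def hom_def )

lemma character_simps:
  assumes "\<gamma> \<in> characters D"
  shows "g \<in> G \<Longrightarrow> h \<in> G \<Longrightarrow> \<gamma> (g \<otimes>\<^bsub>grp D\<^esub> h) = \<gamma> g * \<gamma> h" "g \<in> G \<Longrightarrow> \<gamma> g \<noteq> 0" "\<gamma> \<one>\<^bsub>grp D\<^esub> = 1"
proof -
  show m: "g \<in> G \<Longrightarrow> h \<in> G \<Longrightarrow> \<gamma> (g \<otimes>\<^bsub>grp D\<^esub> h) = \<gamma> g * \<gamma> h" for g h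
    using assms by (auto simp: characters_def hom_def )
  show nz: "g \<in> G \<Longrightarrow> \<gamma> g \<noteq> 0" for g
    using assms by (auto simp: characters_def hom_def Pi_def)
  show "\<gamma> \<one>\<^bsub>grp D\<^esub> = 1"
    using m[of "\<one>\<^bsub>grp D\<^esub>" "\<one>\<^bsub>grp D\<^esub>"] nz[of "\<one>\<^bsub>grp D\<^esub>"] by simp
qed

abbreviation "qi i \<equiv> qq D i i"

lemma qi_power: assumes "i \<in> idx" shows "qi i ^ mm D i = 1" "qi i \<noteq> 1" "mm D i > 0"
proof -
  interpret U: group "unit_group :: 'k monoid" by (rule group_unit_group)
  have m: "2 \<le> mm D i" using m_ge_2 assms by (simp add: idx_def)
  thus "mm D i > 0" by simp
  show "qi i ^ mm D i = 1"
    using U.pow_ord_eq_1[of "qi i"] qq_nonzero[OF assms assms] by (simp add: mm_def unit_group_pow)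
  show "qi i \<noteq> 1"
  proof
    assume "qi i = 1"
    hence "mm D i = 1" using U.ord_eq_1[of 1] by (simp add: mm_def)
    thus False using m by simp
  qed
qed

lemma qq_inv: "i \<in> idx \<Longrightarrow> j \<in> idx \<Longrightarrow> i \<noteq> j \<Longrightarrow> qq D i j * qq D j i = 1"
  using chi_a[of j i] by (simp add: idx_def qq_def)

text \<open>
  The scalar by which \<open>g\<close> acts on the vector \<open>x\<^sup>e v\<close>, where \<open>v\<close> has weight \<open>\<gamma>\<close>.
\<close>

definition verma_weight :: "('g \<Rightarrow> 'k) \<Rightarrow> 'g \<Rightarrow> (nat \<Rightarrow> nat) \<Rightarrow> 'k" where
  "verma_weight \<gamma> g e = \<gamma> g * (\<Prod>k\<in>idx. chi D k g ^ e k)"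

text \<open>
  The scalar produced when \<open>x\<^sub>i\<close> is moved to its place in the ordered monomial \<open>x\<^sup>e\<close>.
\<close>

definition reorder_scalar :: "nat \<Rightarrow> (nat \<Rightarrow> nat) \<Rightarrow> 'k" where
  "reorder_scalar i e = (\<Prod>k\<in>idx \<inter> {..<i}. qq D i k ^ e k)"

text \<open>
  If \<open>y\<^sub>i v = 0\<close> and \<open>a\<^sub>i b\<^sub>i v = \<lambda> v\<close> then \<open>y\<^sub>i x\<^sub>i\<^sup>s v\<close> is this multiple of the vector with
  one factor \<open>x\<^sub>i\<close> less, where \<open>\<lambda> = \<gamma>(a\<^sub>i b\<^sub>i)\<close> and \<open>q = q\<^sub>i\<close>. The closed form solves the recursion
  \<open>c(s+1) = q c(s) - q (\<lambda> q\<^sup>2\<^sup>s - 1)\<close> with \<open>c(0) = 0\<close> by two geometric sums, and makes it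
  evident that \<open>c(s) = 0\<close> whenever \<open>q\<^sup>s = 1\<close>.
\<close>

definition lower_coeff :: "('g \<Rightarrow> 'k) \<Rightarrow> nat \<Rightarrow> nat \<Rightarrow> 'k" where
  "lower_coeff \<gamma> i s = - (qi i ^ s * (\<gamma> (aa D i \<otimes>\<^bsub>grp D\<^esub> bb D i) * ((qi i ^ s - 1) / (qi i - 1))
      - (inverse (qi i) ^ s - 1) / (inverse (qi i) - 1)))"

text \<open>
  The transposed action on coordinates: a functional \<open>\<phi>\<close> on the basis vectors \<open>[e]\<close> goes to
  \<open>[e] \<mapsto> \<phi>(s [e])\<close>. The exponents run over all functions, the vector of index \<open>e\<close> being
  cut off from its \<open>x\<^sub>i\<close>-successor wherever \<open>m\<^sub>i\<close> divides \<open>e\<^sub>i + 1\<close>; since \<open>lower_coeff\<close> vanishes at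
  multiples of \<open>m\<^sub>i\<close>, the relations hold on this whole space, without bounds on exponents. In the clause
  for \<open>y\<^sub>i\<close> the value of \<open>e\<^sub>i - 1\<close> at \<open>e\<^sub>i = 0\<close> is multiplied by \<open>0\<close>.
\<close>

fun verma_gen :: "('g \<Rightarrow> 'k) \<Rightarrow> 'g gen \<Rightarrow> ((nat \<Rightarrow> nat) \<Rightarrow> 'k) \<Rightarrow> ((nat \<Rightarrow> nat) \<Rightarrow> 'k)" where
  "verma_gen \<gamma> (GenG g) \<phi> = (\<lambda>e. verma_weight \<gamma> g e * \<phi> e)"
| "verma_gen \<gamma> (GenX i) \<phi> = (\<lambda>e. if mm D i dvd Suc (e i) then 0 else reorder_scalar i e * \<phi> (e(i := Suc (e i))))"
| "verma_gen \<gamma> (GenY i) \<phi> = (\<lambda>e. inverse (reorder_scalar i e) * lower_coeff \<gamma> i (e i) * \<phi> (e(i := e i - 1)))"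

declare verma_gen.simps [simp del]

lemma verma_gen_apply [simp]:
  "verma_gen \<gamma> (GenG g) \<phi> e = verma_weight \<gamma> g e * \<phi> e"
  "verma_gen \<gamma> (GenX i) \<phi> e = (if mm D i dvd Suc (e i) then 0 else reorder_scalar i e * \<phi> (e(i := Suc (e i))))"
  "verma_gen \<gamma> (GenY i) \<phi> e = inverse (reorder_scalar i e) * lower_coeff \<gamma> i (e i) * \<phi> (e(i := e i - 1))"
  by (simp_all add: verma_gen.simps)

lemma verma_weight_Suc: assumes "i \<in> idx" shows "verma_weight \<gamma> g (e(i := Suc (e i))) = chi D i g * verma_weight \<gamma> g e"
proof -
  have "(\<Prod>k\<in>idx. chi D k g ^ (e(i := Suc (e i))) k) = chi D i g * (\<Prod>k\<in>idx. chi D k g ^ e k)"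
    using assms by (subst (1 2) prod.remove[of _ i]) (auto intro!: prod.cong)
  thus ?thesis by (simp add: verma_weight_def)
qed

lemma reorder_scalar_Suc: assumes "j \<in> idx"
  shows "reorder_scalar i (e(j := Suc (e j))) = (if j < i then qq D i j else 1) * reorder_scalar i e"
proof (cases "j < i")
  case True
  thus ?thesis unfolding reorder_scalar_def
    using assms by (subst (1 2) prod.remove[of _ j]) (auto intro!: prod.cong)
next
  case False
  thus ?thesis unfolding reorder_scalar_def by (auto intro!: prod.cong)
qed

lemma reorder_scalar_nonzero: "i \<in> idx \<Longrightarrow> reorder_scalar i e \<noteq> 0"
  using qq_nonzero by (auto simp: reorder_scalar_def)

lemma pred_upd: "e i \<noteq> 0 \<Longrightarrow> e = (e(i := e i - 1 :: nat))(i := Suc ((e(i := e i - 1)) i))"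
  by auto

lemma verma_weight_pred:
  assumes "i \<in> idx" "g \<in> G" "e i \<noteq> 0"
  shows "verma_weight \<gamma> g (e(i := e i - 1)) = inverse (chi D i g) * verma_weight \<gamma> g e"
  using verma_weight_Suc[OF assms(1), of \<gamma> g "e(i := e i - 1)"] pred_upd[of e i] assms chi_unit[of i g]
  by (simp add: field_simps)

lemma reorder_scalar_pred:
  assumes "i \<in> idx" "j \<in> idx" "e j \<noteq> 0"
  shows "reorder_scalar i (e(j := e j - 1)) = inverse (if j < i then qq D i j else 1) * reorder_scalar i e"
  using reorder_scalar_Suc[OF assms(2), of i "e(j := e j - 1)"] pred_upd[of e j] assms qq_nonzero[of i j]
  by (auto simp: field_simps)

lemma lower_coeff_0: "lower_coeff \<gamma> i 0 = 0"
  by (simp add: lower_coeff_def)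

lemma lower_coeff_dvd: assumes "i \<in> idx" "mm D i dvd s" shows "lower_coeff \<gamma> i s = 0"
proof -
  obtain t where s: "s = mm D i * t" using assms(2) by auto
  have "qi i ^ s = 1" unfolding s by (simp add: power_mult qi_power[OF assms(1)])
  thus ?thesis by (simp add: lower_coeff_def power_inverse)
qed

lemma lower_coeff_Suc:
  assumes i: "i \<in> idx"
  shows "lower_coeff \<gamma> i (Suc s) = qi i * lower_coeff \<gamma> i s
    - qi i * (\<gamma> (aa D i \<otimes>\<^bsub>grp D\<^esub> bb D i) * qi i ^ (2 * s) - 1)"
proof -
  define q where "q = qi i"
  define r where "r = \<gamma> (aa D i \<otimes>\<^bsub>grp D\<^esub> bb D i)"
  define P where "P = q ^ s"
  have q: "q \<noteq> 0" "q \<noteq> 1" using qi_power[OF i] qq_nonzero[OF i i] by (auto simp: q_def)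
  have P: "P \<noteq> 0" using q by (simp add: P_def)
  have d: "q - 1 \<noteq> 0" "inverse q - 1 \<noteq> 0" using q by auto
  have A: "(q * P - 1) / (q - 1) = (P - 1) / (q - 1) + P"
    using d by (simp add: field_simps)
  have B: "(inverse q * inverse P - 1) / (inverse q - 1) = (inverse P - 1) / (inverse q - 1) + inverse P"
  proof -
    have "(v * u - 1) / (v - 1) = (u - 1) / (v - 1) + u" if "v - 1 \<noteq> 0" for u v :: 'k
      using that by (simp add: field_simps)
    thus ?thesis using d by blast
  qed
  have "- (q * P * (r * ((q * P - 1) / (q - 1)) - (inverse q * inverse P - 1) / (inverse q - 1)))
    = q * - (P * (r * ((P - 1) / (q - 1)) - (inverse P - 1) / (inverse q - 1))) - q * (r * P\<^sup>2 - 1)"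
  proof -
    have "- (q * P * (r * (a + P) - (b + u))) = q * - (P * (r * a - b)) - q * (r * P\<^sup>2 - P * u)" for a b u
      by (simp add: algebra_simps power2_eq_square)
    from this[of _ _ "inverse P"] show ?thesis unfolding A B using P by simp
  qed
  moreover have "q ^ (2 * s) = P\<^sup>2" by (simp add: P_def power_mult mult.commute[of 2])
  ultimately show ?thesis unfolding lower_coeff_def
    by (simp add: q_def[symmetric] r_def[symmetric] P_def power_inverse)
qed

text \<open>
  For \<open>k \<noteq> i\<close> the character \<open>\<chi>\<^sub>k\<close> is trivial on \<open>a\<^sub>i b\<^sub>i\<close>, because \<open>q\<^sub>i\<^sub>k q\<^sub>k\<^sub>i = 1\<close>. Hence the
  linking relation for \<open>i\<close> only sees the exponent of \<open>x\<^sub>i\<close>, and different indices do not interact.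
\<close>

lemma verma_weight_ab: assumes i: "i \<in> idx"
  shows "verma_weight \<gamma> (aa D i \<otimes>\<^bsub>grp D\<^esub> bb D i) e = \<gamma> (aa D i \<otimes>\<^bsub>grp D\<^esub> bb D i) * qi i ^ (2 * e i)"
proof -
  have "chi D k (aa D i \<otimes>\<^bsub>grp D\<^esub> bb D i) = (if k = i then (qi i)\<^sup>2 else 1)" if k: "k \<in> idx" for k
  proof -
    have "chi D k (bb D i) = qq D k i"
      using chi_a_b[of k i] i k by (simp add: idx_def qq_def)
    hence "chi D k (aa D i \<otimes>\<^bsub>grp D\<^esub> bb D i) = qq D i k * qq D k i"
      using chi_mult datum_closed i k by (simp add: qq_def)
    thus ?thesis using qq_inv[OF i k] by (auto simp: power2_eq_square)
  qed
  hence "(\<Prod>k\<in>idx. chi D k (aa D i \<otimes>\<^bsub>grp D\<^esub> bb D i) ^ e k) = (\<Prod>k\<in>idx. if k = i then (qi i)\<^sup>2 ^ e k else 1)"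
    by (intro prod.cong) auto
  also have "\<dots> = qi i ^ (2 * e i)" using i by (simp add: prod.delta power_mult)
  finally show ?thesis by (simp add: verma_weight_def)
qed

section \<open>The Verma module as a module over \<open>H\<close>\<close>

text \<open>
  Transposition reverses the order: the first letter of a word acts first on functionals.
\<close>

fun verma_word :: "('g \<Rightarrow> 'k) \<Rightarrow> 'g gen list \<Rightarrow> ((nat \<Rightarrow> nat) \<Rightarrow> 'k) \<Rightarrow> ((nat \<Rightarrow> nat) \<Rightarrow> 'k)" where
  "verma_word \<gamma> [] \<phi> = \<phi>"
| "verma_word \<gamma> (s # w) \<phi> = verma_word \<gamma> w (verma_gen \<gamma> s \<phi>)"

definition verma_act :: "('g \<Rightarrow> 'k) \<Rightarrow> ('g gen, 'k) free_algebra \<Rightarrow> ((nat \<Rightarrow> nat) \<Rightarrow> 'k) \<Rightarrow> ((nat \<Rightarrow> nat) \<Rightarrow> 'k)" where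
  "verma_act \<gamma> f \<phi> = (\<Sum>w\<in>Poly_Mapping.keys f. fscale (Poly_Mapping.lookup f w) (verma_word \<gamma> (letters w) \<phi>))"

lemma verma_gen_lin: "verma_gen \<gamma> s (\<phi> + \<psi>) = verma_gen \<gamma> s \<phi> + verma_gen \<gamma> s \<psi>" "verma_gen \<gamma> s (fscale c \<phi>) = fscale c (verma_gen \<gamma> s \<phi>)"
  by (cases s; auto simp: fun_eq_iff fscale_def algebra_simps)+

lemma verma_word_lin: "verma_word \<gamma> w (\<phi> + \<psi>) = verma_word \<gamma> w \<phi> + verma_word \<gamma> w \<psi>" "verma_word \<gamma> w (fscale c \<phi>) = fscale c (verma_word \<gamma> w \<phi>)"
  by (induction w arbitrary: \<phi> \<psi>) (auto simp: verma_gen_lin)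

lemma verma_act_superset:
  assumes "finite A" "Poly_Mapping.keys f \<subseteq> A"
  shows "verma_act \<gamma> f \<phi> = (\<Sum>w\<in>A. fscale (Poly_Mapping.lookup f w) (verma_word \<gamma> (letters w) \<phi>))"
  unfolding verma_act_def using assms
  by (intro sum.mono_neutral_left) (auto simp: in_keys_iff zero_fun_eq)

lemma verma_act_add: "verma_act \<gamma> (f + g) \<phi> = verma_act \<gamma> f \<phi> + verma_act \<gamma> g \<phi>"
proof -
  let ?A = "Poly_Mapping.keys f \<union> Poly_Mapping.keys g"
  have "Poly_Mapping.keys (f + g) \<subseteq> ?A" by (rule Poly_Mapping.keys_add)
  thus ?thesis
    by (subst (1 2 3) verma_act_superset[of ?A])
       (auto simp: lookup_add sum.distrib fun_space.scale_left_distrib)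
qed

lemma verma_act_fconst: "verma_act \<gamma> (fconst c * f) \<phi> = fscale c (verma_act \<gamma> f \<phi>)"
proof -
  have "Poly_Mapping.keys (fconst c * f) \<subseteq> Poly_Mapping.keys f"
    by (auto simp: in_keys_iff lookup_fconst_mult)
  thus ?thesis
    by (subst (1 2) verma_act_superset[of "Poly_Mapping.keys f"])
       (auto simp: lookup_fconst_mult fun_space.scale_sum_right)
qed

lemma verma_act_0: "verma_act \<gamma> 0 \<phi> = 0"
  by (simp add: verma_act_def)

lemma verma_act_diff: "verma_act \<gamma> (f - g) \<phi> = verma_act \<gamma> f \<phi> - verma_act \<gamma> g \<phi>"
  using verma_act_add[of \<gamma> "f - g" g \<phi>] by simp

lemma verma_act_word: "verma_act \<gamma> (word w) \<phi> = verma_word \<gamma> w \<phi>"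
  by (simp add: verma_act_def word_def)

lemma verma_act_var: "verma_act \<gamma> (fvar s) \<phi> = verma_gen \<gamma> s \<phi>"
  using verma_act_word[of \<gamma> "[s]"] by (simp add: word_def fvar_def)

lemma verma_act_1: "verma_act \<gamma> 1 \<phi> = \<phi>"
  using verma_act_word[of \<gamma> "[]"] by (simp add: word_Nil)

lemma verma_act_fconst_single: "verma_act \<gamma> (fconst c) \<phi> = fscale c \<phi>"
  using verma_act_fconst[of \<gamma> c 1 \<phi>] by (simp add: verma_act_1)

lemma verma_act_fun_lin: "verma_act \<gamma> f (\<phi> + \<psi>) = verma_act \<gamma> f \<phi> + verma_act \<gamma> f \<psi>" "verma_act \<gamma> f (fscale c \<phi>) = fscale c (verma_act \<gamma> f \<phi>)"
   "verma_act \<gamma> f 0 = 0"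
proof -
  show "verma_act \<gamma> f (\<phi> + \<psi>) = verma_act \<gamma> f \<phi> + verma_act \<gamma> f \<psi>"
    by (simp add: verma_act_def verma_word_lin fun_space.scale_right_distrib sum.distrib)
  show s: "verma_act \<gamma> f (fscale c \<phi>) = fscale c (verma_act \<gamma> f \<phi>)" for c \<phi>
    by (simp add: verma_act_def verma_word_lin fun_space.scale_sum_right mult.commute)
  show "verma_act \<gamma> f 0 = 0" using s[of 0 0] by (simp add: zero_fun_eq)
qed

lemma verma_word_append: "verma_word \<gamma> (u @ w) \<phi> = verma_word \<gamma> w (verma_word \<gamma> u \<phi>)"
  by (induction u arbitrary: \<phi>) auto

lemma verma_act_mult: "verma_act \<gamma> (f * g) \<phi> = verma_act \<gamma> g (verma_act \<gamma> f \<phi>)"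
proof (induction f rule: free_algebra_induct)
  case zero
  show ?case by (simp only: mult_zero_left verma_act_0 verma_act_fun_lin(3))
next
  case (add c u p)
  have "verma_act \<gamma> (word u * g) \<phi> = verma_act \<gamma> g (verma_word \<gamma> u \<phi>)"
  proof (induction g rule: free_algebra_induct)
    case (add d w q)
    have "word u * (fconst d * word w + q) = fconst d * word (u @ w) + word u * q"
      by (simp add: distrib_left fconst_left_commute word_append)
    thus ?case using add by (simp add: verma_act_add verma_act_fconst verma_act_word verma_word_append)
  qed (simp add: verma_act_0)
  thus ?case using add
    by (simp only: distrib_right mult.assoc verma_act_add verma_act_fconst verma_act_fun_lin verma_act_word)
qed

lemma verma_act_power: "verma_act \<gamma> (fvar s ^ n) \<phi> = (verma_gen \<gamma> s ^^ n) \<phi>"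
  by (induction n arbitrary: \<phi>) (simp_all add: verma_act_1 verma_act_mult verma_act_var funpow_swap1)

text \<open>
  Among the steps from \<open>e\<^sub>i\<close> to \<open>e\<^sub>i + n\<close> one crosses a cut of the basis.
\<close>

lemma verma_x_pow:
  "\<exists>t. 1 \<le> t \<and> t \<le> n \<and> mm D i dvd (e i + t) \<Longrightarrow> (verma_gen \<gamma> (GenX i) ^^ n) \<phi> e = 0"
proof (induction n arbitrary: e)
  case (Suc n)
  have step: "(verma_gen \<gamma> (GenX i) ^^ Suc n) \<phi> e =
      (if mm D i dvd Suc (e i) then 0 else reorder_scalar i e * (verma_gen \<gamma> (GenX i) ^^ n) \<phi> (e(i := Suc (e i))))"
    unfolding funpow.simps o_apply by (rule verma_gen_apply(2))
  show ?case
  proof (cases "mm D i dvd Suc (e i)")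
    case False
    obtain t where t: "1 \<le> t" "t \<le> Suc n" "mm D i dvd (e i + t)" using Suc.prems by blast
    hence "t \<noteq> 1" using False by auto
    hence "(verma_gen \<gamma> (GenX i) ^^ n) \<phi> (e(i := Suc (e i))) = 0"
      using t by (intro Suc.IH exI[of _ "t - 1"]) auto
    thus ?thesis unfolding step by (simp only: mult_zero_right if_cancel)
  qed (simp only: step if_True)
qed auto

lemma verma_y_pow:
  "i \<in> idx \<Longrightarrow> \<exists>t. t < n \<and> t \<le> e i \<and> mm D i dvd (e i - t) \<Longrightarrow> (verma_gen \<gamma> (GenY i) ^^ n) \<phi> e = 0"
proof (induction n arbitrary: e)
  case (Suc n)
  have step: "(verma_gen \<gamma> (GenY i) ^^ Suc n) \<phi> e =
      inverse (reorder_scalar i e) * lower_coeff \<gamma> i (e i) * (verma_gen \<gamma> (GenY i) ^^ n) \<phi> (e(i := e i - 1))"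
    unfolding funpow.simps o_apply by (rule verma_gen_apply(3))
  show ?case
  proof (cases "mm D i dvd e i")
    case True
    hence "lower_coeff \<gamma> i (e i) = 0" by (rule lower_coeff_dvd[OF Suc.prems(1)])
    thus ?thesis unfolding step by (simp only: mult_zero_left mult_zero_right)
  next
    case False
    obtain t where t: "t < Suc n" "t \<le> e i" "mm D i dvd (e i - t)" using Suc.prems by blast
    hence "t \<noteq> 0" using False by (metis diff_zero)
    hence "(verma_gen \<gamma> (GenY i) ^^ n) \<phi> (e(i := e i - 1)) = 0"
      using t by (intro Suc.IH Suc.prems(1) exI[of _ "t - 1"]) auto
    thus ?thesis unfolding step by (simp only: mult_zero_right)
  qed
qed auto

lemmas verma_act_simps = verma_act_diff verma_act_mult verma_act_fconst_single verma_act_var verma_act_1 verma_act_power verma_act_0 mult.assoc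

lemma verma_act_xx:
  assumes ij: "i \<in> idx" "j \<in> idx" "i \<noteq> j"
  shows "verma_act \<gamma> (var_x i * var_x j - fconst (qq D i j) * var_x j * var_x i) \<phi> = 0"
proof
  fix e
  have "qq D j i \<noteq> 0" "qq D i j * qq D j i = 1" "qq D j i * qq D i j = 1"
    using ij qq_nonzero qq_inv by auto
  thus "verma_act \<gamma> (var_x i * var_x j - fconst (qq D i j) * var_x j * var_x i) \<phi> e = 0 e"
    using ij by (simp add: verma_act_simps fscale_def reorder_scalar_Suc fun_upd_twist[of i j])
qed

lemma verma_act_yy:
  assumes ij: "i \<in> idx" "j \<in> idx" "i \<noteq> j"
  shows "verma_act \<gamma> (var_y i * var_y j - fconst (qq D i j) * var_y j * var_y i) \<phi> = 0"
proof
  fix e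
  have q: "qq D i j \<noteq> 0" "inverse (qq D j i) = qq D i j" "qq D j i * qq D i j = 1"
    using ij qq_nonzero qq_inv[of i j] qq_inv[of j i] by (auto simp: field_simps)
  show "verma_act \<gamma> (var_y i * var_y j - fconst (qq D i j) * var_y j * var_y i) \<phi> e = 0 e"
  proof (cases "e i = 0 \<or> e j = 0")
    case True
    thus ?thesis using ij by (auto simp: verma_act_simps fscale_def lower_coeff_0)
  next
    case False
    have "reorder_scalar i (e(j := e j - 1)) = inverse (if j < i then qq D i j else 1) * reorder_scalar i e"
      "reorder_scalar j (e(i := e i - 1)) = inverse (if i < j then qq D j i else 1) * reorder_scalar j e"
      using False reorder_scalar_pred ij by auto
    thus ?thesis using ij q
      by (simp add: verma_act_simps fscale_def fun_upd_twist[of i j] inverse_mult_distrib)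
  qed
qed

lemma verma_act_xy_distinct:
  assumes ij: "i \<in> idx" "j \<in> idx" "i \<noteq> j"
  shows "verma_act \<gamma> (var_x i * var_y j - fconst (inverse (qq D i j)) * var_y j * var_x i) \<phi> = 0"
proof
  fix e
  have q: "qq D i j \<noteq> 0" "qq D j i = inverse (qq D i j)"
    using ij qq_nonzero qq_inv[of i j] by (auto simp: field_simps)
  show "verma_act \<gamma> (var_x i * var_y j - fconst (inverse (qq D i j)) * var_y j * var_x i) \<phi> e = 0 e"
  proof (cases "e j = 0")
    case True
    thus ?thesis using ij by (simp add: verma_act_simps fscale_def lower_coeff_0)
  next
    case False
    hence "reorder_scalar i (e(j := e j - 1)) = inverse (if j < i then qq D i j else 1) * reorder_scalar i e"
      using reorder_scalar_pred ij by auto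
    thus ?thesis using ij q
      by (simp add: verma_act_simps fscale_def reorder_scalar_Suc fun_upd_twist[of i j])
  qed
qed

lemma verma_gen_yx: assumes j: "j \<in> idx"
  shows "verma_gen \<gamma> (GenY j) (verma_gen \<gamma> (GenX j) \<psi>) e = lower_coeff \<gamma> j (e j) * \<psi> e"
proof (cases "e j = 0")
  case True
  thus ?thesis by (simp add: lower_coeff_0)
next
  case False
  thus ?thesis using reorder_scalar_pred[OF j j, of e] lower_coeff_dvd[OF j, of "e j"] reorder_scalar_nonzero[OF j, of e] by simp
qed

lemma verma_gen_xy: assumes j: "j \<in> idx"
  shows "verma_gen \<gamma> (GenX j) (verma_gen \<gamma> (GenY j) \<psi>) e = lower_coeff \<gamma> j (Suc (e j)) * \<psi> e"
  using reorder_scalar_Suc[OF j, of j e] lower_coeff_dvd[OF j, of "Suc (e j)"] reorder_scalar_nonzero[OF j, of e] by simp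

text \<open>
  On a basis vector \<open>[e]\<close> the relation becomes the recursion of \<open>lower_coeff\<close>, the group term
  contributing the inhomogeneity \<open>\<lambda> q\<^sup>2\<^sup>s - 1\<close> with \<open>s = e\<^sub>i\<close>.
\<close>

lemma verma_act_xy_same:
  assumes j: "j \<in> idx"
  shows "verma_act \<gamma> (var_x j * var_y j - fconst (inverse (qi j)) * var_y j * var_x j
      - (var_g (aa D j \<otimes>\<^bsub>grp D\<^esub> bb D j) - 1)) \<phi> = 0"
proof
  fix e
  define \<mu> where "\<mu> = \<gamma> (aa D j \<otimes>\<^bsub>grp D\<^esub> bb D j) * qi j ^ (2 * e j)"
  have "verma_act \<gamma> (var_x j * var_y j - fconst (inverse (qi j)) * var_y j * var_x j
      - (var_g (aa D j \<otimes>\<^bsub>grp D\<^esub> bb D j) - 1)) \<phi> e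
    = lower_coeff \<gamma> j (e j) * \<phi> e - lower_coeff \<gamma> j (Suc (e j)) * (inverse (qi j) * \<phi> e) - (\<mu> * \<phi> e - \<phi> e)"
    by (simp add: verma_act_simps verma_gen_yx[OF j] verma_gen_xy[OF j] fscale_def verma_weight_ab[OF j] \<mu>_def del: verma_gen_apply(2,3))
  also have "\<dots> = 0"
    unfolding lower_coeff_Suc[OF j] \<mu>_def[symmetric] using qq_nonzero[OF j j] by (simp add: field_simps)
  finally show "verma_act \<gamma> (var_x j * var_y j - fconst (inverse (qi j)) * var_y j * var_x j
      - (var_g (aa D j \<otimes>\<^bsub>grp D\<^esub> bb D j) - 1)) \<phi> e = 0 e" by simp
qed

lemma verma_act_gx:
  assumes "g \<in> G" "i \<in> idx"
  shows "verma_act \<gamma> (var_g g * var_x i - fconst (chi D i g) * var_x i * var_g g) \<phi> = 0"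
proof
  fix e show "verma_act \<gamma> (var_g g * var_x i - fconst (chi D i g) * var_x i * var_g g) \<phi> e = 0 e"
    using assms by (simp add: verma_act_simps fscale_def verma_weight_Suc)
qed

lemma verma_act_gy:
  assumes "g \<in> G" "i \<in> idx"
  shows "verma_act \<gamma> (var_g g * var_y i - fconst (inverse (chi D i g)) * var_y i * var_g g) \<phi> = 0"
proof
  fix e
  show "verma_act \<gamma> (var_g g * var_y i - fconst (inverse (chi D i g)) * var_y i * var_g g) \<phi> e = 0 e"
  proof (cases "e i = 0")
    case False
    thus ?thesis using verma_weight_pred[of i g e \<gamma>] assms by (simp add: verma_act_simps fscale_def)
  qed (simp add: verma_act_simps fscale_def lower_coeff_0)
qed

lemma verma_act_gg:
  assumes \<gamma>: "\<gamma> \<in> characters D" and "g \<in> G" "h \<in> G"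
  shows "verma_act \<gamma> (var_g g * var_g h - var_g (g \<otimes>\<^bsub>grp D\<^esub> h)) \<phi> = 0"
proof
  fix e
  have "verma_weight \<gamma> (g \<otimes>\<^bsub>grp D\<^esub> h) e = verma_weight \<gamma> g e * verma_weight \<gamma> h e"
    using assms character_simps(1)[OF \<gamma>] by (simp add: verma_weight_def chi_mult power_mult_distrib prod.distrib)
  thus "verma_act \<gamma> (var_g g * var_g h - var_g (g \<otimes>\<^bsub>grp D\<^esub> h)) \<phi> e = 0 e"
    by (simp add: verma_act_simps)
qed

lemma verma_act_g1:
  assumes \<gamma>: "\<gamma> \<in> characters D"
  shows "verma_act \<gamma> (var_g \<one>\<^bsub>grp D\<^esub> - 1) \<phi> = 0"
proof
  fix e
  have "chi D k \<one>\<^bsub>grp D\<^esub> = 1" if "k \<in> idx" for k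
    using character_simps(3) datum_closed(3) that by blast
  hence "verma_weight \<gamma> \<one>\<^bsub>grp D\<^esub> e = 1" using character_simps(3)[OF \<gamma>] by (simp add: verma_weight_def)
  thus "verma_act \<gamma> (var_g \<one>\<^bsub>grp D\<^esub> - 1) \<phi> e = 0 e" by (simp add: verma_act_simps)
qed

lemma verma_act_x_power: assumes "i \<in> idx" shows "verma_act \<gamma> (var_x i ^ mm D i) \<phi> = 0"
proof
  fix e
  have lt: "e i mod mm D i < mm D i" using qi_power(3)[OF assms] by simp
  have "e i + (mm D i - e i mod mm D i) = mm D i * (e i div mm D i) + mm D i"
    using lt mult_div_mod_eq[of "mm D i" "e i"] by linarith
  hence "mm D i dvd (e i + (mm D i - e i mod mm D i))" by simp
  hence "(verma_gen \<gamma> (GenX i) ^^ mm D i) \<phi> e = 0"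
    using lt by (intro verma_x_pow exI[of _ "mm D i - e i mod mm D i"]) linarith
  thus "verma_act \<gamma> (var_x i ^ mm D i) \<phi> e = 0 e" by (simp only: verma_act_power zero_fun_apply)
qed

lemma verma_act_y_power: assumes "i \<in> idx" shows "verma_act \<gamma> (var_y i ^ mm D i) \<phi> = 0"
proof
  fix e
  have "(verma_gen \<gamma> (GenY i) ^^ mm D i) \<phi> e = 0"
    using qi_power(3)[OF assms]
    by (intro verma_y_pow assms exI[of _ "e i mod mm D i"]) (simp add: minus_mod_eq_mult_div)
  thus "verma_act \<gamma> (var_y i ^ mm D i) \<phi> e = 0 e" by (simp only: verma_act_power zero_fun_apply)
qed

text \<open>
  By this the Verma operators define a right action of \<open>H\<close> on coordinate functions.
\<close>

lemma verma_act_relations: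
  assumes \<gamma>: "\<gamma> \<in> characters D" and r: "r \<in> relations D"
  shows "verma_act \<gamma> r \<phi> = 0"
proof -
  have xy: "verma_act \<gamma> (var_x i * var_y j - fconst (inverse (qq D i j)) * var_y j * var_x i
        - (if i = j then var_g (aa D i \<otimes>\<^bsub>grp D\<^esub> bb D i) - 1 else 0)) \<phi> = 0"
    if "i \<in> idx" "j \<in> idx" for i j
  proof (cases "i = j")
    case True
    show ?thesis unfolding True by (simp only: refl if_True verma_act_xy_same[OF that(2)])
  next
    case False
    thus ?thesis by (simp only: if_False diff_zero verma_act_xy_distinct[OF that False])
  qed
  show ?thesis using r unfolding relations_def idx_def[symmetric]
    by (elim UnE; elim CollectE exE conjE singletonE; simp only: verma_act_xx verma_act_yy xy verma_act_gx verma_act_gy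
        verma_act_gg[OF \<gamma>] verma_act_g1[OF \<gamma>] verma_act_x_power verma_act_y_power refl not_False_eq_True)
qed

lemma verma_act_I:
  assumes \<gamma>: "\<gamma> \<in> characters D" and f: "f \<in> I"
  shows "verma_act \<gamma> f \<phi> = 0"
proof -
  define K where "K = {f \<in> F. \<forall>\<phi>. verma_act \<gamma> f \<phi> = 0}"
  have "ideal K (free_alg D)"
  proof (rule idealI)
    show "subgroup K (add_monoid (free_alg D))"
    proof (rule FR.add.subgroupI)
      show "K \<noteq> {}" using verma_act_0 by (auto simp: K_def)
      fix f assume f: "f \<in> K"
      have "verma_act \<gamma> (- f) \<phi> = 0" for \<phi> using verma_act_fconst[of \<gamma> "-1" f \<phi>] f by (simp add: K_def)
      moreover have "\<ominus>\<^bsub>free_alg D\<^esub> f = - f" using FR.minus_equality[of "- f" f] f by (simp add: K_def)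
      ultimately show "\<ominus>\<^bsub>free_alg D\<^esub> f \<in> K" using f by (simp add: K_def)
    qed (auto simp: K_def verma_act_add)
  qed (auto simp: K_def verma_act_mult verma_act_fun_lin intro: FR.ring_axioms)
  moreover have "relations D \<subseteq> K" using verma_act_relations[OF \<gamma>] relations_F by (auto simp: K_def)
  ultimately have "I \<subseteq> K" unfolding rel_ideal_def by (rule FR.genideal_minimal)
  thus ?thesis using f by (auto simp: K_def)
qed

section \<open>The functional of a character\<close>

text \<open>
  The equations satisfied by the functional of \<open>\<gamma>\<close>, in a form that can be found inside any
  sub-bimodule.
\<close>

definition lowest_functional :: "('g \<Rightarrow> 'k) \<Rightarrow> (('g gen, 'k) free_algebra set \<Rightarrow> 'k) \<Rightarrow> bool" where
  "lowest_functional \<gamma> \<alpha> \<longleftrightarrow> \<alpha> \<in> E \<and> (\<forall>i\<in>idx. R (var_x i) \<alpha> = 0) \<and> (\<forall>i\<in>idx. L (var_y i) \<alpha> = 0)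
     \<and> (\<forall>g\<in>G. L (var_g g) \<alpha> = fscale (\<gamma> g) \<alpha>)"

lemma lowest_functional_apply:
  assumes "lowest_functional \<gamma> \<alpha>" "f \<in> F"
  shows "i \<in> idx \<Longrightarrow> \<alpha> (cls D (var_x i * f)) = 0" "i \<in> idx \<Longrightarrow> \<alpha> (cls D (f * var_y i)) = 0"
    "g \<in> G \<Longrightarrow> \<alpha> (cls D (f * var_g g)) = \<gamma> g * \<alpha> (cls D f)"
proof -
  show "\<alpha> (cls D (var_x i * f)) = 0" if i: "i \<in> idx"
  proof -
    have "R (var_x i) \<alpha> (cls D f) = 0" using assms i by (simp add: lowest_functional_def)
    thus ?thesis using i assms by simp
  qed
  show "\<alpha> (cls D (f * var_y i)) = 0" if i: "i \<in> idx"
  proof -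
    have "L (var_y i) \<alpha> (cls D f) = 0" using assms i by (simp add: lowest_functional_def)
    thus ?thesis using i assms by simp
  qed
  show "\<alpha> (cls D (f * var_g g)) = \<gamma> g * \<alpha> (cls D f)" if i: "g \<in> G"
  proof -
    have "L (var_g g) \<alpha> (cls D f) = \<gamma> g * \<alpha> (cls D f)" using assms i by (simp add: lowest_functional_def fscale_def)
    thus ?thesis using i assms by simp
  qed
qed

lemma lowest_functional_on_words:
  assumes "lowest_functional \<gamma> \<alpha>" "set w \<subseteq> idx" "set u \<subseteq> idx" "g \<in> G"
  shows "\<alpha> (cls D (x_word w * y_word u * var_g g)) = (if w = [] \<and> u = [] then \<gamma> g * \<alpha> (cls D 1) else 0)"
proof (cases w)
  case [simp]: Nil
  show ?thesis
  proof (cases u rule: rev_cases)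
    case Nil
    thus ?thesis using lowest_functional_apply(3)[OF assms(1), of 1 g] assms by simp
  next
    case (snoc u' j)
    thus ?thesis using assms lowest_functional_apply(3)[OF assms(1), of "y_word u" g] lowest_functional_apply(2)[OF assms(1), of "y_word u'" j]
      by simp
  qed
next
  case (Cons i w')
  thus ?thesis using assms lowest_functional_apply(1)[OF assms(1), of "x_word w' * y_word u * var_g g" i]
    by (simp add: mult.assoc)
qed

text \<open>
  The functional assigns to \<open>h\<close> the coefficient of \<open>[0]\<close> in \<open>h [0]\<close>. It is killed by \<open>x\<^sub>i\<close> from
  the right because nothing is mapped by \<open>x\<^sub>i\<close> to \<open>[0]\<close>, and by \<open>y\<^sub>i\<close> from the left because
  \<open>y\<^sub>i [0] = 0\<close>.
\<close>

lemma lowest_functional_exists: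
  assumes \<gamma>: "\<gamma> \<in> characters D"
  obtains \<alpha> where "lowest_functional \<gamma> \<alpha>" "\<alpha> (cls D 1) = 1"
proof -
  \<comment> \<open>The coordinate function of \<open>[0]\<close>.\<close>
  define \<phi>0 where "\<phi>0 = (\<lambda>e :: nat \<Rightarrow> nat. if e = (\<lambda>_. 0) then 1 else (0 :: 'k))"
  define \<phi> where "\<phi> f = verma_act \<gamma> f \<phi>0 (\<lambda>_. 0)" for f
  obtain \<alpha> where \<alpha>: "\<alpha> \<in> E" "\<And>f. f \<in> F \<Longrightarrow> \<alpha> (cls D f) = \<phi> f"
    by (rule dual_lift[of \<phi>]) (auto simp: \<phi>_def verma_act_add verma_act_fconst fscale_def verma_act_I[OF \<gamma>])
  have x: "verma_gen \<gamma> (GenX i) \<phi>0 = 0" if "i \<in> idx" for i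
    by (auto simp: fun_eq_iff \<phi>0_def)
  have "lowest_functional \<gamma> \<alpha>" unfolding lowest_functional_def
  proof (intro conjI ballI \<alpha>(1))
    fix i assume i: "i \<in> idx"
    show "R (var_x i) \<alpha> = 0"
      by (rule E_ext) (use i \<alpha> x[OF i] in \<open>simp_all add: fun_space.subspace_0[OF E_subspace] \<phi>_def
          verma_act_mult verma_act_var verma_act_fun_lin\<close>)
    show "L (var_y i) \<alpha> = 0"
      by (rule E_ext) (use i \<alpha> in \<open>simp_all add: fun_space.subspace_0[OF E_subspace] \<phi>_def
          verma_act_mult verma_act_var lower_coeff_0\<close>)
  next
    fix g assume g: "g \<in> G"
    have "fscale (\<gamma> g) \<alpha> \<in> E" using E_subspace \<alpha>(1) by (rule fun_space.subspace_scale)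
    thus "L (var_g g) \<alpha> = fscale (\<gamma> g) \<alpha>"
      by (rule E_ext[rotated]) (use g \<alpha> in \<open>simp_all add: \<phi>_def
          verma_act_mult verma_act_var fscale_def verma_weight_def\<close>)
  qed
  moreover have "\<alpha> (cls D 1) = 1" using \<alpha>(2)[of 1] by (simp add: \<phi>_def verma_act_1 \<phi>0_def)
  ultimately show ?thesis using that by blast
qed

lemma lowest_functional_unique:
  assumes "lowest_functional \<gamma> \<alpha>" "lowest_functional \<gamma> \<beta>" "\<beta> (cls D 1) = 1"
  shows "\<alpha> = fscale (\<alpha> (cls D 1)) \<beta>"
proof -
  have E: "\<alpha> \<in> E" "\<beta> \<in> E" using assms by (auto simp: lowest_functional_def)
  have "\<alpha> - fscale (\<alpha> (cls D 1)) \<beta> = 0"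
  proof (rule E_zero_on_words)
    show "\<alpha> - fscale (\<alpha> (cls D 1)) \<beta> \<in> E"
      using E E_subspace by (intro fun_space.subspace_diff fun_space.subspace_scale)
  qed (use lowest_functional_on_words[OF assms(1)] lowest_functional_on_words[OF assms(2)] assms(3) in \<open>auto simp: fscale_def\<close>)
  thus ?thesis by simp
qed

text \<open>
  An ordered monomial is a product of the words that list each index as often as its exponent says.
\<close>

lemma lowest_functional_on_monomials:
  assumes "lowest_functional \<gamma> \<alpha>" "g \<in> G"
  shows "\<alpha> (monomial D e f g) = (if (\<forall>k\<in>idx. e k = 0) \<and> (\<forall>k\<in>idx. f k = 0) then \<gamma> g * \<alpha> (cls D 1) else 0)"
proof -
  define sorted_word where "sorted_word e = concat (map (\<lambda>k. replicate (e k) k) idx_list)" for e :: "nat \<Rightarrow> nat"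
  have sorted_word: "(\<Prod>i\<leftarrow>sorted_word e. z i) = (\<Prod>k\<leftarrow>idx_list. z k ^ e k)" for z :: "nat \<Rightarrow> ('g gen, 'k) free_algebra" and e
  proof -
    have "(\<Prod>i\<leftarrow>concat (map (\<lambda>k. replicate (e k) k) ks). z i) = (\<Prod>k\<leftarrow>ks. z k ^ e k)" for ks
      by (induction ks) (auto simp: prod_list_replicate)
    thus ?thesis by (simp add: sorted_word_def)
  qed
  have word_set: "set (sorted_word e) \<subseteq> idx" for e by (auto simp: sorted_word_def)
  have word_nil: "sorted_word e = [] \<longleftrightarrow> (\<forall>k\<in>idx. e k = 0)" for e by (auto simp: sorted_word_def)
  show ?thesis
    using lowest_functional_on_words[OF assms(1) word_set[of e] word_set[of f] assms(2)] by (simp add: monomial_eq sorted_word word_nil)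
qed

text \<open>
  The definite description is well defined: existence comes from the Verma module, uniqueness from
  the spanning monomials.
\<close>

lemma char_functional_lowest:
  assumes \<gamma>: "\<gamma> \<in> characters D"
  shows "lowest_functional \<gamma> (char_functional D \<gamma>)" "char_functional D \<gamma> (cls D 1) = 1"
proof -
  obtain \<alpha> where \<alpha>: "lowest_functional \<gamma> \<alpha>" "\<alpha> (cls D 1) = 1" using lowest_functional_exists[OF \<gamma>] .
  have "char_functional D \<gamma> = \<alpha>" unfolding char_functional_def idx_def[symmetric]
  proof (rule the_equality)
    show "\<alpha> \<in> dual H \<and> (\<forall>e\<in>exponents D. \<forall>f\<in>exponents D. \<forall>g\<in>G. \<alpha> (monomial D e f g) =
         (if (\<forall>k\<in>idx. e k = 0) \<and> (\<forall>k\<in>idx. f k = 0) then \<gamma> g else 0))"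
      using \<alpha> lowest_functional_on_monomials[OF \<alpha>(1)] by (auto simp: lowest_functional_def)
    fix \<beta> assume \<beta>: "\<beta> \<in> dual H \<and> (\<forall>e\<in>exponents D. \<forall>f\<in>exponents D. \<forall>g\<in>G. \<beta> (monomial D e f g) =
         (if (\<forall>k\<in>idx. e k = 0) \<and> (\<forall>k\<in>idx. f k = 0) then \<gamma> g else 0))"
    have "\<beta> - \<alpha> = 0"
    proof (rule E_zero_on_monomials)
      show "\<beta> - \<alpha> \<in> E"
        using \<alpha> \<beta> E_subspace by (intro fun_space.subspace_diff) (auto simp: lowest_functional_def)
    qed (use \<beta> lowest_functional_on_monomials[OF \<alpha>(1)] \<alpha>(2) in auto)
    thus "\<beta> = \<alpha>" by simp
  qed
  thus "lowest_functional \<gamma> (char_functional D \<gamma>)" "char_functional D \<gamma> (cls D 1) = 1" using \<alpha> by auto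
qed

end

section \<open>Eigenvectors of operators of finite order\<close>

lemma map_poly_to_ac_mult: "map_poly to_ac (p * q) = map_poly to_ac p * map_poly to_ac q"
  by (rule poly_eqI) (simp add: coeff_map_poly coeff_mult to_ac_sum)

lemma map_poly_to_ac_prod:
  assumes "\<And>x. x \<in># A \<Longrightarrow> x \<in> range to_ac"
  shows "(\<Prod>x\<in>#A. [:- x, 1:]) = map_poly to_ac (\<Prod>x\<in>#A. [:- of_ac x, 1:])"
  using assms
proof (induction A)
  case (add x A)
  have x: "to_ac (of_ac x) = x" using add.prems[of x] to_ac_of_ac by auto
  have "map_poly to_ac [:- of_ac x, 1:] = [:- x, 1:]"
    by (rule poly_eqI) (auto simp: coeff_map_poly coeff_pCons x split: nat.splits)
  thus ?case using add by (simp only: image_mset_add_mset prod_mset.add_mset map_poly_to_ac_mult) simp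
qed (simp add: map_poly_1)

text \<open>
  Over the algebraic closure the polynomial splits; all its roots are roots of unity and so lie in
  the field.
\<close>

lemma unity_poly_splits:
  assumes roots: "contains_roots_of_unity TYPE('k::field)" and m: "m > 0"
  shows "\<exists>c A. monom 1 m - 1 = smult c (\<Prod>z\<in>#A. [:- z, 1 :: 'k:])"
proof -
  define p where "p = (monom 1 m - 1 :: 'k poly)"
  define p' where "p' = (monom 1 m - 1 :: 'k alg_closure poly)"
  have coeff: "coeff p' i = to_ac (coeff p i)" for i
    by (simp add: p_def p'_def coeff_diff coeff_monom coeff_1)
  have "coeff p' m \<noteq> 0" using m by (simp add: p'_def coeff_1)
  hence "p' \<noteq> 0" by auto
  then obtain A where A: "p' = smult (lead_coeff p') (\<Prod>x\<in>#A. [:- x, 1:])"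
    using alg_closed_imp_factorization by blast
  have "x \<in> range to_ac" if "x \<in># A" for x
  proof -
    from that obtain A' where "A = add_mset x A'" by (auto dest: multi_member_split)
    hence "poly p' x = 0" by (subst A) simp
    hence "x ^ m = 1" by (simp add: p'_def poly_monom)
    thus ?thesis using roots m unfolding contains_roots_of_unity_def by blast
  qed
  hence A': "(\<Prod>x\<in>#A. [:- x, 1:]) = map_poly to_ac (\<Prod>x\<in>#A. [:- of_ac x, 1:])"
    by (rule map_poly_to_ac_prod)
  define c where "c = coeff p (degree p')"
  have "p = smult c (\<Prod>x\<in>#A. [:- of_ac x, 1:])"
  proof (rule poly_eqI)
    fix i
    have "to_ac (coeff p i) = coeff (smult (lead_coeff p') (\<Prod>x\<in>#A. [:- x, 1:])) i"
      using coeff[of i] A by simp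
    also have "\<dots> = to_ac (coeff (smult c (\<Prod>x\<in>#A. [:- of_ac x, 1:])) i)"
      unfolding A' by (simp add: coeff_map_poly coeff c_def)
    finally show "coeff p i = coeff (smult c (\<Prod>x\<in>#A. [:- of_ac x, 1:])) i"
      by (simp only: to_ac_eq_iff)
  qed
  hence "p = smult c (\<Prod>z\<in>#image_mset of_ac A. [:- z, 1:])" by (simp add: image_mset.compositionality comp_def)
  thus ?thesis unfolding p_def by blast
qed

text \<open>
  Polynomials in \<open>T\<close> are applied to \<open>v\<close>. The polynomial \<open>X\<^sup>m - 1\<close> kills \<open>v\<close> and is a product of
  linear factors; the last nonzero vector obtained while multiplying these factors up is an
  eigenvector.
\<close>

lemma eigenvector_exists:
  fixes T :: "('x \<Rightarrow> 'k::field) \<Rightarrow> ('x \<Rightarrow> 'k)"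
  assumes roots: "contains_roots_of_unity TYPE('k)" and m: "m > 0"
    and add: "\<And>u w. T (u + w) = T u + T w" and scale: "\<And>c u. T (fscale c u) = fscale c (T u)"
    and B: "fun_space.subspace B" "\<And>u. u \<in> B \<Longrightarrow> T u \<in> B"
    and v: "v \<in> B" "v \<noteq> 0" "(T ^^ m) v = v"
  shows "\<exists>u\<in>B. u \<noteq> 0 \<and> (\<exists>c. T u = fscale c u)"
proof -
  have T0: "T 0 = 0" using scale[of 0 0] by simp
  \<comment> \<open>\<open>ev p\<close> is \<open>p(T) v\<close>, evaluated by the Horner scheme.\<close>
  define ev where "ev p = fold_coeffs (\<lambda>a w. fscale a v + T w) p 0" for p
  have ev_pCons: "ev (pCons a p) = fscale a v + T (ev p)" for a p
    unfolding ev_def by (cases "a = 0 \<and> p = 0") (auto simp: T0 simp del: zero_fun_apply plus_fun_apply)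
  have ev_0: "ev 0 = 0" by (simp add: ev_def)
  have ev_add: "ev (p + q) = ev p + ev q" for p q
    by (induction p q rule: poly_induct2) (simp_all only: ev_0 ev_pCons add_pCons add fun_space.scale_left_distrib add_0_left ac_simps)
  have ev_smult: "ev (smult c p) = fscale c (ev p)" for c p
    by (induction p) (simp_all only: smult_0_right smult_pCons ev_0 ev_pCons scale fun_space.scale_right_distrib
        fun_space.scale_scale fun_space.scale_zero_right)
  have ev_factor: "ev ([:- z, 1:] * p) = T (ev p) - fscale z (ev p)" for z p
  proof -
    have "[:- z, 1:] * p = smult (- z) p + pCons 0 p" by simp
    hence "ev ([:- z, 1:] * p) = fscale (- z) (ev p) + T (ev p)"
      by (simp only: ev_add ev_smult ev_pCons fun_space.scale_zero_left add_0_left)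
    thus ?thesis by (simp only: fun_space.scale_minus_left) (simp only: uminus_add_conv_diff)
  qed
  have ev_B: "ev p \<in> B" for p
    by (induction p) (use B v in \<open>auto simp: ev_0 ev_pCons fun_space.subspace_0
        intro!: fun_space.subspace_add fun_space.subspace_scale simp del: zero_fun_apply plus_fun_apply\<close>)
  have ev_monom: "ev (monom 1 n) = (T ^^ n) v" for n
    by (induction n) (simp_all only: monom_0 monom_Suc ev_pCons ev_0 T0 fun_space.scale_one
        fun_space.scale_zero_left add_0_left add_0_right funpow.simps o_apply id_apply)
  have ev_1: "ev 1 = v" using ev_monom[of 0] by (simp add: monom_0 one_pCons)
  obtain c A where A: "monom 1 m - 1 = smult c (\<Prod>z\<in>#A. [:- z, 1 :: 'k:])"
    using unity_poly_splits[OF roots m] by blast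
  have "coeff (monom 1 m - 1 :: 'k poly) m \<noteq> 0" using m by (simp add: coeff_1)
  hence c: "c \<noteq> 0" unfolding A by auto
  have "ev (monom 1 m) = ev (monom 1 m - 1) + ev 1" using ev_add[of "monom 1 m - 1" 1] by simp
  hence "ev (monom 1 m - 1) = 0" using v(3) by (simp only: ev_monom ev_1) simp
  hence "fscale c (ev (\<Prod>z\<in>#A. [:- z, 1:])) = 0" by (simp only: A ev_smult)
  hence "ev (\<Prod>z\<in>#A. [:- z, 1:]) = 0" using c fun_space.scale_eq_0_iff by blast
  thus ?thesis
  proof (induction A)
    case empty
    thus ?case using v(2) by (simp only: image_mset_empty prod_mset.empty ev_1)
  next
    case (add z A)
    show ?case
    proof (cases "ev (\<Prod>z\<in>#A. [:- z, 1:]) = 0")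
      case False
      have "T (ev (\<Prod>z\<in>#A. [:- z, 1:])) - fscale z (ev (\<Prod>z\<in>#A. [:- z, 1:])) = 0"
        using add.prems by (simp only: image_mset_add_mset prod_mset.add_mset ev_factor)
      thus ?thesis using False ev_B by (intro bexI[of _ "ev (\<Prod>z\<in>#A. [:- z, 1:])"]) auto
    qed (rule add.IH)
  qed
qed

context simply_linked_nilpotent_datum
begin

lemma L_fconst: "\<alpha> \<in> E \<Longrightarrow> L (fconst c) \<alpha> = fscale c \<alpha>"
  using LR_linear_arg(2)[of \<alpha> 1 c] LR_linear_arg(3)[of \<alpha> 1] by simp

section \<open>Sub-bimodules of \<open>H\<^sup>*\<close>\<close>

definition subbimodule where
  "subbimodule B \<longleftrightarrow> fun_space.subspace B \<and> B \<subseteq> E \<and> (\<forall>f\<in>F. \<forall>\<beta>\<in>B. L f \<beta> \<in> B \<and> R f \<beta> \<in> B)"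

lemma subcoalgebra_subbimodule: "subcoalgebra H B \<Longrightarrow> subbimodule B"
  using subcoalgebra_stable[of H B] unfolding subbimodule_def L_def R_def
  by (auto simp: subcoalgebra_def)

lemma maximal_word:
  assumes "P []" "\<And>w. set w \<subseteq> idx \<Longrightarrow> word_bound \<le> length w \<Longrightarrow> \<not> P w"
  obtains w where "set w \<subseteq> idx" "P w" "\<And>w'. set w' \<subseteq> idx \<Longrightarrow> length w < length w' \<Longrightarrow> \<not> P w'"
proof -
  have "\<exists>w. (set w \<subseteq> idx \<and> P w) \<and> (\<forall>w'. set w' \<subseteq> idx \<and> P w' \<longrightarrow> length w' \<le> length w)"
    by (rule ex_has_greatest_nat[of _ "[]" _ word_bound]) (use assms in \<open>auto simp: not_le[symmetric] intro: less_imp_le\<close>)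
  thus ?thesis using that by (meson leD)
qed

text \<open>
  A longest \<open>y\<close>-word that does not kill \<open>v\<close> exists because long words vanish in \<open>H\<close>.
\<close>

lemma kill_y:
  assumes v: "v \<in> E" "v \<noteq> 0"
  obtains w where "set w \<subseteq> idx" "L (y_word w) v \<noteq> 0" "\<And>i. i \<in> idx \<Longrightarrow> L (var_y i) (L (y_word w) v) = 0"
proof -
  have long: "\<not> L (y_word w) v \<noteq> 0" if "set w \<subseteq> idx" "word_bound \<le> length w" for w
    using LR_ideal(1)[OF v(1) y_word_long[OF that]] by simp
  have nil: "L (y_word []) v \<noteq> 0" using v LR_linear_arg(3)[OF v(1), of 0] by (simp del: zero_fun_apply)
  obtain w where w: "set w \<subseteq> idx" "L (y_word w) v \<noteq> 0"
    and max: "\<And>w'. set w' \<subseteq> idx \<Longrightarrow> length w < length w' \<Longrightarrow> \<not> L (y_word w') v \<noteq> 0"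
    using maximal_word[of "\<lambda>w. L (y_word w) v \<noteq> 0", OF nil long] by metis
  have "L (var_y i) (L (y_word w) v) = 0" if "i \<in> idx" for i
    using max[of "i # w"] w that by (simp add: L_mult[symmetric] del: zero_fun_apply)
  thus ?thesis using w that by blast
qed

lemma kill_x:
  assumes v: "v \<in> E" "v \<noteq> 0"
  obtains w where "set w \<subseteq> idx" "R (x_word w) v \<noteq> 0" "\<And>i. i \<in> idx \<Longrightarrow> R (var_x i) (R (x_word w) v) = 0"
proof -
  have long: "\<not> R (x_word w) v \<noteq> 0" if "set w \<subseteq> idx" "word_bound \<le> length w" for w
    using LR_ideal(2)[OF v(1) x_word_long[OF that]] by simp
  have nil: "R (x_word []) v \<noteq> 0" using v LR_linear_arg(6)[OF v(1), of 0] by (simp del: zero_fun_apply)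
  obtain w where w: "set w \<subseteq> idx" "R (x_word w) v \<noteq> 0"
    and max: "\<And>w'. set w' \<subseteq> idx \<Longrightarrow> length w < length w' \<Longrightarrow> \<not> R (x_word w') v \<noteq> 0"
    using maximal_word[of "\<lambda>w. R (x_word w) v \<noteq> 0", OF nil long] by metis
  have "R (var_x i) (R (x_word w) v) = 0" if "i \<in> idx" for i
    using max[of "w @ [i]"] w that by (simp add: R_mult[symmetric] del: zero_fun_apply)
  thus ?thesis using w that by blast
qed

text \<open>
  Right multiplication by a longest \<open>x\<close>-word that does not kill \<open>\<beta>\<close> yields an element annihilated by all
  \<open>x\<^sub>i\<close>. The left conditions survive, as the two actions commute, so the result is a multiple of the
  functional of \<open>\<gamma>\<close>.
\<close>

lemma char_functional_in_subbimodule: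
  assumes B: "subbimodule B" and \<gamma>: "\<gamma> \<in> characters D" and \<beta>: "\<beta> \<in> B" "\<beta> \<noteq> 0"
    and y: "\<And>i. i \<in> idx \<Longrightarrow> L (var_y i) \<beta> = 0"
    and g: "\<And>g. g \<in> G \<Longrightarrow> L (var_g g) \<beta> = fscale (\<gamma> g) \<beta>"
  shows "char_functional D \<gamma> \<in> B"
proof -
  have "\<beta> \<in> E" using B \<beta> by (auto simp: subbimodule_def)
  then obtain w where w: "set w \<subseteq> idx" "R (x_word w) \<beta> \<noteq> 0" "\<And>i. i \<in> idx \<Longrightarrow> R (var_x i) (R (x_word w) \<beta>) = 0"
    using kill_x[OF _ \<beta>(2)] by metis
  define u where "u = R (x_word w) \<beta>"
  have uB: "u \<in> B" using B \<beta> w by (auto simp: u_def subbimodule_def)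
  have "lowest_functional \<gamma> u"
    unfolding lowest_functional_def
  proof (intro conjI ballI)
    show "u \<in> E" using uB B by (auto simp: subbimodule_def)
  next
    fix i assume "i \<in> idx"
    thus "R (var_x i) u = 0" "L (var_y i) u = 0"
      using w y by (simp_all add: u_def L_R_commute LR_linear del: zero_fun_apply)
  next
    fix h assume "h \<in> G"
    thus "L (var_g h) u = fscale (\<gamma> h) u" using g w by (simp add: u_def L_R_commute LR_linear)
  qed
  from lowest_functional_unique[OF this char_functional_lowest[OF \<gamma>]]
  have u: "u = fscale (u (cls D 1)) (char_functional D \<gamma>)" .
  have c: "u (cls D 1) \<noteq> 0"
  proof
    assume "u (cls D 1) = 0"
    with u have "u = 0" by (metis fun_space.scale_zero_left)
    thus False using w by (simp add: u_def)
  qed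
  have "char_functional D \<gamma> = fscale (inverse (u (cls D 1))) (fscale (u (cls D 1)) (char_functional D \<gamma>))" using c by simp
  also have "\<dots> = fscale (inverse (u (cls D 1))) u" using u by simp
  also have "\<dots> \<in> B" using B uB by (auto simp: subbimodule_def intro: fun_space.subspace_scale)
  finally show ?thesis .
qed

lemma L_gg:
  assumes "\<alpha> \<in> E" "g \<in> G" "h \<in> G"
  shows "L (var_g g) (L (var_g h) \<alpha>) = L (var_g (g \<otimes>\<^bsub>grp D\<^esub> h)) \<alpha>"
  using LR_cong(1)[OF assms(1) _ _ relation_in_ideal(2)[OF assms(2,3)]] assms by (simp add: L_mult)

lemma L_g1: "\<alpha> \<in> E \<Longrightarrow> L (var_g \<one>\<^bsub>grp D\<^esub>) \<alpha> = \<alpha>"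
  using LR_cong(1)[OF _ _ _ relation_in_ideal(1)] LR_linear_arg(3)[of \<alpha> 0] by simp

text \<open>
  One group element at a time: the joint eigenspace for the earlier elements is stable under the next
  one by commutativity, and that one has finite order.
\<close>

lemma simultaneous_eigenvector:
  assumes roots: "contains_roots_of_unity TYPE('k)"
    and "finite S" "S \<subseteq> G"
    and B: "fun_space.subspace B" "B \<subseteq> E" "\<And>g \<beta>. g \<in> G \<Longrightarrow> \<beta> \<in> B \<Longrightarrow> L (var_g g) \<beta> \<in> B"
    and v: "\<exists>v\<in>B. v \<noteq> 0"
  shows "\<exists>u\<in>B. u \<noteq> 0 \<and> (\<forall>g\<in>S. \<exists>c. L (var_g g) u = fscale c u)"
  using assms(2,3)
proof (induction S rule: finite_induct)
  case empty
  show ?case using v by blast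
next
  case (insert h S)
  have "S \<subseteq> G" using insert.prems by blast
  then obtain u0 where u0: "u0 \<in> B" "u0 \<noteq> 0" "\<forall>g\<in>S. \<exists>c. L (var_g g) u0 = fscale c u0"
    using insert.IH by blast
  then obtain c where c: "\<And>g. g \<in> S \<Longrightarrow> L (var_g g) u0 = fscale (c g) u0" by metis
  \<comment> \<open>The joint eigenspace of the vector found for \<open>S\<close>.\<close>
  define B' where "B' = {\<beta> \<in> B. \<forall>g\<in>S. L (var_g g) \<beta> = fscale (c g) \<beta>}"
  have B': "fun_space.subspace B'"
    using B(1) unfolding fun_space.subspace_def B'_def
    by (auto simp: LR_linear fun_space.scale_right_distrib mult.commute simp del: zero_fun_apply plus_fun_apply)
  have h: "h \<in> G" using insert by auto
  have st: "L (var_g h) \<beta> \<in> B'" if "\<beta> \<in> B'" for \<beta>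
  proof -
    have \<beta>: "\<beta> \<in> B" "\<beta> \<in> E" using that B by (auto simp: B'_def)
    have "L (var_g g) (L (var_g h) \<beta>) = fscale (c g) (L (var_g h) \<beta>)" if g: "g \<in> S" for g
    proof -
      have gG: "g \<in> G" using g insert by auto
      have "L (var_g g) (L (var_g h) \<beta>) = L (var_g h) (L (var_g g) \<beta>)"
        using \<beta> gG h by (simp add: L_gg G.m_comm)
      also have "L (var_g g) \<beta> = fscale (c g) \<beta>" using g \<open>\<beta> \<in> B'\<close> by (simp add: B'_def)
      finally show ?thesis by (simp add: LR_linear)
    qed
    thus ?thesis using B(3)[OF h] \<beta> by (simp add: B'_def)
  qed
  have pow: "(L (var_g h) ^^ n) \<beta> = L (var_g (h [^]\<^bsub>grp D\<^esub> n)) \<beta>" if "\<beta> \<in> E" for n \<beta>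
    using that h by (induction n) (simp_all add: L_g1 L_gg G.m_comm)
  have "\<exists>u\<in>B'. u \<noteq> 0 \<and> (\<exists>d. L (var_g h) u = fscale d u)"
  proof (rule eigenvector_exists[OF roots _ _ _ B' st])
    show "0 < Coset.order (grp D)" using finite_group by (simp add: G.order_gt_0_iff_finite)
    show "u0 \<in> B'" using u0 c by (simp add: B'_def)
    show "(L (var_g h) ^^ Coset.order (grp D)) u0 = u0"
      using u0 B h by (auto simp: pow G.pow_order_eq_1 L_g1)
  qed (use u0 in \<open>auto simp only: LR_linear\<close>)
  then obtain u d where "u \<in> B'" "u \<noteq> 0" "L (var_g h) u = fscale d u" by blast
  thus ?case unfolding B'_def by blast
qed

text \<open>
  The elements killed by all \<open>y\<^sub>i\<close> form a nonzero subspace. It is stable under the group, since \<open>g\<close> and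
  \<open>y\<^sub>i\<close> commute up to a nonzero scalar. A joint eigenvector in it has a weight, which is automatically
  a character.
\<close>

lemma char_functional_exists_in_subbimodule:
  assumes roots: "contains_roots_of_unity TYPE('k)"
    and B: "subbimodule B" "B \<noteq> {0}"
  shows "\<exists>\<gamma>\<in>characters D. char_functional D \<gamma> \<in> B"
proof -
  have Bs: "fun_space.subspace B" "B \<subseteq> E" "\<And>f \<beta>. f \<in> F \<Longrightarrow> \<beta> \<in> B \<Longrightarrow> L f \<beta> \<in> B"
    using B by (auto simp: subbimodule_def)
  define B0 where "B0 = {\<beta> \<in> B. \<forall>i\<in>idx. L (var_y i) \<beta> = 0}"
  have s0: "fun_space.subspace B0"
    using Bs(1) unfolding fun_space.subspace_def B0_def by (auto simp: LR_linear simp del: zero_fun_apply plus_fun_apply)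
  obtain v where v: "v \<in> B" "v \<noteq> 0" using B(2) fun_space.subspace_0[OF Bs(1)] by blast
  hence "v \<in> E" using Bs by auto
  then obtain w where w: "set w \<subseteq> idx" "L (y_word w) v \<noteq> 0" "\<And>i. i \<in> idx \<Longrightarrow> L (var_y i) (L (y_word w) v) = 0"
    using kill_y[OF _ v(2)] by metis
  hence nz: "\<exists>v\<in>B0. v \<noteq> 0" using Bs v by (intro bexI[of _ "L (y_word w) v"]) (auto simp: B0_def)
  have st: "L (var_g g) \<beta> \<in> B0" if g: "g \<in> G" and \<beta>: "\<beta> \<in> B0" for g \<beta>
  proof -
    have \<beta>E: "\<beta> \<in> E" "\<beta> \<in> B" using \<beta> Bs by (auto simp: B0_def)
    have "L (var_y i) (L (var_g g) \<beta>) = 0" if i: "i \<in> idx" for i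
    proof -
      have "L (var_g g * var_y i) \<beta> = L (fconst (inverse (chi D i g)) * (var_y i * var_g g)) \<beta>"
        using relation_in_ideal(4)[OF g i] g i by (intro LR_cong \<beta>E) (auto simp: mult.assoc)
      hence "L (var_g g) (L (var_y i) \<beta>) = fscale (inverse (chi D i g)) (L (var_y i) (L (var_g g) \<beta>))"
        using g i \<beta>E by (simp add: L_mult L_fconst)
      moreover have "L (var_y i) \<beta> = 0" using \<beta> i by (simp add: B0_def)
      ultimately have "fscale (inverse (chi D i g)) (L (var_y i) (L (var_g g) \<beta>)) = 0"
        by (simp only: LR_linear)
      thus ?thesis using chi_unit[OF i g] fun_space.scale_eq_0_iff by (metis inverse_nonzero_iff_nonzero)
    qed
    thus ?thesis using Bs \<beta>E g by (simp add: B0_def)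
  qed
  obtain u where u: "u \<in> B0" "u \<noteq> 0" "\<forall>g\<in>G. \<exists>c. L (var_g g) u = fscale c u"
    using simultaneous_eigenvector[OF roots finite_group order_refl s0 _ st nz] Bs(2) by (auto simp: B0_def)
  then obtain \<gamma> where \<gamma>: "\<And>g. g \<in> G \<Longrightarrow> L (var_g g) u = fscale (\<gamma> g) u" by metis
  have uE: "u \<in> E" "u \<in> B" using u Bs by (auto simp: B0_def)
  have cancel: "c = d" if "fscale c u = fscale d u" for c d
    using that u(2) by (metis fun_space.scale_cancel_right)
  have mult: "\<gamma> (g \<otimes>\<^bsub>grp D\<^esub> h) = \<gamma> g * \<gamma> h" if "g \<in> G" "h \<in> G" for g h
  proof (rule cancel)
    have "fscale (\<gamma> (g \<otimes>\<^bsub>grp D\<^esub> h)) u = L (var_g g) (L (var_g h) u)"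
      using \<gamma>[of "g \<otimes>\<^bsub>grp D\<^esub> h"] L_gg[OF uE(1) that] that by simp
    also have "\<dots> = fscale (\<gamma> g * \<gamma> h) u" using that by (simp add: \<gamma> LR_linear mult.commute)
    finally show "fscale (\<gamma> (g \<otimes>\<^bsub>grp D\<^esub> h)) u = fscale (\<gamma> g * \<gamma> h) u" .
  qed
  have one: "\<gamma> \<one>\<^bsub>grp D\<^esub> = 1"
    by (rule cancel) (use \<gamma>[of "\<one>\<^bsub>grp D\<^esub>"] uE in \<open>simp add: L_g1\<close>)
  have "\<gamma> g \<noteq> 0" if "g \<in> G" for g
    using mult[OF that G.inv_closed[OF that]] one that by auto
  hence "\<gamma> \<in> characters D" using mult by (auto simp: characters_def hom_def)
  moreover have "char_functional D \<gamma> \<in> B"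
    by (rule char_functional_in_subbimodule[OF B(1) \<open>\<gamma> \<in> characters D\<close> uE(2) u(2)])
       (use u \<gamma> in \<open>auto simp: B0_def\<close>)
  ultimately show ?thesis by blast
qed


section \<open>The subcoalgebras \<open>C(\<gamma>)\<close>\<close>

text \<open>
  A linear map on \<open>H\<close> is controlled by its values on the spanning products.
\<close>

lemma linear_image_span:
  assumes T: "\<And>f g. f \<in> F \<Longrightarrow> g \<in> F \<Longrightarrow> T (f + g) = T f + T g"
    "\<And>c f. f \<in> F \<Longrightarrow> T (fconst c * f) = fscale c (T f)" "\<And>f. f \<in> I \<Longrightarrow> T f = 0"
    and S: "\<And>w u g. set w \<subseteq> idx \<Longrightarrow> set u \<subseteq> idx \<Longrightarrow> g \<in> G \<Longrightarrow> T (x_word w * y_word u * var_g g) \<in> fun_space.span S"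
    and f: "f \<in> F"
  shows "T f \<in> fun_space.span S"
proof -
  have "f \<in> normal_span" using f F_normal_span by blast
  hence "f \<in> F \<and> T f \<in> fun_space.span S"
    unfolding normal_span_def
  proof (induction rule: FA.span_induct_alt)
    case base
    show ?case using T(3)[OF I_closed(4)] by (simp add: fun_space.span_zero del: zero_fun_apply)
  next
    case (step c x y)
    have "x \<in> F \<and> T x \<in> fun_space.span S"
      using step(1) T(3) S I_F fun_space.span_zero[of S] by auto
    moreover from this have "T (scl c x + y) = fscale c (T x) + T y"
      using step T(1,2) by (simp only: scl_def F_closed)
    ultimately show ?case using step(2)
        fun_space.span_add[OF fun_space.span_scale[of "T x" S c], of "T y"]
      by (simp only: scl_def F_closed simp_thms)
  qed
  thus ?thesis by blast
qed

text \<open>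
  A finite spanning set of \<open>H\<close>, which makes \<open>C(\<gamma>)\<close> finite-dimensional.
\<close>

definition short_words :: "('g gen, 'k) free_algebra set" where
  "short_words = (\<lambda>(w, u, g). x_word w * y_word u * var_g g) `
     ({w. set w \<subseteq> idx \<and> length w \<le> word_bound} \<times> {w. set w \<subseteq> idx \<and> length w \<le> word_bound} \<times> G)"

lemma finite_short_words: "finite short_words"
  unfolding short_words_def
  by (intro finite_imageI finite_cartesian_product finite_lists_length_le finite_idx finite_group)

lemma short_words_F: "short_words \<subseteq> F"
  by (auto simp: short_words_def)

lemma linear_image_finite_span:
  assumes T: "\<And>f g. f \<in> F \<Longrightarrow> g \<in> F \<Longrightarrow> T (f + g) = T f + T g"
    "\<And>c f. f \<in> F \<Longrightarrow> T (fconst c * f) = fscale c (T f)" "\<And>f. f \<in> I \<Longrightarrow> T f = 0"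
    and f: "f \<in> F"
  shows "T f \<in> fun_space.span (T ` short_words)"
proof (rule linear_image_span[OF T _ f])
  fix w u g assume a: "set w \<subseteq> idx" "set u \<subseteq> idx" "g \<in> G"
  show "T (x_word w * y_word u * var_g g) \<in> fun_space.span (T ` short_words)"
  proof (cases "length w \<le> word_bound \<and> length u \<le> word_bound")
    case True
    thus ?thesis using a by (intro fun_space.span_base) (force simp: short_words_def)
  next
    case False
    hence "x_word w \<in> I \<or> y_word u \<in> I" using x_word_long[of w] y_word_long[of u] a by auto
    hence "x_word w * y_word u \<in> I" using a I_closed(2)[of "y_word u" "x_word w"] I_closed(3)[of "x_word w" "y_word u"] by auto
    hence "x_word w * y_word u * var_g g \<in> I" using a I_closed(3) by simp
    thus ?thesis using T(3) fun_space.span_zero by metis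
  qed
qed

context
  fixes \<gamma> assumes \<gamma>: "\<gamma> \<in> characters D"
begin

abbreviation "\<Gamma> \<equiv> char_functional D \<gamma>"

lemma \<Gamma>_E: "\<Gamma> \<in> E" using char_functional_lowest(1)[OF \<gamma>] by (simp add: lowest_functional_def)

lemma C_of_eq: "C_of D \<gamma> = fun_space.span {R k (L h \<Gamma>) | h k. h \<in> F \<and> k \<in> F}"
proof -
  have "{right_act H (left_act H h \<Gamma>) k | h k. h \<in> carrier H \<and> k \<in> carrier H}
     = {R k (L h \<Gamma>) | h k. h \<in> F \<and> k \<in> F}"
    unfolding H_carrier L_def R_def by blast
  thus ?thesis by (simp only: C_of_def bi_orbit_def)
qed

lemma C_of_subbimodule: "subbimodule (C_of D \<gamma>)"
  unfolding subbimodule_def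
proof (intro conjI ballI)
  show "fun_space.subspace (C_of D \<gamma>)" unfolding C_of_eq by (rule fun_space.subspace_span)
  show "C_of D \<gamma> \<subseteq> E" unfolding C_of_eq
    by (rule fun_space.span_minimal[OF _ E_subspace]) (use \<Gamma>_E in auto)
  fix f \<beta> assume f: "f \<in> F" and \<beta>: "\<beta> \<in> C_of D \<gamma>"
  show "L f \<beta> \<in> C_of D \<gamma>" using \<beta> unfolding C_of_eq
  proof (induction rule: fun_space.span_induct_alt)
    case (step c x y)
    then obtain h k where hk: "x = R k (L h \<Gamma>)" "h \<in> F" "k \<in> F" by blast
    have "L f x = R k (L (f * h) \<Gamma>)" using hk f by (simp add: L_R_commute L_mult)
    hence "L f x \<in> fun_space.span {R k (L h \<Gamma>) | h k. h \<in> F \<and> k \<in> F}"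
      using hk f by (intro fun_space.span_base) blast
    thus ?case using step(2) unfolding LR_linear by (intro fun_space.span_add fun_space.span_scale)
  qed (simp only: LR_linear fun_space.span_zero)
  show "R f \<beta> \<in> C_of D \<gamma>" using \<beta> unfolding C_of_eq
  proof (induction rule: fun_space.span_induct_alt)
    case (step c x y)
    then obtain h k where hk: "x = R k (L h \<Gamma>)" "h \<in> F" "k \<in> F" by blast
    have "R f x = R (k * f) (L h \<Gamma>)" using hk f by (simp add: R_mult)
    hence "R f x \<in> fun_space.span {R k (L h \<Gamma>) | h k. h \<in> F \<and> k \<in> F}"
      using hk f by (intro fun_space.span_base) blast
    thus ?case using step(2) unfolding LR_linear by (intro fun_space.span_add fun_space.span_scale)
  qed (simp only: LR_linear fun_space.span_zero)
qed

lemma \<Gamma>_in_C_of: "\<Gamma> \<in> C_of D \<gamma>"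
proof -
  have "\<Gamma> = R 1 (L 1 \<Gamma>)" using LR_linear_arg(3,6)[of _ 0] \<Gamma>_E by simp
  thus ?thesis unfolding C_of_eq by (intro fun_space.span_base) blast
qed

lemma C_of_least: assumes "subbimodule B" "\<Gamma> \<in> B" shows "C_of D \<gamma> \<subseteq> B"
  unfolding C_of_eq using assms
  by (intro fun_space.span_minimal) (auto simp: subbimodule_def)

lemma \<Gamma>_nonzero: "\<Gamma> \<noteq> 0"
proof
  assume "\<Gamma> = 0"
  hence "\<Gamma> (cls D 1) = 0" by simp
  thus False using char_functional_lowest(2)[OF \<gamma>] by simp
qed

text \<open>
  Stability under both actions suffices because \<open>C(\<gamma>)\<close> is finite-dimensional: the functional
  \<open>h \<rightharpoonup> \<gamma> \<leftharpoonup> k\<close> depends linearly on each of \<open>h\<close> and \<open>k\<close>.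
\<close>

lemma C_of_subcoalgebra: "subcoalgebra H (C_of D \<gamma>)"
proof -
  define S where "S = (\<lambda>(h, k). R k (L h \<Gamma>)) ` (short_words \<times> short_words)"
  have "R k (L h \<Gamma>) \<in> fun_space.span S" if hk: "h \<in> F" "k \<in> F" for h k
  proof -
    have 1: "R k (L h' \<Gamma>) \<in> fun_space.span S" if h': "h' \<in> short_words" for h'
    proof -
      have "h' \<in> F" using h' short_words_F by auto
      hence E: "L h' \<Gamma> \<in> E" using \<Gamma>_E by auto
      have "R k (L h' \<Gamma>) \<in> fun_space.span ((\<lambda>k. R k (L h' \<Gamma>)) ` short_words)"
        by (rule linear_image_finite_span) (use E hk LR_linear_arg(4,5) LR_ideal(2) in auto)
      also have "\<dots> \<subseteq> fun_space.span S"
        by (rule fun_space.span_mono) (use h' in \<open>auto simp: S_def\<close>)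
      finally show ?thesis .
    qed
    have "R k (L h \<Gamma>) \<in> fun_space.span ((\<lambda>h. R k (L h \<Gamma>)) ` short_words)"
    proof (rule linear_image_finite_span[OF _ _ _ hk(1)])
      fix f g assume "f \<in> F" "g \<in> F"
      thus "R k (L (f + g) \<Gamma>) = R k (L f \<Gamma>) + R k (L g \<Gamma>)"
        by (simp only: LR_linear_arg(1)[OF \<Gamma>_E] LR_linear)
    next
      fix c f assume "f \<in> F"
      thus "R k (L (fconst c * f) \<Gamma>) = fscale c (R k (L f \<Gamma>))"
        by (simp only: LR_linear_arg(2)[OF \<Gamma>_E] LR_linear)
    next
      fix f assume "f \<in> I"
      thus "R k (L f \<Gamma>) = 0" by (simp only: LR_ideal(1)[OF \<Gamma>_E] LR_linear)
    qed
    also have "\<dots> \<subseteq> fun_space.span S"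
      by (rule fun_space.span_minimal[OF _ fun_space.subspace_span]) (use 1 in auto)
    finally show ?thesis .
  qed
  hence sub: "C_of D \<gamma> \<subseteq> fun_space.span S" unfolding C_of_eq
    by (intro fun_space.span_minimal fun_space.subspace_span) auto
  have fin: "finite S" unfolding S_def using finite_short_words by auto
  show ?thesis
    by (rule stable_imp_subcoalgebra[OF _ _ fin sub])
       (use C_of_subbimodule in \<open>auto simp: subbimodule_def H_carrier L_def R_def\<close>)
qed

section \<open>The left module generated by the functional of a character\<close>

text \<open>
  The span of these functionals plays the role of the \<open>d\<close>-th power of the augmentation ideal of the
  \<open>x\<close>-algebra, applied to \<open>\<Gamma>\<close>.
\<close>

definition x_tail :: "nat \<Rightarrow> (('g gen, 'k) free_algebra set \<Rightarrow> 'k) set" where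
  "x_tail d = {L (x_word w) \<Gamma> | w. set w \<subseteq> idx \<and> d \<le> length w}"

text \<open>
  Products with a nonempty \<open>y\<close>-word kill \<open>\<Gamma>\<close> and group elements act by scalars, so only \<open>x\<close>-words
  matter; the empty one contributes the multiple of \<open>\<Gamma>\<close> given by the value at \<open>1\<close>.
\<close>

lemma L_\<Gamma>_reduce:
  assumes f: "f \<in> F"
  shows "L f \<Gamma> - fscale (\<Gamma> (cls D f)) \<Gamma> \<in> fun_space.span (x_tail 1)"
proof (rule linear_image_span[OF _ _ _ _ f])
  note E = \<Gamma>_E
  fix f g assume "f \<in> F" "g \<in> F"
  thus "L (f + g) \<Gamma> - fscale (\<Gamma> (cls D (f + g))) \<Gamma> =
      L f \<Gamma> - fscale (\<Gamma> (cls D f)) \<Gamma> + (L g \<Gamma> - fscale (\<Gamma> (cls D g)) \<Gamma>)"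
    by (simp only: LR_linear_arg(1)[OF E] E_add[OF E] fun_space.scale_left_distrib) simp
next
  fix c f assume "f \<in> F"
  thus "L (fconst c * f) \<Gamma> - fscale (\<Gamma> (cls D (fconst c * f))) \<Gamma> =
      fscale c (L f \<Gamma> - fscale (\<Gamma> (cls D f)) \<Gamma>)"
    by (simp only: LR_linear_arg(2)[OF \<Gamma>_E] E_scale[OF \<Gamma>_E] fun_space.scale_right_diff_distrib fun_space.scale_scale)
next
  fix f assume "f \<in> I"
  thus "L f \<Gamma> - fscale (\<Gamma> (cls D f)) \<Gamma> = 0"
    by (simp only: LR_ideal(1)[OF \<Gamma>_E] E_I[OF \<Gamma>_E] fun_space.scale_zero_left diff_zero)
next
  fix w u g assume a: "set w \<subseteq> idx" "set u \<subseteq> idx" "g \<in> G"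
  note low = char_functional_lowest(1)[OF \<gamma>]
  have low': "\<And>g. g \<in> G \<Longrightarrow> L (var_g g) \<Gamma> = fscale (\<gamma> g) \<Gamma>" "\<And>i. i \<in> idx \<Longrightarrow> L (var_y i) \<Gamma> = 0"
    using low by (auto simp: lowest_functional_def)
  have L: "L (x_word w * y_word u * var_g g) \<Gamma> = fscale (\<gamma> g) (L (x_word w) (L (y_word u) \<Gamma>))"
    using a by (simp add: L_mult low' LR_linear)
  have v: "\<Gamma> (cls D (x_word w * y_word u * var_g g)) = (if w = [] \<and> u = [] then \<gamma> g else 0)"
    using lowest_functional_on_words[OF low a] char_functional_lowest(2)[OF \<gamma>] by simp
  have y: "L (y_word u) \<Gamma> = (if u = [] then \<Gamma> else 0)"
  proof (cases u rule: rev_cases)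
    case Nil thus ?thesis using LR_linear_arg(3)[OF \<Gamma>_E, of 0] by simp
  next
    case (snoc u' j)
    have "L (y_word u' * var_y j) \<Gamma> = L (y_word u') (L (var_y j) \<Gamma>)" using snoc a by (intro L_mult) auto
    also have "\<dots> = 0" using snoc a low'(2)[of j] LR_linear(3) by simp
    finally show ?thesis using snoc by simp
  qed
  show "L (x_word w * y_word u * var_g g) \<Gamma> - fscale (\<Gamma> (cls D (x_word w * y_word u * var_g g))) \<Gamma> \<in> fun_space.span (x_tail 1)"
  proof (cases "u = []")
    case False
    hence "L (x_word w * y_word u * var_g g) \<Gamma> - fscale (\<Gamma> (cls D (x_word w * y_word u * var_g g))) \<Gamma> = 0"
      unfolding L v y by (simp only: if_False LR_linear fun_space.scale_zero_right fun_space.scale_zero_left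
          diff_zero simp_thms)
    thus ?thesis by (simp only: fun_space.span_zero)
  next
    case u: True
    show ?thesis
    proof (cases "w = []")
      case True
      hence "L (x_word w * y_word u * var_g g) \<Gamma> - fscale (\<Gamma> (cls D (x_word w * y_word u * var_g g))) \<Gamma> = 0"
        unfolding L v y using u LR_linear_arg(3)[OF \<Gamma>_E, of 0] by simp
      thus ?thesis by (simp only: fun_space.span_zero)
    next
      case False
      hence "1 \<le> length w" by (cases w) auto
      hence "L (x_word w) \<Gamma> \<in> x_tail 1" using a by (auto simp: x_tail_def)
      moreover have "L (x_word w * y_word u * var_g g) \<Gamma> - fscale (\<Gamma> (cls D (x_word w * y_word u * var_g g))) \<Gamma>
          = fscale (\<gamma> g) (L (x_word w) \<Gamma>)"
        unfolding L v y using u False by (simp del: zero_fun_apply)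
      ultimately show ?thesis by (metis fun_space.span_base fun_space.span_scale)
    qed
  qed
qed

text \<open>
  Nakayama: \<open>\<Gamma>\<close> lies in \<open>U\<close> up to \<open>x\<close>-words of positive length applied to \<open>\<Gamma>\<close>. Substituting this into
  itself pushes the lengths up, until the words vanish.
\<close>

lemma \<Gamma>_in_submodule:
  assumes U: "fun_space.subspace U" "U \<subseteq> E" "\<And>f u. f \<in> F \<Longrightarrow> u \<in> U \<Longrightarrow> L f u \<in> U"
    and f: "L f \<Gamma> \<in> U" "f \<in> F" "\<Gamma> (cls D f) \<noteq> 0"
  shows "\<Gamma> \<in> U"
proof -
  have step0: "\<Gamma> \<in> fun_space.span (U \<union> x_tail 1)"
  proof -
    define c where "c = \<Gamma> (cls D f)"
    have "L f \<Gamma> \<in> fun_space.span (U \<union> x_tail 1)" using f(1) by (intro fun_space.span_base) blast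
    moreover have "L f \<Gamma> - fscale c \<Gamma> \<in> fun_space.span (U \<union> x_tail 1)"
      using L_\<Gamma>_reduce[OF f(2)] fun_space.span_mono[of "x_tail 1" "U \<union> x_tail 1"] unfolding c_def by blast
    ultimately have "L f \<Gamma> - (L f \<Gamma> - fscale c \<Gamma>) \<in> fun_space.span (U \<union> x_tail 1)"
      by (rule fun_space.span_diff)
    hence "fscale c \<Gamma> \<in> fun_space.span (U \<union> x_tail 1)" by (simp only: diff_diff_eq2 add_diff_cancel_left')
    hence "fscale (inverse c) (fscale c \<Gamma>) \<in> fun_space.span (U \<union> x_tail 1)"
      by (rule fun_space.span_scale)
    thus ?thesis using f(3) by (simp add: c_def)
  qed
  have map: "L (x_word w) v \<in> fun_space.span (U \<union> x_tail (Suc (length w)))"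
    if w: "set w \<subseteq> idx" and v: "v \<in> fun_space.span (U \<union> x_tail 1)" for w v
    using v
  proof (induction rule: fun_space.span_induct_alt)
    case (step c x y)
    have "L (x_word w) x \<in> fun_space.span (U \<union> x_tail (Suc (length w)))"
    proof (cases "x \<in> U")
      case True
      thus ?thesis using U(3) w by (intro fun_space.span_base) auto
    next
      case False
      then obtain w' where w': "x = L (x_word w') \<Gamma>" "set w' \<subseteq> idx" "1 \<le> length w'"
        using step(1) by (auto simp: x_tail_def)
      have "L (x_word w) x = L (x_word (w @ w')) \<Gamma>" using w w' by (simp add: L_mult)
      moreover have "L (x_word (w @ w')) \<Gamma> \<in> x_tail (Suc (length w))"
        unfolding x_tail_def using w w' by (intro CollectI exI[of _ "w @ w'"]) auto
      ultimately show ?thesis by (metis UnI2 fun_space.span_base)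
    qed
    thus ?case using step(2) unfolding LR_linear by (intro fun_space.span_add fun_space.span_scale)
  qed (simp only: LR_linear fun_space.span_zero)
  have "\<Gamma> \<in> fun_space.span (U \<union> x_tail (Suc d))" for d
  proof (induction d)
    case 0 thus ?case using step0 by simp
  next
    case (Suc d)
    have "U \<union> x_tail (Suc d) \<subseteq> fun_space.span (U \<union> x_tail (Suc (Suc d)))"
    proof
      fix x assume "x \<in> U \<union> x_tail (Suc d)"
      thus "x \<in> fun_space.span (U \<union> x_tail (Suc (Suc d)))"
      proof
        assume "x \<in> x_tail (Suc d)"
        then obtain w where w: "x = L (x_word w) \<Gamma>" "set w \<subseteq> idx" "Suc d \<le> length w" by (auto simp: x_tail_def)
        have "x \<in> fun_space.span (U \<union> x_tail (Suc (length w)))"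
          unfolding w(1) using map[OF w(2) step0] .
        moreover have "x_tail (Suc (length w)) \<subseteq> x_tail (Suc (Suc d))" using w(3) by (fastforce simp: x_tail_def)
        ultimately show ?thesis using fun_space.span_mono[of "U \<union> x_tail (Suc (length w))" "U \<union> x_tail (Suc (Suc d))"] by blast
      qed (auto intro: fun_space.span_base)
    qed
    hence "fun_space.span (U \<union> x_tail (Suc d)) \<subseteq> fun_space.span (U \<union> x_tail (Suc (Suc d)))"
      by (rule fun_space.span_minimal) (rule fun_space.subspace_span)
    thus ?case using Suc by blast
  qed
  from this[of word_bound] have "\<Gamma> \<in> fun_space.span (U \<union> x_tail (Suc word_bound))" .
  moreover have "x_tail (Suc word_bound) \<subseteq> U"
  proof
    fix x assume "x \<in> x_tail (Suc word_bound)"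
    then obtain w where w: "x = L (x_word w) \<Gamma>" "set w \<subseteq> idx" "Suc word_bound \<le> length w" by (auto simp: x_tail_def)
    hence "x = 0" using LR_ideal(1)[OF \<Gamma>_E x_word_long[OF w(2)]] by simp
    thus "x \<in> U" using fun_space.subspace_0[OF U(1)] by simp
  qed
  hence "U \<union> x_tail (Suc word_bound) = U" by blast
  ultimately show ?thesis using fun_space.span_eq_iff U(1) by metis
qed

text \<open>
  The left module \<open>H \<rightharpoonup> \<Gamma>\<close> is simple. A value of \<open>s\<close> at some \<open>k\<close> that is nonzero becomes, after
  translation by \<open>k\<close>, the value at \<open>1\<close>.
\<close>

lemma L_\<Gamma>_inverse:
  assumes s: "s = L h \<Gamma>" "h \<in> F" "s \<noteq> 0"
  obtains f where "f \<in> F" "L f s = \<Gamma>"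
proof -
  have "s \<in> E" using s \<Gamma>_E by simp
  then obtain k where k: "k \<in> F" "s (cls D k) \<noteq> 0"
    using E_ext[OF _ fun_space.subspace_0[OF E_subspace], of s] s(3) by auto
  \<comment> \<open>\<open>U\<close> is the submodule generated by \<open>s\<close>; it contains \<open>k h \<rightharpoonup> \<Gamma>\<close>, whose value at \<open>1\<close> is \<open>s(k) \<noteq> 0\<close>.\<close>
  define U where "U = {L f s | f. f \<in> F}"
  have "\<Gamma> \<in> U"
  proof (rule \<Gamma>_in_submodule[of _ "k * h"])
    show "fun_space.subspace U"
    proof (rule fun_space.subspaceI)
      show "0 \<in> U" unfolding U_def using LR_ideal(1)[OF \<open>s \<in> E\<close> I_closed(4)] by fastforce
      show "x + y \<in> U" if "x \<in> U" "y \<in> U" for x y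
      proof -
        from that obtain f g where "x = L f s" "f \<in> F" "y = L g s" "g \<in> F" unfolding U_def by blast
        moreover from this have "x + y = L (f + g) s" using LR_linear_arg(1)[OF \<open>s \<in> E\<close>] by simp
        ultimately show ?thesis unfolding U_def by blast
      qed
      show "fscale c x \<in> U" if "x \<in> U" for c x
      proof -
        from that obtain f where "x = L f s" "f \<in> F" unfolding U_def by blast
        moreover from this have "fscale c x = L (fconst c * f) s" using LR_linear_arg(2)[OF \<open>s \<in> E\<close>] by simp
        ultimately show ?thesis unfolding U_def by blast
      qed
    qed
    show "U \<subseteq> E" using \<open>s \<in> E\<close> by (auto simp: U_def)
    show "L f u \<in> U" if "f \<in> F" "u \<in> U" for f u
    proof -
      from that obtain g where "u = L g s" "g \<in> F" unfolding U_def by blast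
      moreover from this have "L f u = L (f * g) s" using that L_mult by simp
      ultimately show ?thesis unfolding U_def using that by blast
    qed
    show "L (k * h) \<Gamma> \<in> U" unfolding U_def using L_mult[OF k(1) s(2)] k(1) s(1) by auto
    show "k * h \<in> F" using k s by auto
    show "\<Gamma> (cls D (k * h)) \<noteq> 0" using k s by simp
  qed
  thus ?thesis using that by (auto simp: U_def)
qed

section \<open>Simplicity of \<open>C(\<gamma>)\<close>\<close>

text \<open>
  Elements of \<open>C(\<gamma>)\<close> are handled as lists of pairs, since the argument below minimises the number of
  terms.
\<close>

definition orbit_sum where "orbit_sum ps = (\<Sum>(s, k)\<leftarrow>ps. R k s)"

definition orbit_terms where
  "orbit_terms ps \<longleftrightarrow> (\<forall>(s, k)\<in>set ps. k \<in> F \<and> (\<exists>h\<in>F. s = L h \<Gamma>))"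

lemma orbit_sum_simps: "orbit_sum [] = 0" "orbit_sum ((s, k) # ps) = R k s + orbit_sum ps"
  by (auto simp: orbit_sum_def)

lemma orbit_terms_simps: "orbit_terms []" "orbit_terms ((s, k) # ps) \<longleftrightarrow> k \<in> F \<and> (\<exists>h\<in>F. s = L h \<Gamma>) \<and> orbit_terms ps"
  by (auto simp: orbit_terms_def)

definition map_left where "map_left f ps = map (\<lambda>(s, k). (L f s, k)) ps"

lemma map_left_simps: "map_left f [] = []" "map_left f ((s, k) # ps) = (L f s, k) # map_left f ps"
  "length (map_left f ps) = length ps"
  by (auto simp: map_left_def)

lemma map_left: assumes "f \<in> F" "orbit_terms ps" shows "orbit_terms (map_left f ps)" "orbit_sum (map_left f ps) = L f (orbit_sum ps)"
proof -
  have "orbit_terms (map_left f ps) \<and> orbit_sum (map_left f ps) = L f (orbit_sum ps)"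
    using assms(2)
  proof (induction ps)
    case (Cons p ps)
    obtain s k where p: "p = (s, k)" by force
    obtain h where h: "s = L h \<Gamma>" "h \<in> F" "k \<in> F" "orbit_terms ps" using Cons.prems by (auto simp: p orbit_terms_simps)
    have "L f s = L (f * h) \<Gamma>" using h assms L_mult by simp
    moreover have "f * h \<in> F" using h assms by auto
    ultimately have "orbit_terms (map_left f (p # ps))"
      using Cons h unfolding p map_left_simps orbit_terms_simps by blast
    moreover have "orbit_sum (map_left f (p # ps)) = L f (orbit_sum (p # ps))"
      using Cons h assms(1) by (simp only: p map_left_simps orbit_sum_simps LR_linear L_R_commute)
    ultimately show ?case by blast
  qed (simp only: map_left_simps orbit_terms_simps orbit_sum_simps LR_linear simp_thms)
  thus "orbit_terms (map_left f ps)" "orbit_sum (map_left f ps) = L f (orbit_sum ps)" by auto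
qed

lemma orbit_sum_E: "orbit_terms ps \<Longrightarrow> orbit_sum ps \<in> E"
proof (induction ps)
  case (Cons p ps)
  obtain s k where p: "p = (s, k)" by force
  have "R k s \<in> E" "orbit_sum ps \<in> E" using Cons \<Gamma>_E by (auto simp: p orbit_terms_simps)
  thus ?case using fun_space.subspace_add[OF E_subspace] by (simp only: p orbit_sum_simps)
qed (simp only: orbit_sum_simps fun_space.subspace_0[OF E_subspace])

lemma C_of_orbit_sum: "\<alpha> \<in> C_of D \<gamma> \<Longrightarrow> \<exists>ps. orbit_terms ps \<and> \<alpha> = orbit_sum ps"
  unfolding C_of_eq
proof (induction rule: fun_space.span_induct_alt)
  case base
  show ?case using orbit_sum_simps(1) orbit_terms_simps(1) by metis
next
  case (step c x y)
  then obtain h k ps where hk: "x = R k (L h \<Gamma>)" "h \<in> F" "k \<in> F" and ps: "orbit_terms ps" "y = orbit_sum ps" by blast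
  have "fscale c x + y = orbit_sum ((L (fconst c * h) \<Gamma>, k) # ps)"
    using hk ps by (simp only: orbit_sum_simps LR_linear_arg(2)[OF \<Gamma>_E] LR_linear)
  moreover have "orbit_terms ((L (fconst c * h) \<Gamma>, k) # ps)"
    using hk ps F_closed(2)[OF F_closed(5)] unfolding orbit_terms_simps by blast
  ultimately show ?case by blast
qed

text \<open>
  Minimal-length argument. Let \<open>s \<leftharpoonup> k\<close> be the first term. If \<open>s \<noteq> 0\<close> then
  \<open>s\<close> generates \<open>H \<rightharpoonup> \<Gamma>\<close>, so some \<open>f\<close> moves it to \<open>\<Gamma>\<close>. If \<open>f\<close> kills the whole sum, then the first term can be expressed by the others, and the
  sum has a shorter presentation. Otherwise the first term of the translate is \<open>\<Gamma> \<leftharpoonup> k\<close>; anything that kills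
  \<open>\<Gamma>\<close> removes this term, and either kills the whole translate or yields a shorter nonzero sum in \<open>B\<close>.
\<close>

lemma annihilated_vector:
  assumes B: "subbimodule B"
  shows "orbit_terms ps \<Longrightarrow> orbit_sum ps \<in> B \<Longrightarrow> orbit_sum ps \<noteq> 0 \<Longrightarrow>
    \<exists>\<beta>\<in>B. \<beta> \<noteq> 0 \<and> (\<forall>f\<in>F. L f \<Gamma> = 0 \<longrightarrow> L f \<beta> = 0)"
proof (induction "length ps" arbitrary: ps rule: less_induct)
  case less
  have BL: "L f \<beta> \<in> B" if "f \<in> F" "\<beta> \<in> B" for f \<beta> using B that by (auto simp: subbimodule_def)
  show ?case
  proof (cases ps)
    case Nil
    thus ?thesis using less.prems by (simp add: orbit_sum_simps)
  next
    case (Cons p qs)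
    obtain s k where p: "p = (s, k)" by force
    note ps = Cons[unfolded p]
    obtain h where h: "s = L h \<Gamma>" "h \<in> F" and k: "k \<in> F" and qs: "orbit_terms qs"
      using less.prems(1) unfolding ps orbit_terms_simps by blast
    have sE: "s \<in> E" using h \<Gamma>_E by simp
    show ?thesis
    proof (cases "s = 0")
      case True
      hence eq: "orbit_sum ps = orbit_sum qs" by (simp only: ps orbit_sum_simps LR_linear add_0_left)
      show ?thesis
        by (rule less.hyps[of qs]) (use less.prems eq qs in \<open>simp_all only: ps length_Cons lessI simp_thms\<close>)
    next
      case False
      obtain f where f: "f \<in> F" "L f s = \<Gamma>" using L_\<Gamma>_inverse[OF h False] .
      have Lf: "L f (orbit_sum ps) = R k \<Gamma> + orbit_sum (map_left f qs)"
        using f k by (simp only: ps orbit_sum_simps LR_linear L_R_commute map_left[OF f(1) qs])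
      show ?thesis
      proof (cases "L f (orbit_sum ps) = 0")
        case True
        \<comment> \<open>From \<open>f \<rightharpoonup> (\<dots>) = 0\<close> and \<open>h f \<rightharpoonup> s = s\<close> the first term is minus \<open>h f\<close> applied to the others.\<close>
        define qs' where "qs' = map_left (1 - h * f) qs"
        have hf: "h * f \<in> F" "1 - h * f \<in> F" using h f by auto
        have "L h (L f (orbit_sum ps)) = R k s + L h (L f (orbit_sum qs))"
          using f h k by (simp only: ps orbit_sum_simps LR_linear L_R_commute)
        hence Rs: "R k s = - L h (L f (orbit_sum qs))"
          using True by (simp only: LR_linear) (metis add_eq_0_iff2)
        have qE: "orbit_sum qs \<in> E" using orbit_sum_E[OF qs] .
        have "L (1 - h * f) (orbit_sum qs) + L (h * f) (orbit_sum qs) = L 1 (orbit_sum qs)"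
          using LR_linear_arg(1)[OF qE hf(2) hf(1)] by simp
        also have "\<dots> = orbit_sum qs" using LR_linear_arg(3)[OF qE hf(1)] .
        finally have "L (1 - h * f) (orbit_sum qs) = orbit_sum qs - L h (L f (orbit_sum qs))"
          using L_mult[OF h(2) f(1)] by (metis add_diff_cancel_right')
        hence eq: "orbit_sum qs' = orbit_sum ps"
          using map_left(2)[OF hf(2) qs] Rs by (simp only: qs'_def ps orbit_sum_simps) simp
        show ?thesis
          by (rule less.hyps[of qs'])
             (use less.prems eq map_left(1)[OF hf(2) qs] in \<open>simp_all only: qs'_def ps map_left_simps length_Cons lessI simp_thms\<close>)
      next
        case nz: False
        show ?thesis
        proof (cases "\<forall>f'\<in>F. L f' \<Gamma> = 0 \<longrightarrow> L f' (L f (orbit_sum ps)) = 0")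
          case True
          thus ?thesis using BL[OF f(1) less.prems(2)] nz by blast
        next
          case False
          then obtain f' where f': "f' \<in> F" "L f' \<Gamma> = 0" "L f' (L f (orbit_sum ps)) \<noteq> 0" by blast
          define qs' where "qs' = map_left f' (map_left f qs)"
          have v: "orbit_terms qs'" using map_left(1) f f' qs by (simp add: qs'_def)
          have eq: "orbit_sum qs' = L f' (L f (orbit_sum ps))"
            using f' k by (simp only: Lf LR_linear L_R_commute qs'_def map_left(2)[OF f'(1) map_left(1)[OF f(1) qs]] add_0_left)
          have "orbit_sum qs' \<in> B" unfolding eq using BL f f' less.prems by blast
          moreover have "length qs' < length ps" by (simp add: qs'_def ps map_left_simps)
          ultimately show ?thesis using less.hyps[of qs'] v f' eq by metis
        qed
      qed
    qed
  qed
qed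

text \<open>
  The elements \<open>y\<^sub>i\<close> and \<open>g - \<gamma>(g)\<close> kill \<open>\<Gamma>\<close>, hence also the vector found before.
\<close>

lemma \<Gamma>_in_subbimodule:
  assumes B: "subbimodule B" "B \<subseteq> C_of D \<gamma>" "B \<noteq> {0}"
  shows "\<Gamma> \<in> B"
proof -
  have "0 \<in> B" using B(1) fun_space.subspace_0 by (auto simp: subbimodule_def)
  then obtain \<alpha> where \<alpha>: "\<alpha> \<in> B" "\<alpha> \<noteq> 0" using B(3) by blast
  then obtain ps where "orbit_terms ps" "\<alpha> = orbit_sum ps" using C_of_orbit_sum B(2) by blast
  then obtain \<beta> where \<beta>: "\<beta> \<in> B" "\<beta> \<noteq> 0" "\<And>f. f \<in> F \<Longrightarrow> L f \<Gamma> = 0 \<Longrightarrow> L f \<beta> = 0"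
    using annihilated_vector[OF B(1), of ps] \<alpha> by blast
  have \<beta>E: "\<beta> \<in> E" using \<beta> B by (auto simp: subbimodule_def)
  have low: "\<And>g. g \<in> G \<Longrightarrow> L (var_g g) \<Gamma> = fscale (\<gamma> g) \<Gamma>" "\<And>i. i \<in> idx \<Longrightarrow> L (var_y i) \<Gamma> = 0"
    using char_functional_lowest(1)[OF \<gamma>] by (auto simp: lowest_functional_def)
  show ?thesis
  proof (rule char_functional_in_subbimodule[OF B(1) \<gamma> \<beta>(1,2)])
    show "L (var_y i) \<beta> = 0" if "i \<in> idx" for i using \<beta>(3) low(2) that by blast
    show "L (var_g g) \<beta> = fscale (\<gamma> g) \<beta>" if g: "g \<in> G" for g
    proof -
      have L: "L (fconst (- \<gamma> g) * 1 + var_g g) \<alpha> = fscale (- \<gamma> g) \<alpha> + L (var_g g) \<alpha>" if "\<alpha> \<in> E" for \<alpha>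
        using that g LR_linear_arg(1)[OF that _ var_F(1)[OF g], of "fconst (- \<gamma> g) * 1"] LR_linear_arg(2,3)[OF that F_closed(7)]
        by (simp only: F_closed)
      have "L (fconst (- \<gamma> g) * 1 + var_g g) \<Gamma> = 0"
        unfolding L[OF \<Gamma>_E] low(1)[OF g] by (simp only: fun_space.scale_minus_left add.left_inverse)
      moreover have "fconst (- \<gamma> g) * 1 + var_g g \<in> F" using g by auto
      ultimately have "fscale (- \<gamma> g) \<beta> + L (var_g g) \<beta> = 0" using \<beta>(3) L[OF \<beta>E] by metis
      thus ?thesis by (simp only: fun_space.scale_minus_left) (metis add_eq_0_iff neg_equal_iff_equal minus_minus)
    qed
  qed
qed

lemma C_of_simple: "simple_subcoalgebra H (C_of D \<gamma>)"
  unfolding simple_subcoalgebra_def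
proof (intro conjI allI impI)
  show "subcoalgebra H (C_of D \<gamma>)" by (rule C_of_subcoalgebra)
  show "C_of D \<gamma> \<noteq> {0}" using \<Gamma>_in_C_of \<Gamma>_nonzero by blast
  fix B assume B: "subcoalgebra H B \<and> B \<subseteq> C_of D \<gamma>"
  hence "subbimodule B" using subcoalgebra_subbimodule by blast
  thus "B = {0} \<or> B = C_of D \<gamma>" using \<Gamma>_in_subbimodule[of B] C_of_least[of B] B by blast
qed

end

section \<open>The coradical\<close>

text \<open>
  Any nonzero sub-bimodule contains some \<open>C(\<gamma>)\<close>.
\<close>

lemma simple_subcoalgebra_is_C_of:
  assumes roots: "contains_roots_of_unity TYPE('k)" and C: "simple_subcoalgebra H C"
  shows "\<exists>\<gamma>\<in>characters D. C = C_of D \<gamma>"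
proof -
  have "subbimodule C" "C \<noteq> {0}" using C subcoalgebra_subbimodule by (auto simp: simple_subcoalgebra_def)
  then obtain \<gamma> where \<gamma>: "\<gamma> \<in> characters D" "char_functional D \<gamma> \<in> C"
    using char_functional_exists_in_subbimodule[OF roots] by blast
  have "C_of D \<gamma> \<subseteq> C" using C_of_least[OF \<gamma>(1) \<open>subbimodule C\<close> \<gamma>(2)] .
  moreover have "C_of D \<gamma> \<noteq> {0}" using \<Gamma>_in_C_of[OF \<gamma>(1)] \<Gamma>_nonzero[OF \<gamma>(1)] by blast
  ultimately show ?thesis using C C_of_subcoalgebra[OF \<gamma>(1)] \<gamma>(1) by (auto simp: simple_subcoalgebra_def)
qed

end

theorem proposition3p8:
  fixes D :: "('g, 'k::field_char_0) datum"
  assumes "contains_roots_of_unity TYPE('k)"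
    and "simply_linked_nilpotent_datum D"
  shows "(\<forall>\<gamma>\<in>characters D. subcoalgebra (hopf_alg D) (C_of D \<gamma>))
    \<and> {C. simple_subcoalgebra (hopf_alg D) C} \<subseteq> {C_of D \<gamma> | \<gamma>. \<gamma> \<in> characters D}
    \<and> corad (hopf_alg D) = sum_of_subspaces {C_of D \<gamma> | \<gamma>. \<gamma> \<in> characters D}"
proof -
  interpret simply_linked_nilpotent_datum D by (rule assms(2))
  have "{C. simple_subcoalgebra H C} = {C_of D \<gamma> | \<gamma>. \<gamma> \<in> characters D}"
    using simple_subcoalgebra_is_C_of[OF assms(1)] C_of_simple by blast
  thus ?thesis using C_of_subcoalgebra by (auto simp: corad_def)
qed

end
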